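(* Let $A\in\mathbb{C}^{n\times n}$, $1\le k\le n$ an integer, and $a+ib\in\mathbb{C}$ with $a,b\in\mathbb{R}$. The Membership Test algorithm described in the context correctly determines membership in $\Lambda_k(A)$; that is, with $s_0,\dots,s_m$ the test points it computes, $a+ib\in\Lambda_k(A)$ if and only if for every $i\in\{0,\dots,m\}$ both $$\lambda_k(\Re(A)+s_i\Im(A))\ge a+bs_i\quad\text{and}\quad \lambda_{n-k+1}(\Re(A)+s_i\Im(A))\le a+bs_i .$$
   Context: For $A\in\mathbb{C}^{n\times n}$ put $\Re(A)=\frac12(A+A^* )$ and $\Im(A)=\frac{1}{2i}(A-A^* )$, both Hermitian. For a Hermitian $n\times n$ matrix $M$, $\lambda_1(M)\ge\dots\ge\lambda_n(M)$ are its eigenvalues with multiplicity. The rank-$k$ numerical range is $\Lambda_k(A)=\{\mu\in\mathbb{C}: \exists X\in\mathbb{C}^{n\times k} \text{ with } X^*X=I_k,\ X^*AX=\mu I_k\}$. Membership Test algorithm. Input: $A$, $k$, $a+ib$. Let $f=\det(tI_n+x\Re(A)+y\Im(A))\in\mathbb{R}[t,x,y]$ and $\ell=t+ax+by$. Let $d$ be the largest $e\in\mathbb{N}$ (including $0$) such that $\ell^e$ divides $f$, and $\tilde f=f/\ell^d$. Let $h(y)=\tilde f(-a-by,1,y)\in\mathbb{R}[y]$ and let $r_1<\dots<r_m$ be the distinct real roots of $h$. If $h$ has no real roots, set $m=0$ and $s_0=0$. Otherwise set $s_0=r_1-1$, $s_m=r_m+1$, and $s_i=(r_i+r_{i+1})/2$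 for $1\le i\le m-1$. If for some $i\in\{0,\dots,m\}$ one has $\lambda_k(\Re(A)+s_i\Im(A))<a+bs_i$ or $\lambda_{n-k+1}(\Re(A)+s_i\Im(A))>a+bs_i$, return "False" (meaning $a+ib\notin\Lambda_k(A)$); otherwise return "True" (meaning $a+ib\in\Lambda_k(A)$). *)

theory Defs
  imports
    "HOL-Computational_Algebra.Fundamental_Theorem_Algebra"
    "Jordan_Normal_Form.Schur_Decomposition"
begin

definition herm_re :: "complex mat \<Rightarrow> complex mat" where
  "herm_re A = (1 / 2) \<cdot>\<^sub>m (A + mat_adjoint A)"

definition herm_im :: "complex mat \<Rightarrow> complex mat" where
  "herm_im A = (1 / (2 * \<i>)) \<cdot>\<^sub>m (A - mat_adjoint A)"

text \<open>
  Only meant for Hermitian matrices, whose eigenvalues are real and have equal algebraic and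
  geometric multiplicities (see \<open>herm_eigvals_char_poly\<close> below); the multiset \<open>proots\<close> counts
  every root with its multiplicity. The index is 1-based: \<open>herm_eigval M 1\<close> is the largest
  eigenvalue.
\<close>

definition herm_eigvals :: "complex mat \<Rightarrow> real list" where
  "herm_eigvals M = rev (sorted_list_of_multiset (image_mset Re (proots (char_poly M))))"

definition herm_eigval :: "complex mat \<Rightarrow> nat \<Rightarrow> real" where
  "herm_eigval M j = herm_eigvals M ! (j - 1)"

definition rank_num_range :: "nat \<Rightarrow> complex mat \<Rightarrow> complex set" where
  "rank_num_range k A =
     {\<mu>. \<exists>X \<in> carrier_mat (dim_row A) k.
           mat_adjoint X * X = 1\<^sub>m k \<and> mat_adjoint X * A * X = \<mu> \<cdot>\<^sub>m 1\<^sub>m k}"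

text \<open>
  The ring \<open>R[t,x,y]\<close> is represented as \<open>R[y][x][t]\<close>: the outermost variable of the iterated
  univariate polynomial type is \<open>t\<close>, the innermost one is \<open>y\<close>.
\<close>

definition const3 :: "'a::comm_semiring_1 \<Rightarrow> 'a poly poly poly" where
  "const3 c = [:[:[:c:]:]:]"

definition var_t :: "'a::comm_semiring_1 poly poly poly" where
  "var_t = [:0, 1:]"

definition var_x :: "'a::comm_semiring_1 poly poly poly" where
  "var_x = [:[:0, 1:]:]"

definition var_y :: "'a::comm_semiring_1 poly poly poly" where
  "var_y = [:[:[:0, 1:]:]:]"

abbreviation map_poly3 :: "('a::zero \<Rightarrow> 'b::zero) \<Rightarrow> 'a poly poly poly \<Rightarrow> 'b poly poly poly" where
  "map_poly3 g \<equiv> map_poly (map_poly (map_poly g))"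

definition pencil :: "complex mat \<Rightarrow> complex poly poly poly mat" where
  "pencil A = var_t \<cdot>\<^sub>m 1\<^sub>m (dim_row A)
     + var_x \<cdot>\<^sub>m map_mat const3 (herm_re A) + var_y \<cdot>\<^sub>m map_mat const3 (herm_im A)"

text \<open>
  The determinant of the pencil has real coefficients, so taking real parts coefficientwise merely
  views it as an element of \<open>\<real>[t,x,y]\<close>; see \<open>of_real_pencil_poly\<close> below.
\<close>

definition pencil_poly :: "complex mat \<Rightarrow> real poly poly poly" where
  "pencil_poly A = map_poly3 Re (det (pencil A))"

definition test_line :: "real \<Rightarrow> real \<Rightarrow> real poly poly poly" where
  "test_line a b = var_t + const3 a * var_x + const3 b * var_y"

definition line_mult :: "complex mat \<Rightarrow> real \<Rightarrow> real \<Rightarrow> nat" where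
  "line_mult A a b = (GREATEST e. test_line a b ^ e dvd pencil_poly A)"

definition reduced_poly :: "complex mat \<Rightarrow> real \<Rightarrow> real \<Rightarrow> real poly poly poly" where
  "reduced_poly A a b =
     pencil_poly A div test_line a b ^ line_mult A a b"

text \<open>First substitute \<open>t = -a - b y\<close>, then \<open>x = 1\<close>.\<close>

definition restricted_poly :: "complex mat \<Rightarrow> real \<Rightarrow> real \<Rightarrow> real poly" where
  "restricted_poly A a b = poly (poly (reduced_poly A a b) [:[:- a, - b:]:]) 1"

definition root_list :: "complex mat \<Rightarrow> real \<Rightarrow> real \<Rightarrow> real list" where
  "root_list A a b = sorted_list_of_set {y. poly (restricted_poly A a b) y = 0}"

definition num_roots :: "complex mat \<Rightarrow> real \<Rightarrow> real \<Rightarrow> nat" where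
  "num_roots A a b = length (root_list A a b)"

text \<open>List indexing is 0-based, so the root \<open>r\<^sub>i\<close> is \<open>root_list A a b ! (i - 1)\<close>.\<close>

definition test_point :: "complex mat \<Rightarrow> real \<Rightarrow> real \<Rightarrow> nat \<Rightarrow> real" where
  "test_point A a b i =
     (let r = (\<lambda>j. root_list A a b ! (j - 1)); m = num_roots A a b in
      if m = 0 then 0
      else if i = 0 then r 1 - 1
      else if i = m then r m + 1
      else (r i + r (i + 1)) / 2)"

definition real_pencil_at :: "complex mat \<Rightarrow> real \<Rightarrow> complex mat" where
  "real_pencil_at A s = herm_re A + complex_of_real s \<cdot>\<^sub>m herm_im A"

definition membership_test :: "complex mat \<Rightarrow> nat \<Rightarrow> real \<Rightarrow> real \<Rightarrow> bool" where
  "membership_test A k a b =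
     (if \<exists>i \<in> {0..num_roots A a b}.
           herm_eigval (real_pencil_at A (test_point A a b i)) k < a + b * test_point A a b i \<or>
           herm_eigval (real_pencil_at A (test_point A a b i)) (dim_row A - k + 1)
             > a + b * test_point A a b i
      then False else True)"

lemma mat_adjoint_carrier: "A \<in> carrier_mat n m \<Longrightarrow> mat_adjoint A \<in> carrier_mat m n"
  unfolding mat_adjoint_def by (auto simp: mat_of_rows_def)

lemma mat_adjoint_index:
  fixes A :: "complex mat"
  assumes "A \<in> carrier_mat n m" "i < m" "j < n"
  shows "mat_adjoint A $$ (i, j) = cnj (A $$ (j, i))"
  using assms unfolding mat_adjoint_def by (auto simp: mat_of_rows_def)

lemma herm_re_carrier: "A \<in> carrier_mat n n \<Longrightarrow> herm_re A \<in> carrier_mat n n"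
  and herm_im_carrier: "A \<in> carrier_mat n n \<Longrightarrow> herm_im A \<in> carrier_mat n n"
  using mat_adjoint_carrier[of A n n] by (auto simp: herm_re_def herm_im_def)

lemma herm_re_cnj:
  assumes "A \<in> carrier_mat n n" "i < n" "j < n"
  shows "cnj (herm_re A $$ (i, j)) = herm_re A $$ (j, i)"
  using assms mat_adjoint_carrier[OF assms(1)]
  by (auto simp: herm_re_def mat_adjoint_index[OF assms(1)])

lemma herm_im_cnj:
  assumes "A \<in> carrier_mat n n" "i < n" "j < n"
  shows "cnj (herm_im A $$ (i, j)) = herm_im A $$ (j, i)"
  using assms mat_adjoint_carrier[OF assms(1)]
  by (auto simp: herm_im_def mat_adjoint_index[OF assms(1)] field_simps)

lemma herm_re_adjoint: "A \<in> carrier_mat n n \<Longrightarrow> mat_adjoint (herm_re A) = herm_re A"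
  and herm_im_adjoint: "A \<in> carrier_mat n n \<Longrightarrow> mat_adjoint (herm_im A) = herm_im A"
  using herm_re_carrier[of A n] herm_im_carrier[of A n]
    mat_adjoint_carrier[of "herm_re A" n n] mat_adjoint_carrier[of "herm_im A" n n]
  by (auto intro!: eq_matI simp: mat_adjoint_index[of _ n n] herm_re_cnj[of A n] herm_im_cnj[of A n])

interpretation cnj_hom: comm_ring_hom cnj
  by unfold_locales auto

interpretation cnj1: map_poly_comm_ring_hom cnj ..
interpretation cnj2: map_poly_comm_ring_hom "map_poly cnj" ..
interpretation cnj3: map_poly_comm_ring_hom "map_poly (map_poly cnj)" ..

lemma cnj_det_pencil:
  assumes A: "A \<in> carrier_mat n n"
  shows "map_poly3 cnj (det (pencil A)) = det (pencil A)"
proof -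
  have P: "pencil A \<in> carrier_mat n n"
    using A herm_re_carrier[OF A] herm_im_carrier[OF A] by (auto simp: pencil_def)
  have "map_mat (map_poly3 cnj) (pencil A) = transpose_mat (pencil A)"
  proof (rule eq_matI)
    fix i j assume "i < dim_row (transpose_mat (pencil A))" "j < dim_col (transpose_mat (pencil A))"
    then have ij: "i < n" "j < n" using P by auto
    show "map_mat (map_poly3 cnj) (pencil A) $$ (i, j) = transpose_mat (pencil A) $$ (i, j)"
      using ij A P herm_re_carrier[OF A] herm_im_carrier[OF A]
        herm_re_cnj[OF A ij] herm_im_cnj[OF A ij]
      by (auto simp: pencil_def var_t_def var_x_def var_y_def const3_def map_poly_pCons
          map_poly_simps)
  qed (use P in auto)
  then show ?thesis
    using cnj3.hom_det[of "pencil A"] det_transpose[OF P] by simp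
qed

lemma of_real_pencil_poly:
  assumes A: "A \<in> carrier_mat n n"
  shows "map_poly3 complex_of_real (pencil_poly A) = det (pencil A)"
proof (intro poly_eqI)
  fix i j l
  let ?c = "coeff (coeff (coeff (det (pencil A)) i) j) l"
  have "cnj ?c = ?c"
    using arg_cong[OF cnj_det_pencil[OF A], of "\<lambda>p. coeff (coeff (coeff p i) j) l"]
    by (simp add: coeff_map_poly)
  then show "coeff (coeff (coeff (map_poly3 complex_of_real (pencil_poly A)) i) j) l = ?c"
    by (simp add: pencil_poly_def coeff_map_poly complex_eq_iff)
qed

lemma pencil_poly_nonzero:
  assumes A: "A \<in> carrier_mat n n"
  shows "pencil_poly A \<noteq> 0"
proof
  assume "pencil_poly A = 0"
  then have 0: "det (pencil A) = 0" using of_real_pencil_poly[OF A] by simp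
  define g :: "complex poly poly \<Rightarrow> complex" where "g = (\<lambda>p. poly (poly p 0) 0)"
  interpret g: comm_ring_hom g by unfold_locales (auto simp: g_def)
  interpret G: map_poly_comm_ring_hom g ..
  have "map_mat (map_poly g) (pencil A) = [:0, 1:] \<cdot>\<^sub>m 1\<^sub>m n"
    using A herm_re_carrier[OF A] herm_im_carrier[OF A]
    by (intro eq_matI poly_eqI) (auto simp: pencil_def var_t_def var_x_def var_y_def const3_def
        g_def coeff_map_poly coeff_pCons split: nat.splits)
  then have "map_poly g (det (pencil A)) = det ([:0, 1:] \<cdot>\<^sub>m 1\<^sub>m n :: complex poly mat)"
    using G.hom_det[of "pencil A"] by simp
  then show False using 0 by (simp add: det_smult)
qed

lemma line_mult:
  assumes A: "A \<in> carrier_mat n n"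
  shows "test_line a b ^ line_mult A a b dvd pencil_poly A"
    and "test_line a b ^ e dvd pencil_poly A \<Longrightarrow> e \<le> line_mult A a b"
proof -
  have l: "test_line a b = [:[:[:0, b:], [:a:]:], 1:]"
    by (simp add: test_line_def var_t_def var_x_def var_y_def const3_def)
  have bnd: "e \<le> degree (pencil_poly A)" if "test_line a b ^ e dvd pencil_poly A" for e
    using dvd_imp_degree_le[OF that pencil_poly_nonzero[OF A]]
    by (simp add: l degree_power_eq)
  show "test_line a b ^ line_mult A a b dvd pencil_poly A"
    unfolding line_mult_def by (rule GreatestI_nat[of _ 0]) (use bnd in auto)
  show "test_line a b ^ e dvd pencil_poly A \<Longrightarrow> e \<le> line_mult A a b"
    unfolding line_mult_def by (rule Greatest_le_nat) (use bnd in auto)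
qed

lemma herm_eigenvalue_real:
  fixes M :: "complex mat"
  assumes M: "M \<in> carrier_mat n n" and h: "mat_adjoint M = M" and e: "eigenvalue M z"
  shows "z \<in> \<real>"
proof -
  from e M obtain v where v: "v \<in> carrier_vec n" "v \<noteq> 0\<^sub>v n" and ev: "M *\<^sub>v v = z \<cdot>\<^sub>v v"
    unfolding eigenvalue_def eigenvector_def by auto
  let ?q = "v \<bullet>c v"
  have Mij: "cnj (M $$ (i, j)) = M $$ (j, i)" if "i < n" "j < n" for i j
    using mat_adjoint_index[OF M, of j i] h that by simp
  have comp: "(\<Sum>j<n. M $$ (i, j) * v $ j) = z * v $ i" if "i < n" for i
    using arg_cong[OF ev, of "\<lambda>w. w $ i"] that M v
    by (auto simp: scalar_prod_def atLeast0LessThan)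
  have q: "?q = (\<Sum>i<n. v $ i * cnj (v $ i))"
    using v by (auto simp: scalar_prod_def atLeast0LessThan)
  have 1: "(\<Sum>i<n. cnj (v $ i) * (\<Sum>j<n. M $$ (i, j) * v $ j)) = z * ?q"
    unfolding q sum_distrib_left[of z] by (intro sum.cong refl) (simp add: comp)
  have "cnj (\<Sum>i<n. cnj (v $ i) * (\<Sum>j<n. M $$ (i, j) * v $ j))
      = (\<Sum>i<n. \<Sum>j<n. v $ i * (M $$ (j, i) * cnj (v $ j)))"
    unfolding cnj_sum by (simp add: Mij sum_distrib_left)
  also have "\<dots> = (\<Sum>j<n. \<Sum>i<n. v $ i * (M $$ (j, i) * cnj (v $ j)))"
    by (rule sum.swap)
  also have "\<dots> = (\<Sum>i<n. cnj (v $ i) * (\<Sum>j<n. M $$ (i, j) * v $ j))"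
    by (simp add: sum_distrib_left mult_ac)
  finally have 2: "cnj (z * ?q) = z * ?q" unfolding 1 .
  have "cnj ?q = ?q" unfolding q by (simp add: mult.commute)
  moreover have "?q \<noteq> 0" using v by (simp add: conjugate_square_eq_0_vec)
  ultimately show ?thesis using 2 by (simp add: Reals_cnj_iff)
qed

lemma herm_eigvals_char_poly:
  assumes M: "M \<in> carrier_mat n n" and h: "mat_adjoint M = M"
  shows "char_poly M = (\<Prod>x\<leftarrow>herm_eigvals M. [:- complex_of_real x, 1:])"
    and "length (herm_eigvals M) = n"
    and "sorted_wrt (\<ge>) (herm_eigvals M)"
proof -
  let ?p = "char_poly M"
  have d: "degree ?p = n" and lc: "lead_coeff ?p = 1" using degree_monic_char_poly[OF M] by auto
  then have p0: "?p \<noteq> 0" by auto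
  have ms: "mset (herm_eigvals M) = image_mset Re (proots ?p)" by (simp add: herm_eigvals_def)
  have "complex_of_real (Re z) = z" if "z \<in># proots ?p" for z
  proof -
    from that p0 have "poly ?p z = 0" by simp
    then have "eigenvalue M z" using eigenvalue_root_char_poly[OF M] by simp
    then show ?thesis using herm_eigenvalue_real[OF M h] by simp
  qed
  then have "image_mset (\<lambda>z. complex_of_real (Re z)) (proots ?p) = image_mset (\<lambda>z. z) (proots ?p)"
    by (intro image_mset_cong) auto
  then have r: "image_mset complex_of_real (mset (herm_eigvals M)) = proots ?p"
    by (simp add: ms image_mset.compositionality comp_def)
  have "(\<Prod>x\<leftarrow>herm_eigvals M. [:- complex_of_real x, 1:])
      = prod_mset (image_mset (\<lambda>z. [:- z, 1:]) (image_mset complex_of_real (mset (herm_eigvals M))))"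
    by (simp add: prod_mset_prod_list[symmetric] image_mset.compositionality comp_def)
  also have "\<dots> = ?p"
    unfolding r using complex_poly_decompose_multiset[of ?p] lc by simp
  finally show "?p = (\<Prod>x\<leftarrow>herm_eigvals M. [:- complex_of_real x, 1:])" ..
  have "length (herm_eigvals M) = size (proots ?p)"
    by (metis ms size_mset size_image_mset)
  then show "length (herm_eigvals M) = n" by (simp add: size_proots_complex d)
  show "sorted_wrt (\<ge>) (herm_eigvals M)"
    by (simp add: herm_eigvals_def sorted_wrt_rev)
qed

end

theory Submission
  imports Defs "HOL-Library.Function_Algebras"
begin

text \<open>
  Membership is a statement about Hermitian pencils. For \<open>\<mu> = a + i b\<close>, an isometry \<open>X\<close> with
  \<open>X\<^sup>* A X = \<mu> I\<close> is a \<open>k\<close>-dimensional subspace on which the two Hermitian forms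
  \<open>h = \<Re>(A) - a I\<close> and \<open>q = \<Im>(A) - b I\<close> vanish. By Courant--Fischer, the two eigenvalue
  conditions at \<open>s\<close> say that \<open>h + s q\<close> is nonnegative on some \<open>k\<close>-dimensional subspace
  and nonpositive on another.

  The core is a theorem of Li and Sze: if this holds for all but finitely many \<open>s\<close>, then a
  common isotropic \<open>k\<close>-dimensional subspace exists. The proof is by induction on the dimension.
  If the pencil has an eigenvector \<open>v\<close> isotropic for both forms, pass to its orthogonal
  complement, which still contains \<open>v\<close> (or split \<open>v\<close> off, if it lies in both radicals).
  Otherwise eigenvectors split off one by one and the forms are simultaneously diagonal. Then the
  number \<open>N(s)\<close> of positive diagonal entries lies between \<open>k\<close> and \<open>n - k\<close>, and one restricts to
  a hyperplane \<open>u\<^sup>\<bottom>\<close>: the inertia of the compression is governed by the sign of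
  \<open>u\<^sup>* (h + s q)\<^sup>-\<^sup>1 u\<close>, a rational function of \<open>s\<close>
  whose residues can be prescribed so that its sign is negative where \<open>N(s) = k\<close> and positive
  elsewhere.

  For the test points: off the roots of the restricted polynomial exactly \<open>d\<close> eigenvalues of
  \<open>\<Re>(A) + s \<Im>(A)\<close> equal \<open>a + b s\<close>. The eigenvalues depend continuously on \<open>s\<close>, so between
  consecutive roots none of them crosses \<open>a + b s\<close>, and one test point per interval decides.
\<close>

section \<open>Sign patterns of affine functions\<close>

text \<open>What shapes the induction is that one hyperplane must serve all parameters at once.
  Compression to a hyperplane may cost a dimension of the positive or of the negative part, and
  which of the two is spared depends on the sign of the form on the normal vector, which varies with
  the parameter. Where the positive part has only dimension \<open>k\<close>, it must be spared;
  elsewhere it has a dimension to give away, and the negative part is spared. The weights available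
  are squared moduli, so the residues of the rational function cannot have arbitrary signs: the
  slopes of the entries dictate them. Excluding isotropic eigenvectors makes the two demands
  compatible. Entries that vanish together then have slopes of one sign, so \<open>N(s)\<close>
  jumps strictly up or strictly down at each zero, and a jump to or from the minimum
  \<open>k\<close> has exactly the sign that its residue needs. Finitely many exceptional parameters
  are allowed throughout because each descent to a subspace can create new ones; this also lets the
  test ignore the roots of the restricted polynomial.\<close>

lemma gap_around:
  fixes Z :: "real set"
  assumes "finite Z" "e > 0"
  obtains d where "d > 0" "d < e" "\<And>z. z \<in> Z \<Longrightarrow> \<bar>z - t\<bar> \<le> d \<Longrightarrow> z = t"
proof -
  let ?m = "Min (insert e ((\<lambda>z. \<bar>z - t\<bar>) ` (Z - {t})))"
  have m: "?m > 0" using assms by (subst Min_gr_iff) auto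
  have "z = t" if "z \<in> Z" "\<bar>z - t\<bar> \<le> ?m / 2" for z
  proof (rule ccontr)
    assume "z \<noteq> t"
    then have "?m \<le> \<bar>z - t\<bar>" using that assms by (intro Min_le) auto
    with that m show False by linarith
  qed
  moreover have "?m \<le> e" using assms by (intro Min_le) auto
  ultimately show thesis using m by (intro that[of "?m / 2"]) auto
qed

lemma prod_sgn: "finite T \<Longrightarrow> sgn (\<Prod>\<tau>\<in>T. f \<tau>) = (\<Prod>\<tau>\<in>T. sgn (f \<tau> :: real))"
  by (induct T rule: finite_induct) (auto simp: sgn_mult)

text \<open>Both factors change sign exactly at the points of \<open>T\<close>, so their product
  never does. The induction removes the largest point of \<open>Z\<close> between \<open>a\<close>
  and \<open>b\<close>.\<close>

lemma alternating_sign: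
  fixes \<sigma> :: "real \<Rightarrow> real"
  assumes Z: "finite Z" and T: "T \<subseteq> Z"
    and const: "\<And>a b. a \<le> b \<Longrightarrow> {a..b} \<inter> Z = {} \<Longrightarrow> \<sigma> a = \<sigma> b"
    and flip: "\<And>a b \<tau>. a < \<tau> \<Longrightarrow> \<tau> < b \<Longrightarrow> {a..b} \<inter> Z = {\<tau>} \<Longrightarrow> \<sigma> b = (if \<tau> \<in> T then - \<sigma> a else \<sigma> a)"
    and ab: "a \<notin> Z" "b \<notin> Z"
  shows "\<sigma> a * (\<Prod>\<tau>\<in>T. sgn (a - \<tau>)) = \<sigma> b * (\<Prod>\<tau>\<in>T. sgn (b - \<tau>))"
proof -
  have fT: "finite T" using finite_subset[OF T Z] .
  have main: "\<sigma> a * (\<Prod>\<tau>\<in>T. sgn (a - \<tau>)) = \<sigma> b * (\<Prod>\<tau>\<in>T. sgn (b - \<tau>))"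
    if "a \<le> b" "a \<notin> Z" "b \<notin> Z" for a b
    using that
  proof (induct "card (Z \<inter> {a..b})" arbitrary: b rule: less_induct)
    case (less b)
    show ?case
    proof (cases "Z \<inter> {a..b} = {}")
      case True
      then have "sgn (a - \<tau>) = sgn (b - \<tau>)" if "\<tau> \<in> T" for \<tau>
        using that T less(2) by (force simp: sgn_if)
      moreover have "\<sigma> a = \<sigma> b" using const[OF less(2)] True by blast
      ultimately show ?thesis by simp
    next
      case False
      define \<tau> where "\<tau> = Max (Z \<inter> {a..b})"
      have fin: "finite (Z \<inter> {a..b})" using Z by simp
      have \<tau>: "\<tau> \<in> Z \<inter> {a..b}" unfolding \<tau>_def by (rule Max_in[OF fin False])
      have mx: "z \<le> \<tau>" if "z \<in> Z \<inter> {a..b}" for z unfolding \<tau>_def by (rule Max_ge[OF fin that])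
      have \<tau>ab: "a < \<tau>" "\<tau> < b" using \<tau> less(3,4) by (auto simp: less_le)
      obtain d where d: "d > 0" "d < \<tau> - a" "\<And>z. z \<in> Z \<Longrightarrow> \<bar>z - \<tau>\<bar> \<le> d \<Longrightarrow> z = \<tau>"
        using gap_around[OF Z, of "\<tau> - a"] \<tau>ab by auto
      \<comment> \<open>A point so close to the left of \<tau> that \<open>flip\<close> applies to
        \<open>{c..b}\<close> and the induction hypothesis to \<open>{a..c}\<close>.\<close>
      define c where "c = \<tau> - d"
      have c: "a < c" "c < \<tau>" using d by (auto simp: c_def)
      have cZ: "c \<notin> Z" using d(3)[of c] d(1) by (auto simp: c_def)
      have cb: "{c..b} \<inter> Z = {\<tau>}"
      proof (intro equalityI subsetI)
        fix z assume z: "z \<in> {c..b} \<inter> Z"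
        then have "z \<le> \<tau>" using mx c by auto
        then show "z \<in> {\<tau>}" using d(3)[of z] z by (auto simp: c_def)
      qed (use \<tau> c in auto)
      have "\<tau> \<notin> Z \<inter> {a..c}" "Z \<inter> {a..c} \<subseteq> Z \<inter> {a..b}" using c \<tau>ab by auto
      then have "Z \<inter> {a..c} \<subset> Z \<inter> {a..b}" using \<tau> by blast
      then have "card (Z \<inter> {a..c}) < card (Z \<inter> {a..b})" using Z by (intro psubset_card_mono) auto
      from less(1)[OF this] c cZ less(3)
      have 1: "\<sigma> a * (\<Prod>\<tau>\<in>T. sgn (a - \<tau>)) = \<sigma> c * (\<Prod>\<tau>\<in>T. sgn (c - \<tau>))" by simp
      have sg: "sgn (c - z) = sgn (b - z)" if "z \<in> T - {\<tau>}" for z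
      proof -
        have "z \<notin> {c..b}" using that cb T by blast
        then show ?thesis using c \<tau>ab by (auto simp: sgn_if)
      qed
      have 2: "\<sigma> c * (\<Prod>\<tau>\<in>T. sgn (c - \<tau>)) = \<sigma> b * (\<Prod>\<tau>\<in>T. sgn (b - \<tau>))"
      proof (cases "\<tau> \<in> T")
        case True
        have "(\<Prod>\<tau>\<in>T. sgn (x - \<tau>)) = sgn (x - \<tau>) * (\<Prod>z\<in>T - {\<tau>}. sgn (x - z))" for x
          by (rule prod.remove[OF fT True])
        moreover have "(\<Prod>z\<in>T - {\<tau>}. sgn (c - z)) = (\<Prod>z\<in>T - {\<tau>}. sgn (b - z))"
          using sg by (rule prod.cong[OF refl])
        ultimately show ?thesis using flip[OF c(2) \<tau>ab(2) cb] True c \<tau>ab by simp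
      next
        case False
        then have "(\<Prod>z\<in>T. sgn (c - z)) = (\<Prod>z\<in>T. sgn (b - z))"
          using sg by (intro prod.cong refl) auto
        then show ?thesis using flip[OF c(2) \<tau>ab(2) cb] False by simp
      qed
      show ?thesis using 1 2 by simp
    qed
  qed
  show ?thesis
  proof (cases "a \<le> b")
    case True
    then show ?thesis by (rule main[OF _ ab])
  next
    case False
    then have "b \<le> a" by simp
    then show ?thesis by (rule main[OF _ ab(2,1), symmetric])
  qed
qed

text \<open>The Lagrange basis polynomials \<open>L\<close> of the nodes \<open>T\<close> sum to 1,
  because the difference has degree below \<open>card T\<close> and vanishes on \<open>T\<close>.
  Dividing this identity by the product of all \<open>t - \<tau>\<close> gives the claim.\<close>

lemma partial_fractions:
  fixes T :: "real set"
  assumes T: "finite T" "T \<noteq> {}" and t: "t \<notin> T"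
  shows "(\<Sum>\<tau>\<in>T. 1 / ((\<Prod>z\<in>T - {\<tau>}. \<tau> - z) * (t - \<tau>))) = 1 / (\<Prod>\<tau>\<in>T. t - \<tau>)"
proof -
  define L where "L \<tau> = smult (1 / (\<Prod>z\<in>T - {\<tau>}. \<tau> - z)) (\<Prod>z\<in>T - {\<tau>}. [:- z, 1:])" for \<tau>
  define p where "p = (\<Sum>\<tau>\<in>T. L \<tau>) - 1"
  have ne: "(\<Prod>z\<in>T - {\<tau>}. \<tau> - z) \<noteq> 0" if "\<tau> \<in> T" for \<tau> using T by auto
  have pL: "poly (L \<tau>) x = (\<Prod>z\<in>T - {\<tau>}. x - z) / (\<Prod>z\<in>T - {\<tau>}. \<tau> - z)" for \<tau> x
    by (simp add: L_def poly_prod)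
  have roots: "poly p x = 0" if x: "x \<in> T" for x
  proof -
    have "poly (L \<tau>) x = (if \<tau> = x then 1 else 0)" if "\<tau> \<in> T" for \<tau>
    proof (cases "\<tau> = x")
      case True then show ?thesis using ne[OF x] pL[of x x] by simp
    next
      case False
      then have "(\<Prod>z\<in>T - {\<tau>}. x - z) = 0" using x T by auto
      then show ?thesis using False pL by simp
    qed
    then have "(\<Sum>\<tau>\<in>T. poly (L \<tau>) x) = (\<Sum>\<tau>\<in>T. if \<tau> = x then 1 else 0)" by (rule sum.cong[OF refl])
    also have "\<dots> = 1" using T x by simp
    finally show ?thesis by (simp add: p_def poly_sum)
  qed
  have degL: "degree (L \<tau>) \<le> card T - 1" if "\<tau> \<in> T" for \<tau>
  proof -
    have "degree (\<Prod>z\<in>T - {\<tau>}. [:- z, 1:]) \<le> (\<Sum>z\<in>T - {\<tau>}. degree [:- z, 1:])"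
      using degree_prod_sum_le[of "T - {\<tau>}" "\<lambda>z. [:- z, 1:]"] T by (simp add: o_def)
    also have "\<dots> = card T - 1" using that T by simp
    finally show ?thesis using degree_smult_le unfolding L_def by (metis order_trans)
  qed
  have "degree p \<le> card T - 1" unfolding p_def
    using degL T by (intro degree_diff_le degree_sum_le) auto
  then have "degree p < card T" using T card_gt_0_iff[of T] by linarith
  have "p = 0"
  proof (rule ccontr)
    assume p0: "p \<noteq> 0"
    have "card T \<le> card {x. poly p x = 0}" using roots poly_roots_finite[OF p0] by (intro card_mono) auto
    also have "\<dots> \<le> degree p" by (rule card_poly_roots_bound[OF p0])
    finally show False using \<open>degree p < card T\<close> by simp
  qed
  have "poly p t = 0" unfolding \<open>p = 0\<close> by simp
  then have "(\<Sum>\<tau>\<in>T. poly (L \<tau>) t) = 1" by (simp add: p_def poly_sum)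
  moreover have "1 / ((\<Prod>z\<in>T - {\<tau>}. \<tau> - z) * (t - \<tau>)) = poly (L \<tau>) t / (\<Prod>\<tau>\<in>T. t - \<tau>)"
    if "\<tau> \<in> T" for \<tau>
  proof -
    have "(\<Prod>\<tau>\<in>T. t - \<tau>) = (t - \<tau>) * (\<Prod>z\<in>T - {\<tau>}. t - z)" by (rule prod.remove[OF T(1) that])
    moreover have "(\<Prod>z\<in>T - {\<tau>}. t - z) \<noteq> 0" using T t by auto
    ultimately show ?thesis using pL by simp
  qed
  ultimately show ?thesis by (simp add: sum_divide_distrib[symmetric])
qed

text \<open>The functions \<open>u b - t * v b\<close> model the diagonal entries of a
  simultaneously diagonalized pencil. The assumption \<open>no_opposite\<close> is the trace left by
  the absence of isotropic eigenvectors: two entries vanishing at the same \<open>t\<close> with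
  opposite slopes would combine to one, see \<open>isotropic_combination\<close>.\<close>

locale affine_signs =
  fixes D :: "'b set" and u v :: "'b \<Rightarrow> real"
  assumes finite_D: "finite D"
    and nondegenerate: "\<And>b. b \<in> D \<Longrightarrow> u b \<noteq> 0 \<or> v b \<noteq> 0"
    and no_opposite: "\<And>b c t. b \<in> D \<Longrightarrow> c \<in> D \<Longrightarrow> u b = t * v b \<Longrightarrow> u c = t * v c \<Longrightarrow> v b > 0 \<Longrightarrow> \<not> v c < 0"
begin

definition zeros :: "real set" where "zeros = (\<lambda>b. u b / v b) ` {b \<in> D. v b \<noteq> 0}"
definition pos :: "real \<Rightarrow> 'b set" where "pos t = {b \<in> D. 0 < u b - t * v b}"
definition neg :: "real \<Rightarrow> 'b set" where "neg t = {b \<in> D. u b - t * v b < 0}"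

lemma finite_zeros: "finite zeros" and finite_pos: "finite (pos t)" and finite_neg: "finite (neg t)"
  using finite_D by (auto simp: zeros_def pos_def neg_def)

lemma nonzero_off_zeros: "t \<notin> zeros \<Longrightarrow> b \<in> D \<Longrightarrow> u b - t * v b \<noteq> 0"
  using nondegenerate[of b] by (cases "v b = 0") (auto simp: zeros_def image_iff field_simps)

lemma nonneg_iff_off_zeros:
  assumes "t \<notin> zeros"
  shows "{b \<in> D. 0 \<le> u b - t * v b} = pos t" "{b \<in> D. 0 \<le> - (u b - t * v b)} = neg t"
  using nonzero_off_zeros[OF assms] unfolding pos_def neg_def by force+

lemma pos_neg_card:
  assumes "t \<notin> zeros" shows "card (pos t) + card (neg t) = card D"
proof -
  have "D = pos t \<union> neg t" "pos t \<inter> neg t = {}"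
    using nonzero_off_zeros[OF assms] by (force simp: pos_def neg_def)+
  then show ?thesis using card_Un_disjoint[OF finite_pos finite_neg, of t t] by simp
qed

lemma zero_between:
  assumes "b \<in> D" "v b \<noteq> 0" "x \<le> y" "\<not> (0 < u b - x * v b \<longleftrightarrow> 0 < u b - y * v b)"
  shows "u b / v b \<in> {x..y} \<inter> zeros"
proof -
  have "u b / v b \<in> {x..y}"
  proof (cases "v b > 0")
    case True
    have "x * v b \<le> y * v b" using True assms(3) by simp
    then have "x * v b < u b \<and> u b \<le> y * v b" using assms(4) by linarith
    with True show ?thesis by (auto simp: field_simps)
  next
    case False
    then have v: "v b < 0" using assms(2) by simp
    then have "y * v b \<le> x * v b" using assms(3) by simp
    then have "u b \<le> x * v b \<and> y * v b < u b" using assms(4) by linarith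
    with v show ?thesis by (auto simp: field_simps)
  qed
  then show ?thesis using assms by (auto simp: zeros_def)
qed

lemma pos_constant:
  assumes "x \<le> y" "{x..y} \<inter> zeros = {}" shows "pos x = pos y"
proof -
  have "0 < u b - x * v b \<longleftrightarrow> 0 < u b - y * v b" if "b \<in> D" for b
    using zero_between[OF that _ assms(1)] assms(2) by (cases "v b = 0") auto
  then show ?thesis by (auto simp: pos_def)
qed

text \<open>By \<open>no_opposite\<close>, the entries that vanish at \<open>z\<close> all have slopes of the same sign.\<close>

lemma pos_across_zero:
  assumes xy: "x < z" "z < y" "{x..y} \<inter> zeros = {z}" and b: "b \<in> D" "v b \<noteq> 0" "u b = z * v b"
  shows "v b > 0 \<Longrightarrow> pos y \<subset> pos x" "v b < 0 \<Longrightarrow> pos x \<subset> pos y"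
proof -
  have other: "0 < u c - x * v c \<longleftrightarrow> 0 < u c - y * v c" if "c \<in> D" "v c = 0 \<or> u c \<noteq> z * v c" for c
  proof (cases "v c = 0")
    case False
    then have "u c / v c \<noteq> z" using that by (auto simp: field_simps)
    then show ?thesis using zero_between[OF that(1) False, of x y] xy by force
  qed auto
  have less: "z * v b < y * v b" "x * v b < z * v b" if "v b > 0" using that xy by auto
  have gr: "z * v b > y * v b" "x * v b > z * v b" if "v b < 0" using that xy by auto
  show "pos y \<subset> pos x" if "v b > 0"
  proof -
    have "c \<in> pos x" if c: "c \<in> pos y" for c
    proof (cases "v c = 0 \<or> u c \<noteq> z * v c")
      case True then show ?thesis using other[of c] c by (auto simp: pos_def)
    next
      case False
      then have "\<not> v c < 0" using no_opposite[OF b(1), of c z] b(3) \<open>v b > 0\<close> c by (auto simp: pos_def)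
      then have "v c > 0" using False by auto
      then have "x * v c < z * v c" using xy by simp
      then show ?thesis using False c by (auto simp: pos_def)
    qed
    moreover have "b \<in> pos x" "b \<notin> pos y" using b less[OF that] by (auto simp: pos_def)
    ultimately show ?thesis by blast
  qed
  show "pos x \<subset> pos y" if "v b < 0"
  proof -
    have "c \<in> pos y" if c: "c \<in> pos x" for c
    proof (cases "v c = 0 \<or> u c \<noteq> z * v c")
      case True then show ?thesis using other[of c] c by (auto simp: pos_def)
    next
      case False
      then have "\<not> 0 < v c" using no_opposite[of c b z] b(1,3) \<open>v b < 0\<close> c by (auto simp: pos_def)
      then have "v c < 0" using False by auto
      then have "y * v c < z * v c" using xy by simp
      then show ?thesis using False c by (auto simp: pos_def)
    qed
    moreover have "b \<in> pos y" "b \<notin> pos x" using b gr[OF that] by (auto simp: pos_def)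
    ultimately show ?thesis by blast
  qed
qed

text \<open>
  The weights are the residues of \<open>\<plusminus>1 / P\<close>, where \<open>P\<close> has its simple roots exactly where the
  number of positive entries changes between \<open>k\<close> and a larger value.
\<close>

lemma sign_weights:
  assumes lower: "\<And>t. t \<notin> zeros \<Longrightarrow> k \<le> card (pos t)"
    and t0: "t0 \<notin> zeros" "card (pos t0) = k" and ne: "zeros \<noteq> {}"
  obtains w where "\<And>b. b \<in> D \<Longrightarrow> 0 \<le> w b" "\<exists>b\<in>D. 0 < w b" "\<exists>t. t \<notin> zeros \<and> k < card (pos t)"
    "\<And>t. t \<notin> zeros \<Longrightarrow> card (pos t) = k \<Longrightarrow> (\<Sum>b\<in>D. w b / (u b - t * v b)) < 0"
    "\<And>t. t \<notin> zeros \<Longrightarrow> k < card (pos t) \<Longrightarrow> (\<Sum>b\<in>D. w b / (u b - t * v b)) > 0"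
proof -
  \<comment> \<open>\<sigma> is the sign that the weighted sum is to have at \<open>t\<close>, and
    \<open>T\<close> collects the zeros at which this sign flips.\<close>
  define \<sigma> :: "real \<Rightarrow> real" where "\<sigma> t = (if card (pos t) = k then -1 else 1)" for t
  have \<sigma>1: "\<sigma> t = 1 \<or> \<sigma> t = -1" for t by (simp add: \<sigma>_def)
  define T where "T = {\<tau> \<in> zeros. \<exists>x y. x < \<tau> \<and> \<tau> < y \<and> {x..y} \<inter> zeros = {\<tau>} \<and> \<sigma> x \<noteq> \<sigma> y}"
  have TZ: "T \<subseteq> zeros" and fT: "finite T" using finite_zeros by (auto simp: T_def)
  have const: "\<sigma> x = \<sigma> y" if "x \<le> y" "{x..y} \<inter> zeros = {}" for x y
    using pos_constant[OF that] by (simp add: \<sigma>_def)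
  have only: "z = \<tau>" if "{x..y} \<inter> zeros = {\<tau>}" "z \<in> zeros" "x \<le> z" "z \<le> y" for x y z \<tau>
  proof -
    have "z \<in> {x..y} \<inter> zeros" using that(2-4) by simp
    then show ?thesis unfolding that(1) by simp
  qed
  \<comment> \<open>Membership in \<open>T\<close> is witnessed by one pair around \<tau>. This fact
    and its mirror image compare any two such pairs, so that \<open>flip\<close> holds for all of
    them.\<close>
  have const': "\<sigma> x = \<sigma> x'"
    if "x \<le> x'" "x' < \<tau>" "\<tau> < y" "{x..y} \<inter> zeros = {\<tau>}" for x x' y \<tau>
  proof (rule const[OF that(1)])
    show "{x..x'} \<inter> zeros = {}" using only[OF that(4)] that(2,3) by force
  qed
  have const'': "\<sigma> y' = \<sigma> y"
    if "y' \<le> y" "\<tau> < y'" "x < \<tau>" "{x..y} \<inter> zeros = {\<tau>}" for x y' y \<tau>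
  proof (rule const[OF that(1)])
    show "{y'..y} \<inter> zeros = {}" using only[OF that(4)] that(2,3) by force
  qed
  have flip: "\<sigma> y = (if \<tau> \<in> T then - \<sigma> x else \<sigma> x)" if xy: "x < \<tau>" "\<tau> < y" "{x..y} \<inter> zeros = {\<tau>}" for x y \<tau>
  proof (cases "\<sigma> x = \<sigma> y")
    case False
    moreover have "\<tau> \<in> T" using False that unfolding T_def by blast
    ultimately show ?thesis using \<sigma>1[of x] \<sigma>1[of y] by auto
  next
    case True
    have "\<tau> \<notin> T"
    proof
      assume "\<tau> \<in> T"
      then obtain x' y' where xy': "x' < \<tau>" "\<tau> < y'" "{x'..y'} \<inter> zeros = {\<tau>}" "\<sigma> x' \<noteq> \<sigma> y'"
        by (auto simp: T_def)
      have "\<sigma> x = \<sigma> x'"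
        using linear[of x x'] const'[OF _ xy'(1) xy(2,3)] const'[OF _ xy(1) xy'(2,3)] by metis
      moreover have "\<sigma> y = \<sigma> y'"
        using linear[of y y'] const''[OF _ xy(2) xy'(1,3)] const''[OF _ xy'(2) xy(1,3)] by metis
      ultimately show False using True xy'(4) by simp
    qed
    then show ?thesis using True by simp
  qed
  define g where "g t = \<sigma> t * (\<Prod>\<tau>\<in>T. sgn (t - \<tau>))" for t
  define \<epsilon> where "\<epsilon> = g t0"
  have g\<epsilon>: "g t = \<epsilon>" if "t \<notin> zeros" for t
    unfolding \<epsilon>_def g_def using alternating_sign[OF finite_zeros TZ const flip that t0(1)] .
  have \<epsilon>2: "\<epsilon> * \<epsilon> = 1"
  proof -
    have "\<epsilon> = \<sigma> t0 * sgn (\<Prod>\<tau>\<in>T. t0 - \<tau>)" by (simp add: \<epsilon>_def g_def prod_sgn[OF fT])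
    moreover have "(\<Prod>\<tau>\<in>T. t0 - \<tau>) \<noteq> 0" using fT t0(1) TZ by auto
    ultimately show ?thesis using \<sigma>1[of t0] by (auto simp: sgn_if)
  qed
  have gap: "\<exists>x y. x < \<tau> \<and> \<tau> < y \<and> {x..y} \<inter> zeros = {\<tau>} \<and> x \<notin> zeros \<and> y \<notin> zeros" if "\<tau> \<in> zeros" for \<tau>
  proof -
    obtain d where d: "d > 0" "\<And>z. z \<in> zeros \<Longrightarrow> \<bar>z - \<tau>\<bar> \<le> d \<Longrightarrow> z = \<tau>"
      by (rule gap_around[OF finite_zeros, of 1 \<tau>]) auto
    have "{\<tau> - d..\<tau> + d} \<inter> zeros = {\<tau>}" using d that by (auto simp: abs_if)
    moreover have "\<tau> - d \<notin> zeros"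
    proof
      assume "\<tau> - d \<in> zeros"
      from d(2)[OF this] d(1) show False by simp
    qed
    moreover have "\<tau> + d \<notin> zeros"
    proof
      assume "\<tau> + d \<in> zeros"
      from d(2)[OF this] d(1) show False by simp
    qed
    moreover have "\<tau> - d < \<tau>" "\<tau> < \<tau> + d" using d(1) by simp_all
    ultimately show ?thesis by blast
  qed
  have exb: "\<exists>b. b \<in> D \<and> v b \<noteq> 0 \<and> u b = \<tau> * v b" if "\<tau> \<in> zeros" for \<tau>
    using that by (auto simp: zeros_def)
  then obtain \<beta> where \<beta>: "\<And>\<tau>. \<tau> \<in> zeros \<Longrightarrow> \<beta> \<tau> \<in> D \<and> v (\<beta> \<tau>) \<noteq> 0 \<and> u (\<beta> \<tau>) = \<tau> * v (\<beta> \<tau>)" by metis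
  have inj: "inj_on \<beta> T"
  proof (rule inj_onI)
    fix x y assume "x \<in> T" "y \<in> T" "\<beta> x = \<beta> y"
    then have "x * v (\<beta> x) = y * v (\<beta> x)" "v (\<beta> x) \<noteq> 0" using \<beta>[of x] \<beta>[of y] TZ by (metis subsetD)+
    then show "x = y" by simp
  qed
  \<comment> \<open>Without a flip the count would equal \<open>k\<close> off all zeros, yet it
    changes strictly across any zero.\<close>
  have Tne: "T \<noteq> {}"
  proof
    assume T0: "T = {}"
    obtain \<tau> where \<tau>: "\<tau> \<in> zeros" using ne by blast
    obtain x y where xy: "x < \<tau>" "\<tau> < y" "{x..y} \<inter> zeros = {\<tau>}" "x \<notin> zeros" "y \<notin> zeros" using gap[OF \<tau>] by blast
    have "pos x \<subset> pos y \<or> pos y \<subset> pos x"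
      using pos_across_zero[OF xy(1-3), of "\<beta> \<tau>"] \<beta>[OF \<tau>] by (meson linorder_neqE_linordered_idom)
    then have "card (pos x) \<noteq> card (pos y)" using psubset_card_mono finite_pos by (metis nat_neq_iff)
    moreover have "card (pos t) = k" if t: "t \<notin> zeros" for t
    proof -
      have "\<sigma> t = \<sigma> t0" using g\<epsilon>[OF t] g\<epsilon>[OF t0(1)] T0 by (simp add: g_def)
      then show ?thesis using t0(2) by (simp add: \<sigma>_def split: if_splits)
    qed
    ultimately show False using xy(4,5) by simp
  qed
  define P' where "P' \<tau> = (\<Prod>z\<in>T - {\<tau>}. \<tau> - z)" for \<tau>
  \<comment> \<open>Forced by comparing residues: as \<open>u = \<tau> * v\<close> at
    \<open>\<beta> \<tau>\<close>, the term with weight \<open>W\<close> equals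
    \<open>- W / (v * (t - \<tau>))\<close>, which has to be the partial fraction
    \<open>\<epsilon> / (P' \<tau> * (t - \<tau>))\<close>.\<close>
  define W where "W \<tau> = - \<epsilon> * v (\<beta> \<tau>) / P' \<tau>" for \<tau>
  have big: "\<exists>t. t \<notin> zeros \<and> k < card (pos t)" and Wpos: "0 < W \<tau>" if \<tau>: "\<tau> \<in> T" for \<tau>
  proof -
    have \<tau>Z: "\<tau> \<in> zeros" using \<tau> TZ by blast
    obtain x y where xy: "x < \<tau>" "\<tau> < y" "{x..y} \<inter> zeros = {\<tau>}" "x \<notin> zeros" "y \<notin> zeros" using gap[OF \<tau>Z] by blast
    have \<sigma>xy: "\<sigma> y = - \<sigma> x" using flip[OF xy(1-3)] \<tau> by simp
    then show "\<exists>t. t \<notin> zeros \<and> k < card (pos t)"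
      using xy(4,5) lower[OF xy(4)] lower[OF xy(5)] by (auto simp: \<sigma>_def le_less split: if_splits)
    note c = pos_across_zero[OF xy(1-3), of "\<beta> \<tau>"]
    \<comment> \<open>This ties the slope to the required sign. If \<open>v\<close> is positive,
      positive entries are lost from \<open>x\<close> to \<open>y\<close>; the count at
      \<open>x\<close> then exceeds \<open>k\<close>, and since \<sigma> flips at \<tau>, the count
      at \<open>y\<close> is \<open>k\<close>. A negative slope exchanges the two sides.\<close>
    have \<sigma>y: "\<sigma> y = - sgn (v (\<beta> \<tau>))"
    proof (cases "v (\<beta> \<tau>) > 0")
      case True
      then have "card (pos y) < card (pos x)" using c(1) \<beta>[OF \<tau>Z] psubset_card_mono[OF finite_pos] by blast
      then have "card (pos x) \<noteq> k" using lower[OF xy(5)] by simp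
      then show ?thesis using True \<sigma>xy by (simp add: \<sigma>_def)
    next
      case False
      then have v: "v (\<beta> \<tau>) < 0" using \<beta>[OF \<tau>Z] by auto
      then have "card (pos x) < card (pos y)" using c(2) \<beta>[OF \<tau>Z] psubset_card_mono[OF finite_pos] by blast
      then have "card (pos y) \<noteq> k" using lower[OF xy(4)] by simp
      then show ?thesis using v by (simp add: \<sigma>_def)
    qed
    have "(\<Prod>z\<in>T. sgn (y - z)) = sgn (y - \<tau>) * (\<Prod>z\<in>T - {\<tau>}. sgn (y - z))"
      by (rule prod.remove[OF fT \<tau>])
    also have "(\<Prod>z\<in>T - {\<tau>}. sgn (y - z)) = (\<Prod>z\<in>T - {\<tau>}. sgn (\<tau> - z))"
    proof (rule prod.cong[OF refl])
      fix z assume z: "z \<in> T - {\<tau>}"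
      then have "z \<notin> {x..y}" using xy(3) TZ by blast
      then show "sgn (y - z) = sgn (\<tau> - z)" using xy(1,2) by (auto simp: sgn_if)
    qed
    also have "\<dots> = sgn (P' \<tau>)" unfolding P'_def using fT by (simp add: prod_sgn)
    finally have "\<epsilon> = \<sigma> y * sgn (P' \<tau>)" using g\<epsilon>[OF xy(5)] xy(2) by (simp add: g_def)
    then have "sgn (W \<tau>) = 1" using \<sigma>y \<epsilon>2 \<sigma>1[of y] unfolding W_def
      by (auto simp: sgn_mult sgn_divide sgn_if zero_less_divide_iff split: if_splits)
    then show "0 < W \<tau>" by (simp add: sgn_1_pos)
  qed
  define w where "w b = (if b \<in> \<beta> ` T then W (inv_into T \<beta> b) else 0)" for b
  have wW: "w (\<beta> \<tau>) = W \<tau>" if "\<tau> \<in> T" for \<tau> using that inj by (simp add: w_def)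
  have \<beta>D: "\<beta> ` T \<subseteq> D" using \<beta> TZ by blast
  have w0: "w b \<ge> 0" for b using wW Wpos by (cases "b \<in> \<beta> ` T") (auto simp: less_imp_le, simp add: w_def)
  have sum: "(\<Sum>b\<in>D. w b / (u b - t * v b)) = \<epsilon> / (\<Prod>\<tau>\<in>T. t - \<tau>)" if t: "t \<notin> zeros" for t
  proof -
    have "(\<Sum>b\<in>D. w b / (u b - t * v b)) = (\<Sum>b\<in>\<beta> ` T. w b / (u b - t * v b))"
      using \<beta>D finite_D by (intro sum.mono_neutral_right) (auto simp: w_def)
    also have "\<dots> = (\<Sum>\<tau>\<in>T. W \<tau> / (u (\<beta> \<tau>) - t * v (\<beta> \<tau>)))"
      using wW by (simp add: sum.reindex[OF inj])
    also have "\<dots> = (\<Sum>\<tau>\<in>T. \<epsilon> * (1 / (P' \<tau> * (t - \<tau>))))"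
    proof (rule sum.cong[OF refl])
      fix \<tau> assume \<tau>: "\<tau> \<in> T"
      then have b: "v (\<beta> \<tau>) \<noteq> 0" "u (\<beta> \<tau>) = \<tau> * v (\<beta> \<tau>)" "t \<noteq> \<tau>" using \<beta> TZ t by blast+
      have "P' \<tau> \<noteq> 0" using fT by (auto simp: P'_def)
      moreover have e: "u (\<beta> \<tau>) - t * v (\<beta> \<tau>) = - (v (\<beta> \<tau>) * (t - \<tau>))" using b by (simp add: algebra_simps)
      ultimately show "W \<tau> / (u (\<beta> \<tau>) - t * v (\<beta> \<tau>)) = \<epsilon> * (1 / (P' \<tau> * (t - \<tau>)))"
        unfolding e W_def using b by (simp add: divide_simps)
    qed
    also have "\<dots> = \<epsilon> * (1 / (\<Prod>\<tau>\<in>T. t - \<tau>))"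
      unfolding sum_distrib_left[symmetric] P'_def using partial_fractions[OF fT Tne, of t] t TZ by (metis subsetD)
    finally show ?thesis by simp
  qed
  have sgnsum: "sgn (\<Sum>b\<in>D. w b / (u b - t * v b)) = \<sigma> t" if t: "t \<notin> zeros" for t
  proof -
    have "(\<Prod>\<tau>\<in>T. t - \<tau>) \<noteq> 0" using fT t TZ by auto
    moreover have "\<epsilon> = \<sigma> t * sgn (\<Prod>\<tau>\<in>T. t - \<tau>)"
      using g\<epsilon>[OF t] by (simp add: g_def prod_sgn[OF fT])
    ultimately show ?thesis unfolding sum[OF t] using \<sigma>1[of t] by (auto simp: sgn_divide sgn_if)
  qed
  show thesis
  proof
    show "\<And>b. b \<in> D \<Longrightarrow> 0 \<le> w b" using w0 .
    show "\<exists>b\<in>D. 0 < w b" using Tne wW Wpos \<beta>D by fastforce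
    show "\<exists>t. t \<notin> zeros \<and> k < card (pos t)" using Tne big by blast
    fix t assume t: "t \<notin> zeros"
    show "(\<Sum>b\<in>D. w b / (u b - t * v b)) < 0" if "card (pos t) = k"
      using sgnsum[OF t] that by (simp add: \<sigma>_def sgn_1_neg)
    show "(\<Sum>b\<in>D. w b / (u b - t * v b)) > 0" if "k < card (pos t)"
      using sgnsum[OF t] that by (simp add: \<sigma>_def sgn_1_pos)
  qed
qed

end

section \<open>Subspaces on which Hermitian forms are definite\<close>

text \<open>For invertible \<open>K\<close> this is an eigenvector of the inverse of
  \<open>K\<close> times \<open>H\<close>. The adjugate stands in for the inverse, so the eigenvalue
  is divided by \<open>det K\<close> at the end.\<close>

lemma mat_pencil_eigenvector:
  fixes H K :: "complex mat"
  assumes H: "H \<in> carrier_mat n n" and K: "K \<in> carrier_mat n n" and n: "n > 0"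
  obtains c where "c \<in> carrier_vec n" "c \<noteq> 0\<^sub>v n" "K *\<^sub>v c = 0\<^sub>v n \<or> (\<exists>\<mu>. H *\<^sub>v c = \<mu> \<cdot>\<^sub>v (K *\<^sub>v c))"
proof (cases "det K = 0")
  case True
  then show thesis using det_0_iff_vec_prod_zero[OF K] that by blast
next
  case False
  let ?J = "adj_mat K"
  have J: "?J \<in> carrier_mat n n" and KJ: "K * ?J = det K \<cdot>\<^sub>m 1\<^sub>m n" using adj_mat[OF K] by auto
  have JH: "?J * H \<in> carrier_mat n n" using J H by simp
  have "\<not> constant (poly (char_poly (?J * H)))"
    using degree_monic_char_poly[OF JH] n by (simp add: constant_degree)
  then obtain z where "poly (char_poly (?J * H)) z = 0" using fundamental_theorem_of_algebra by blast
  then have "eigenvalue (?J * H) z" using eigenvalue_root_char_poly[OF JH] by simp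
  then obtain c where c: "c \<in> carrier_vec n" "c \<noteq> 0\<^sub>v n" "(?J * H) *\<^sub>v c = z \<cdot>\<^sub>v c"
    using JH unfolding eigenvalue_def eigenvector_def by auto
  have "z \<cdot>\<^sub>v (K *\<^sub>v c) = K *\<^sub>v ((?J * H) *\<^sub>v c)" unfolding c(3) using K c(1) by (simp add: mult_mat_vec)
  also have "\<dots> = (K * ?J) *\<^sub>v (H *\<^sub>v c)" using K J H c(1) by simp
  also have "\<dots> = det K \<cdot>\<^sub>v (H *\<^sub>v c)" unfolding KJ using H c(1)
    by (intro eq_vecI) (auto simp: scalar_prod_def if_distrib[of "\<lambda>x. det K * x * _"] sum.If_cases)
  finally have "(1 / det K) \<cdot>\<^sub>v (z \<cdot>\<^sub>v (K *\<^sub>v c)) = (1 / det K) \<cdot>\<^sub>v (det K \<cdot>\<^sub>v (H *\<^sub>v c))" by simp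
  then have "H *\<^sub>v c = (z / det K) \<cdot>\<^sub>v (K *\<^sub>v c)" using False by (simp add: smult_smult_assoc)
  then show thesis using that c by blast
qed

text \<open>The induction passes to subspaces rather than to smaller matrices. Forms therefore live
  on a whole abstract space, and a subspace enters as the span of a finite independent set.\<close>

locale complex_vector_space = vector_space scale
  for scale :: "complex \<Rightarrow> 'a::ab_group_add \<Rightarrow> 'a" (infixr \<open>*s\<close> 75)
begin

definition functional :: "('a \<Rightarrow> complex) \<Rightarrow> bool" where
  "functional \<phi> \<longleftrightarrow> (\<forall>x y. \<phi> (x + y) = \<phi> x + \<phi> y) \<and> (\<forall>c x. \<phi> (c *s x) = c * \<phi> x)"

definition hermitian_form :: "('a \<Rightarrow> 'a \<Rightarrow> complex) \<Rightarrow> bool" where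
  "hermitian_form Q \<longleftrightarrow> (\<forall>x. functional (Q x)) \<and> (\<forall>x y. Q y x = cnj (Q x y))"

text \<open>\<open>S\<close> need not be a subspace: it is typically a cone such as the vectors with
  \<open>0 \<le> Re (Q x x)\<close>, as in the Courant-Fischer principle.\<close>

definition contains_dim :: "nat \<Rightarrow> 'a set \<Rightarrow> bool" where
  "contains_dim k S \<longleftrightarrow> (\<exists>B. finite B \<and> independent B \<and> card B = k \<and> span B \<subseteq> S)"

lemma contains_dimI:
  assumes "finite B" "independent B" "k \<le> card B" "span B \<subseteq> S"
  shows "contains_dim k S"
proof -
  obtain C where C: "C \<subseteq> B" "card C = k" "finite C"
    using obtain_subset_with_card_n[OF assms(3)] by blast
  moreover have "independent C" using independent_mono[OF assms(2) C(1)] .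
  moreover have "span C \<subseteq> S" using span_mono[OF C(1)] assms(4) by blast
  ultimately show ?thesis unfolding contains_dim_def by blast
qed

lemma contains_dimE:
  assumes "contains_dim k S"
  obtains B where "finite B" "independent B" "card B = k" "span B \<subseteq> S"
  using assms unfolding contains_dim_def by blast

lemma contains_dim_mono: "contains_dim k S \<Longrightarrow> l \<le> k \<Longrightarrow> S \<subseteq> T \<Longrightarrow> contains_dim l T"
  by (elim contains_dimE) (rule contains_dimI, auto)

lemma functional_sum:
  assumes "functional \<phi>" shows "\<phi> (\<Sum>i\<in>I. f i) = (\<Sum>i\<in>I. \<phi> (f i))"
proof -
  interpret additive \<phi> using assms by unfold_locales (simp add: functional_def)
  show ?thesis by (rule sum)
qed

lemma functional_simps:
  assumes "functional \<phi>"
  shows "\<phi> (x + y) = \<phi> x + \<phi> y" "\<phi> (c *s x) = c * \<phi> x" "\<phi> 0 = 0" "\<phi> (- x) = - \<phi> x"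
    "\<phi> (x - y) = \<phi> x - \<phi> y"
proof -
  interpret additive \<phi> using assms by unfold_locales (simp add: functional_def)
  show "\<phi> (x + y) = \<phi> x + \<phi> y" by (rule add)
  show "\<phi> 0 = 0" by (rule zero)
  show "\<phi> (- x) = - \<phi> x" by (rule minus)
  show "\<phi> (x - y) = \<phi> x - \<phi> y" by (rule diff)
qed (use assms in \<open>simp add: functional_def\<close>)

lemma functional_zero_on_span:
  assumes "functional \<phi>" "\<And>b. b \<in> B \<Longrightarrow> \<phi> b = 0" "x \<in> span B"
  shows "\<phi> x = 0"
  using assms(3) by (induct rule: span_induct_alt) (auto simp: functional_simps[OF assms(1)] assms(2))

lemma functional_representation: "independent B \<Longrightarrow> span B = UNIV \<Longrightarrow> functional (\<lambda>x. representation B x b)"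
  by (simp add: functional_def representation_add representation_scale)

lemma hermitian_formD:
  assumes "hermitian_form Q"
  shows "functional (Q x)" "Q y x = cnj (Q x y)"
  using assms unfolding hermitian_form_def by blast+

lemma form_right:
  assumes "hermitian_form Q"
  shows "Q z (x + y) = Q z x + Q z y" "Q z (c *s x) = c * Q z x" "Q z 0 = 0" "Q z (- x) = - Q z x"
    "Q z (x - y) = Q z x - Q z y"
  using functional_simps[OF hermitian_formD(1)[OF assms, of z]] by blast+

lemma form_left:
  assumes "hermitian_form Q"
  shows "Q (x + y) z = Q x z + Q y z" "Q (c *s x) z = cnj c * Q x z" "Q 0 z = 0" "Q (- x) z = - Q x z"
    "Q (x - y) z = Q x z - Q y z"
proof -
  have c: "Q u z = cnj (Q z u)" for u by (rule hermitian_formD(2)[OF assms])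
  note r = form_right[OF assms, of z]
  show "Q (x + y) z = Q x z + Q y z" unfolding c[of "x + y"] c[of x] c[of y] r(1) by simp
  show "Q (c *s x) z = cnj c * Q x z" unfolding c[of "c *s x"] c[of x] r(2) by simp
  show "Q 0 z = 0" unfolding c[of 0] r(3) by simp
  show "Q (- x) z = - Q x z" unfolding c[of "- x"] c[of x] r(4) by simp
  show "Q (x - y) z = Q x z - Q y z" unfolding c[of "x - y"] c[of x] c[of y] r(5) by simp
qed

lemma form_sum:
  assumes "hermitian_form Q"
  shows "Q z (\<Sum>i\<in>I. f i) = (\<Sum>i\<in>I. Q z (f i))" "Q (\<Sum>i\<in>I. f i) z = (\<Sum>i\<in>I. Q (f i) z)"
proof -
  show r: "Q z (\<Sum>i\<in>I. f i) = (\<Sum>i\<in>I. Q z (f i))"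
    by (rule functional_sum[OF hermitian_formD(1)[OF assms]])
  have c: "Q u z = cnj (Q z u)" for u by (rule hermitian_formD(2)[OF assms])
  show "Q (\<Sum>i\<in>I. f i) z = (\<Sum>i\<in>I. Q (f i) z)"
    unfolding c[of "sum f I"] r cnj_sum by (intro sum.cong refl) (rule c[symmetric])
qed

lemma form_diag_real:
  assumes "hermitian_form Q" shows "Q x x = complex_of_real (Re (Q x x))"
  using arg_cong[OF hermitian_formD(2)[OF assms, of x x], of Im] by (simp add: complex_eq_iff)

lemma hermitian_form_combination:
  assumes "hermitian_form h" "hermitian_form q"
  shows "hermitian_form (\<lambda>x y. complex_of_real s * h x y + complex_of_real t * q x y)"
  unfolding hermitian_form_def
proof (intro conjI allI)
  fix x y
  show "functional (\<lambda>y. complex_of_real s * h x y + complex_of_real t * q x y)"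
    unfolding functional_def using form_right[OF assms(1)] form_right[OF assms(2)]
    by (auto simp: algebra_simps)
  show "complex_of_real s * h y x + complex_of_real t * q y x
      = cnj (complex_of_real s * h x y + complex_of_real t * q x y)"
    unfolding hermitian_formD(2)[OF assms(1), of y x] hermitian_formD(2)[OF assms(2), of y x] by simp
qed

lemma hermitian_form_pencil:
  assumes "hermitian_form h" "hermitian_form q"
  shows "hermitian_form (\<lambda>x y. h x y - complex_of_real t * q x y)"
  using hermitian_form_combination[OF assms, of 1 "- t"] by simp

text \<open>Isotropy of \<open>x + y\<close> makes the real part of \<open>Q x y\<close> vanish,
  isotropy of \<open>x + \<i> *s y\<close> the imaginary part.\<close>

lemma form_polarization:
  assumes Q: "hermitian_form Q" and S: "subspace S" and 0: "\<And>x. x \<in> S \<Longrightarrow> Q x x = 0"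
    and xy: "x \<in> S" "y \<in> S"
  shows "Q x y = 0"
proof -
  have "Q (x + y) (x + y) = 0" "Q (x + \<i> *s y) (x + \<i> *s y) = 0"
    using 0 subspace_add[OF S] subspace_scale[OF S] xy by blast+
  then have "Q x y + Q y x = 0" "\<i> * Q x y - \<i> * Q y x = 0"
    using 0[OF xy(1)] 0[OF xy(2)]
    by (simp_all add: form_right[OF Q] form_left[OF Q] algebra_simps)
  then show ?thesis by (simp add: algebra_simps)
qed

section \<open>Shears, kernels of functionals and dimension counts\<close>

lemma linear_shear:
  assumes "functional \<phi>"
  shows "Vector_Spaces.linear scale scale (\<lambda>x. x - \<phi> x *s z)"
  by unfold_locales (simp_all add: functional_simps[OF assms] algebra_simps)

text \<open>A vector killed by the shear equals \<open>\<phi> x *s z\<close>, a multiple of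
  \<open>z\<close>. The third assumption excludes nonzero vectors of this kind from
  \<open>span B\<close>, so the shear is injective there and carries bases to bases.\<close>

lemma independent_shear:
  assumes "functional \<phi>" "independent B" "\<And>c. c *s z \<in> span B \<Longrightarrow> \<phi> (c *s z) *s z = c *s z \<Longrightarrow> c *s z = 0"
  defines "f \<equiv> \<lambda>x. x - \<phi> x *s z"
  shows "independent (f ` B)" "card (f ` B) = card B" "span (f ` B) = f ` span B"
proof -
  interpret f: Vector_Spaces.linear scale scale f unfolding f_def by (rule linear_shear[OF assms(1)])
  have "x = 0" if "x \<in> span B" "f x = 0" for x
  proof -
    have x: "\<phi> x *s z = x" using that(2) by (simp add: f_def)
    show "x = 0" using assms(3)[of "\<phi> x"] that(1) unfolding x by simp
  qed
  then have inj: "inj_on f (span B)" using f.inj_on_iff_eq_0[of "span B"] by auto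
  show "independent (f ` B)" by (rule f.independent_injective_image[OF assms(2) inj])
  show "card (f ` B) = card B" using inj_on_subset[OF inj span_superset] by (rule card_image)
  show "span (f ` B) = f ` span B" by (rule f.span_image)
qed

text \<open>Some basis vector \<open>b\<close> lies outside the kernel; the others are sheared along
  it into the kernel, with the functional normalised to 1 at \<open>b\<close>. This supplies the
  drop of the dimension by exactly one on which the induction rests.\<close>

lemma kernel_basis:
  assumes \<phi>: "functional \<phi>" and B: "finite B" "independent B" and b0: "b0 \<in> span B" "\<phi> b0 \<noteq> 0"
  obtains B0 where "finite B0" "independent B0" "card B = Suc (card B0)" "span B0 = {x \<in> span B. \<phi> x = 0}"
proof -
  obtain b where b: "b \<in> B" "\<phi> b \<noteq> 0"
    using functional_zero_on_span[OF \<phi>, of B b0] b0 by blast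
  define \<psi> where "\<psi> x = \<phi> x / \<phi> b" for x
  have \<psi>: "functional \<psi>" using \<phi> by (auto simp: functional_def \<psi>_def add_divide_distrib)
  have \<psi>b: "\<psi> b = 1" using b by (simp add: \<psi>_def)
  define f where "f x = x - \<psi> x *s b" for x
  have bn: "b \<notin> span (B - {b})" using B(2) b(1) unfolding dependent_def by blast
  have z: "c *s b = 0" if "c *s b \<in> span (B - {b})" for c
    using that bn span_scale[OF that, of "inverse c"] by (cases "c = 0") auto
  have iB: "independent (B - {b})" by (rule independent_mono[OF B(2)]) auto
  note f = independent_shear[OF \<psi> iB, of b, folded f_def]
  have 1: "span (f ` (B - {b})) = f ` span (B - {b})" and 2: "independent (f ` (B - {b}))"
    and 3: "card (f ` (B - {b})) = card (B - {b})" using f z by blast+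
  have f0: "\<phi> (f x) = 0" for x
    using b by (simp add: f_def functional_simps[OF \<phi>] \<psi>_def)
  have "f ` span (B - {b}) = {x \<in> span B. \<phi> x = 0}"
  proof (intro Set.set_eqI iffI)
    fix y assume "y \<in> f ` span (B - {b})"
    then obtain x where x: "x \<in> span (B - {b})" "y = f x" by blast
    have "x \<in> span B" using x(1) span_mono[of "B - {b}" B] by blast
    then have "y \<in> span B"
      unfolding x(2) f_def by (rule span_diff) (intro span_scale span_base b(1))
    then show "y \<in> {x \<in> span B. \<phi> x = 0}" using f0 x by simp
  next
    fix y assume y: "y \<in> {x \<in> span B. \<phi> x = 0}"
    then have "y \<in> span (insert b (B - {b}))" using b by (simp add: insert_absorb)
    then obtain c where c: "y - c *s b \<in> span (B - {b})" using span_breakdown_eq by blast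
    have "f (y - c *s b) = y" using y \<psi>b
      by (simp add: f_def functional_simps[OF \<psi>]) (simp add: \<psi>_def)
    then show "y \<in> f ` span (B - {b})" using c by (metis imageI)
  qed
  then show thesis using that[of "f ` (B - {b})"] 1 2 3 B(1) card_Suc_Diff1[OF B(1) b(1)] by simp
qed

lemma contains_dim_kernel:
  assumes \<phi>: "functional \<phi>" and S: "contains_dim (Suc k) S"
  shows "contains_dim k {x \<in> S. \<phi> x = 0}"
proof -
  obtain B where B: "finite B" "independent B" "card B = Suc k" "span B \<subseteq> S"
    using S by (rule contains_dimE)
  show ?thesis
  proof (cases "\<exists>x\<in>span B. \<phi> x \<noteq> 0")
    case True
    then obtain x where "x \<in> span B" "\<phi> x \<noteq> 0" by blast
    from kernel_basis[OF \<phi> B(1,2) this] obtain B0 where B0: "finite B0" "independent B0"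
      "card B = Suc (card B0)" "span B0 = {x \<in> span B. \<phi> x = 0}" by blast
    then show ?thesis using B by (intro contains_dimI[of B0]) auto
  next
    case False
    then show ?thesis using B by (intro contains_dimI[of B]) auto
  qed
qed

lemma common_kernel_nonzero:
  assumes "finite I" "\<And>i. i \<in> I \<Longrightarrow> functional (\<phi> i)" "contains_dim k S" "card I < k"
  obtains x where "x \<in> S" "x \<noteq> 0" "\<And>i. i \<in> I \<Longrightarrow> \<phi> i x = 0"
proof -
  have "\<exists>x\<in>S. x \<noteq> 0 \<and> (\<forall>i\<in>I. \<phi> i x = 0)"
    using assms
  proof (induct I arbitrary: k S rule: finite_induct)
    case empty
    then obtain B where B: "finite B" "independent B" "card B = k" "span B \<subseteq> S" "k > 0"
      by (auto elim: contains_dimE)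
    then obtain b where "b \<in> B" by fastforce
    moreover have "b \<noteq> 0" using B(2) \<open>b \<in> B\<close> dependent_zero by blast
    ultimately show ?case using B(4) span_base by blast
  next
    case (insert j I)
    obtain l where l: "k = Suc l" using insert.prems(3) by (cases k) auto
    have "contains_dim l {x \<in> S. \<phi> j x = 0}"
      using insert.prems l by (intro contains_dim_kernel) auto
    from insert.hyps(3)[OF _ this] insert.prems insert.hyps l show ?case by auto
  qed
  then show thesis using that by blast
qed

lemma span_eq_of_card:
  assumes "finite B" "independent C" "C \<subseteq> span B" "card B \<le> card C"
  shows "span C = span B"
proof (rule ccontr)
  assume ne: "span C \<noteq> span B"
  have "span C \<subseteq> span B" using assms(3) by (simp add: span_minimal)
  then obtain x where x: "x \<in> span B" "x \<notin> span C" using ne by blast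
  then have "independent (insert x C)" using assms(2) by (simp add: independent_insertI)
  moreover have "insert x C \<subseteq> span B" using assms(3) x by simp
  ultimately have "finite (insert x C) \<and> card (insert x C) \<le> card B"
    by (rule independent_span_bound[OF assms(1)])
  moreover have "x \<notin> C" using x span_base by blast
  ultimately show False using assms(4) by auto
qed

text \<open>
  Projecting along a vector \<open>z\<close> with \<open>Q z z < 0\<close> onto its \<open>Q\<close>-orthogonal complement can only
  increase the form, so a positive definite subspace survives with its dimension.
\<close>

lemma contains_dim_orthogonal_complement:
  assumes Q: "hermitian_form Q" and V: "subspace V" and z: "z \<in> V" "Re (Q z z) < 0"
    and B: "finite B" "independent B" "span B \<subseteq> V" "\<And>x. x \<in> span B \<Longrightarrow> x \<noteq> 0 \<Longrightarrow> Re (Q x x) > 0"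
  shows "contains_dim (card B) {x \<in> V. Q z x = 0 \<and> 0 \<le> Re (Q x x)}"
proof -
  define g where "g = Re (Q z z)"
  have Qz: "Q z z = complex_of_real g" unfolding g_def by (rule form_diag_real[OF Q])
  have g: "g < 0" using z by (simp add: g_def)
  define \<phi> where "\<phi> x = Q z x / g" for x
  have \<phi>: "functional \<phi>" using hermitian_formD(1)[OF Q, of z]
    by (auto simp: functional_def \<phi>_def add_divide_distrib)
  define f where "f x = x - \<phi> x *s z" for x
  \<comment> \<open>On a nonzero multiple of \<open>z\<close> the form is negative, on a nonzero
    vector of \<open>span B\<close> positive. So the projection along \<open>z\<close> is injective
    on \<open>span B\<close>.\<close>
  have z0: "c *s z = 0" if "c *s z \<in> span B" for c
  proof (rule ccontr)
    assume "c *s z \<noteq> 0"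
    then have "Re (Q (c *s z) (c *s z)) > 0" using B(4) that by blast
    also have "Q (c *s z) (c *s z) = complex_of_real ((cmod c)\<^sup>2 * g)"
      by (simp add: form_left[OF Q] form_right[OF Q] Qz complex_norm_square[symmetric] mult.assoc[symmetric])
    finally show False using g by (simp add: zero_less_mult_iff)
  qed
  have f: "independent (f ` B)" "card (f ` B) = card B" "span (f ` B) = f ` span B"
    using independent_shear[OF \<phi> B(2), of z, folded f_def] z0 by blast+
  have "f x \<in> {x \<in> V. Q z x = 0 \<and> 0 \<le> Re (Q x x)}" if x: "x \<in> span B" for x
  proof -
    have 1: "f x \<in> V" unfolding f_def using x B(3) z by (intro subspace_diff[OF V] subspace_scale[OF V]) auto
    have 2: "Q z (f x) = 0" using g by (simp add: f_def form_right[OF Q] \<phi>_def Qz)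
    have "Q (f x) (f x) = Q x (f x) - cnj (\<phi> x) * Q z (f x)"
      by (subst (1) f_def) (simp add: form_left[OF Q])
    also have "\<dots> = Q x x - \<phi> x * Q x z" using 2 by (simp add: f_def form_right[OF Q])
    also have "\<phi> x * Q x z = complex_of_real ((cmod (Q z x))\<^sup>2 / g)"
    proof -
      have "Q x z = cnj (Q z x)" by (rule hermitian_formD(2)[OF Q])
      then show ?thesis unfolding \<phi>_def of_real_divide complex_norm_square by simp
    qed
    finally have "Re (Q (f x) (f x)) = Re (Q x x) - (cmod (Q z x))\<^sup>2 / g" by simp
    moreover have "(cmod (Q z x))\<^sup>2 / g \<le> 0" using g by (simp add: divide_nonneg_neg)
    moreover have "0 \<le> Re (Q x x)" using B(4)[OF x] form_right(3)[OF Q, of 0] by (cases "x = 0") auto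
    ultimately show ?thesis using 1 2 by auto
  qed
  then show ?thesis using f B(1) by (intro contains_dimI[of "f ` B"]) auto
qed

section \<open>Coordinates, orthogonal bases and inertia\<close>

text \<open>Extending \<open>B\<close> to a basis of the whole space makes each coordinate a
  functional everywhere, and not only on \<open>span B\<close>.\<close>

definition coord :: "'a set \<Rightarrow> 'a \<Rightarrow> 'a \<Rightarrow> complex" where
  "coord B b x = representation (extend_basis B) x b"

lemma functional_coord: "independent B \<Longrightarrow> functional (coord B b)"
  unfolding coord_def
  by (intro functional_representation independent_extend_basis) simp_all

lemma coord_basis:
  assumes "independent B" "b' \<in> B" shows "coord B b b' = (if b = b' then 1 else 0)"
proof -
  have "b' \<in> extend_basis B" using extend_basis_superset[OF assms(1)] assms(2) by blast
  then show ?thesis unfolding coord_def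
    using representation_basis[OF independent_extend_basis[OF assms(1)], of b'] by auto
qed

lemma coord_expansion:
  assumes "finite B" "independent B" "x \<in> span B"
  shows "(\<Sum>b\<in>B. coord B b x *s b) = x"
proof -
  obtain u where u: "x = (\<Sum>b\<in>B. u b *s b)" using assms(3) span_finite[OF assms(1)] by auto
  have "coord B b x = u b" if "b \<in> B" for b
  proof -
    note \<phi> = functional_coord[OF assms(2), of b]
    have "coord B b x = (\<Sum>b'\<in>B. u b' * coord B b b')"
      unfolding u functional_sum[OF \<phi>] functional_simps(2)[OF \<phi>] ..
    also have "\<dots> = (\<Sum>b'\<in>B. if b = b' then u b' else 0)"
      by (intro sum.cong refl) (simp add: coord_basis[OF assms(2)])
    finally show ?thesis using that assms(1) by simp
  qed
  then show ?thesis unfolding u by simp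
qed

lemma coord_nonzero:
  assumes "finite B" "independent B" "x \<in> span B" "x \<noteq> 0"
  obtains b where "b \<in> B" "coord B b x \<noteq> 0"
  using coord_expansion[OF assms(1-3)] assms(4)
  by (metis (mono_tags, lifting) scale_zero_left sum.neutral)

text \<open>The diagonal values \<open>Q b b\<close> are neither normalised nor restricted in sign,
  and may vanish.\<close>

definition orthogonal_basis :: "('a \<Rightarrow> 'a \<Rightarrow> complex) \<Rightarrow> 'a set \<Rightarrow> bool" where
  "orthogonal_basis Q B \<longleftrightarrow> finite B \<and> independent B \<and> (\<forall>b\<in>B. \<forall>c\<in>B. b \<noteq> c \<longrightarrow> Q b c = 0)"

lemma orthogonal_basisD:
  assumes "orthogonal_basis Q B"
  shows "finite B" "independent B" "\<And>b c. b \<in> B \<Longrightarrow> c \<in> B \<Longrightarrow> b \<noteq> c \<Longrightarrow> Q b c = 0"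
  using assms unfolding orthogonal_basis_def by blast+

lemma orthogonal_basis_mono: "orthogonal_basis Q B \<Longrightarrow> C \<subseteq> B \<Longrightarrow> orthogonal_basis Q C"
  unfolding orthogonal_basis_def by (meson finite_subset independent_mono subsetD)

lemma orthogonal_basis_form:
  assumes Q: "hermitian_form Q" and B: "orthogonal_basis Q B" and x: "x \<in> span B"
  shows "b \<in> B \<Longrightarrow> Q b x = coord B b x * Q b b"
    and "Q x x = (\<Sum>b\<in>B. complex_of_real ((cmod (coord B b x))\<^sup>2) * Q b b)"
    and "Re (Q x x) = (\<Sum>b\<in>B. (cmod (coord B b x))\<^sup>2 * Re (Q b b))"
proof -
  note B' = orthogonal_basisD[OF B]
  note x' = coord_expansion[OF B'(1,2) x]
  have 1: "Q b x = coord B b x * Q b b" if b: "b \<in> B" for b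
  proof -
    have "Q b x = Q b (\<Sum>c\<in>B. coord B c x *s c)" by (simp add: x')
    also have "\<dots> = (\<Sum>c\<in>B. coord B c x * Q b c)" by (simp add: form_sum[OF Q] form_right[OF Q])
    also have "\<dots> = (\<Sum>c\<in>B. if c = b then coord B b x * Q b b else 0)"
      using B'(3)[OF b] by (intro sum.cong refl) auto
    finally show ?thesis using b B'(1) by simp
  qed
  then show "b \<in> B \<Longrightarrow> Q b x = coord B b x * Q b b" .
  have "Q x x = Q (\<Sum>c\<in>B. coord B c x *s c) x" by (simp add: x')
  also have "\<dots> = (\<Sum>c\<in>B. cnj (coord B c x) * Q c x)" by (simp add: form_sum[OF Q] form_left[OF Q])
  also have "\<dots> = (\<Sum>b\<in>B. complex_of_real ((cmod (coord B b x))\<^sup>2) * Q b b)"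
    using 1 by (intro sum.cong refl) (simp add: complex_norm_square mult.commute mult.left_commute del: of_real_power)
  finally show 2: "Q x x = (\<Sum>b\<in>B. complex_of_real ((cmod (coord B b x))\<^sup>2) * Q b b)" .
  show "Re (Q x x) = (\<Sum>b\<in>B. (cmod (coord B b x))\<^sup>2 * Re (Q b b))"
    unfolding 2 Re_sum by (intro sum.cong refl) (simp del: of_real_power)
qed

lemma hermitian_form_minus: "hermitian_form Q \<Longrightarrow> hermitian_form (\<lambda>x y. - Q x y)"
  using hermitian_form_combination[of Q Q "-1" 0] by simp

lemma orthogonal_basis_minus: "orthogonal_basis Q B \<Longrightarrow> orthogonal_basis (\<lambda>x y. - Q x y) B"
  unfolding orthogonal_basis_def by simp

lemma positive_definite_span:
  assumes Q: "hermitian_form Q" and B: "orthogonal_basis Q B" and pos: "\<And>b. b \<in> B \<Longrightarrow> 0 < Re (Q b b)"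
    and x: "x \<in> span B" "x \<noteq> 0"
  shows "0 < Re (Q x x)"
proof -
  note B' = orthogonal_basisD[OF B]
  obtain b where b: "b \<in> B" "coord B b x \<noteq> 0" using coord_nonzero[OF B'(1,2) x] .
  have "0 < (cmod (coord B b x))\<^sup>2 * Re (Q b b)" using b pos by simp
  also have "\<dots> \<le> (\<Sum>b\<in>B. (cmod (coord B b x))\<^sup>2 * Re (Q b b))"
    using b B'(1) pos by (intro member_le_sum) (auto simp: less_imp_le)
  finally show ?thesis using orthogonal_basis_form(3)[OF Q B x(1)] by simp
qed

text \<open>One half of Sylvester's law of inertia. A subspace of larger dimension would contain a
  nonzero vector whose coordinates at all nonnegative entries vanish, and there the form is
  negative. The other half is \<open>contains_dim_nonneg\<close>.\<close>

lemma nonneg_dim_le_card: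
  assumes Q: "hermitian_form Q" and B: "orthogonal_basis Q B" and k: "contains_dim k {x \<in> span B. 0 \<le> Re (Q x x)}"
  shows "k \<le> card {b \<in> B. 0 \<le> Re (Q b b)}"
proof (rule ccontr)
  note B' = orthogonal_basisD[OF B]
  let ?P = "{b \<in> B. 0 \<le> Re (Q b b)}"
  assume "\<not> k \<le> card ?P"
  then have "card ?P < k" by simp
  have "finite ?P" using B'(1) by simp
  then obtain x where "x \<in> {x \<in> span B. 0 \<le> Re (Q x x)}" "x \<noteq> 0" "\<And>b. b \<in> ?P \<Longrightarrow> coord B b x = 0"
    by (rule common_kernel_nonzero[where \<phi> = "coord B", OF _ functional_coord[OF B'(2)] k \<open>card ?P < k\<close>]) blast+
  then have x: "x \<in> span B" "0 \<le> Re (Q x x)" "x \<noteq> 0" "\<And>b. b \<in> ?P \<Longrightarrow> coord B b x = 0" by blast+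
  obtain c where c: "c \<in> B" "coord B c x \<noteq> 0" using coord_nonzero[OF B'(1,2) x(1,3)] .
  have "(\<Sum>b\<in>B. (cmod (coord B b x))\<^sup>2 * Re (Q b b)) < (\<Sum>b\<in>B. 0)"
  proof (rule sum_strict_mono_ex1[OF B'(1)])
    show "\<forall>b\<in>B. (cmod (coord B b x))\<^sup>2 * Re (Q b b) \<le> 0"
    proof
      fix b assume "b \<in> B"
      then show "(cmod (coord B b x))\<^sup>2 * Re (Q b b) \<le> 0"
        using x(4)[of b] by (cases "0 \<le> Re (Q b b)") (auto simp: mult_le_0_iff)
    qed
    have "\<not> 0 \<le> Re (Q c c)" using x(4)[of c] c by auto
    then show "\<exists>b\<in>B. (cmod (coord B b x))\<^sup>2 * Re (Q b b) < 0"
      using c by (intro bexI[of _ c]) (auto simp: mult_less_0_iff)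
  qed
  then show False using x(2) orthogonal_basis_form(3)[OF Q B x(1)] by simp
qed

lemma contains_dim_nonneg:
  assumes Q: "hermitian_form Q" and B: "orthogonal_basis Q B"
  shows "contains_dim (card {b \<in> B. 0 \<le> Re (Q b b)}) {x \<in> span B. 0 \<le> Re (Q x x)}"
proof -
  let ?P = "{b \<in> B. 0 \<le> Re (Q b b)}"
  have P: "orthogonal_basis Q ?P" by (rule orthogonal_basis_mono[OF B]) auto
  have "0 \<le> Re (Q x x)" if "x \<in> span ?P" for x
    unfolding orthogonal_basis_form(3)[OF Q P that] by (intro sum_nonneg mult_nonneg_nonneg) auto
  moreover have "span ?P \<subseteq> span B" by (rule span_mono) auto
  ultimately have "span ?P \<subseteq> {x \<in> span B. 0 \<le> Re (Q x x)}" by blast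
  then show ?thesis by (rule contains_dimI[OF orthogonal_basisD(1,2)[OF P] order_refl])
qed

section \<open>Eigenvectors of a pencil of forms and simultaneous diagonalization\<close>

text \<open>An equation between the functionals \<open>h v\<close> and \<open>q v\<close> on
  \<open>V\<close>; the second alternative is the eigenvalue at infinity. For Hermitian forms a
  nonreal \<mu> forces \<open>h v v = 0\<close> and \<open>q v v = 0\<close>, since both values are
  real, so such an eigenvector is isotropic.\<close>

definition pencil_eigenvector :: "('a \<Rightarrow> 'a \<Rightarrow> complex) \<Rightarrow> ('a \<Rightarrow> 'a \<Rightarrow> complex) \<Rightarrow> 'a set \<Rightarrow> 'a \<Rightarrow> bool" where
  "pencil_eigenvector h q V v \<longleftrightarrow> v \<in> V \<and> v \<noteq> 0 \<and>
     ((\<exists>\<mu>. \<forall>w\<in>V. h v w = \<mu> * q v w) \<or> (\<forall>w\<in>V. q v w = 0))"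

text \<open>Passes to the Gram matrices of both forms; an eigenvector of the matrix pencil holds the
  coordinates of \<open>v\<close>.\<close>

lemma pencil_eigenvector_exists:
  assumes h: "hermitian_form h" and q: "hermitian_form q" and B: "finite B" "independent B" "B \<noteq> {}"
  obtains v where "pencil_eigenvector h q (span B) v"
proof -
  obtain bs where bs: "set bs = B" "distinct bs" using finite_distinct_list[OF B(1)] by blast
  define n where "n = length bs"
  have n: "n > 0" using bs B(3) by (auto simp: n_def)
  have bsB: "bs ! i \<in> B" if "i < n" for i using that bs by (auto simp: n_def)
  have Bbs: "\<exists>i<n. b = bs ! i" if "b \<in> B" for b using that bs by (auto simp: n_def in_set_conv_nth)
  define G where "G Q = mat n n (\<lambda>(i, j). Q (bs ! i) (bs ! j))" for Q :: "'a \<Rightarrow> 'a \<Rightarrow> complex"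
  have G: "G Q \<in> carrier_mat n n" for Q by (simp add: G_def)
  obtain c where c: "c \<in> carrier_vec n" "c \<noteq> 0\<^sub>v n"
    "G q *\<^sub>v c = 0\<^sub>v n \<or> (\<exists>\<mu>. G h *\<^sub>v c = \<mu> \<cdot>\<^sub>v (G q *\<^sub>v c))"
    using mat_pencil_eigenvector[OF G G n] .
  define v where "v = (\<Sum>j<n. c $ j *s bs ! j)"
  have v: "v \<in> span B" unfolding v_def by (intro span_sum span_scale span_base) (simp add: bsB)
  have GQ: "(G Q *\<^sub>v c) $ i = Q (bs ! i) v" if "hermitian_form Q" "i < n" for Q i
    using that c(1) by (simp add: G_def v_def form_sum[OF that(1)] form_right[OF that(1)]
        scalar_prod_def atLeast0LessThan mult.commute)
  have "v \<noteq> 0"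
  proof
    assume v0: "v = 0"
    have "c $ i = 0" if i: "i < n" for i
    proof -
      note \<phi> = functional_coord[OF B(2), of "bs ! i"]
      have "0 = coord B (bs ! i) v" using functional_simps(3)[OF \<phi>] v0 by simp
      also have "\<dots> = (\<Sum>j<n. c $ j * coord B (bs ! i) (bs ! j))"
        unfolding v_def functional_sum[OF \<phi>] functional_simps(2)[OF \<phi>] ..
      also have "\<dots> = (\<Sum>j<n. if j = i then c $ i else 0)"
        using i bs by (intro sum.cong refl) (auto simp: coord_basis[OF B(2)] bsB n_def nth_eq_iff_index_eq)
      finally show ?thesis using i by simp
    qed
    then have "c = 0\<^sub>v n" using c(1) by (intro eq_vecI) auto
    then show False using c(2) by simp
  qed
  moreover have "(\<exists>\<mu>. \<forall>w\<in>span B. h v w = \<mu> * q v w) \<or> (\<forall>w\<in>span B. q v w = 0)"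
    using c(3)
  proof
    assume "G q *\<^sub>v c = 0\<^sub>v n"
    then have "q (bs ! i) v = 0" if "i < n" for i using GQ[OF q that] that by simp
    then have "q v b = 0" if "b \<in> B" for b using Bbs[OF that] hermitian_formD(2)[OF q, of v b] by auto
    then show ?thesis using functional_zero_on_span[OF hermitian_formD(1)[OF q]] by blast
  next
    assume "\<exists>\<mu>. G h *\<^sub>v c = \<mu> \<cdot>\<^sub>v (G q *\<^sub>v c)"
    then obtain \<mu> where \<mu>: "G h *\<^sub>v c = \<mu> \<cdot>\<^sub>v (G q *\<^sub>v c)" by blast
    have "h (bs ! i) v = \<mu> * q (bs ! i) v" if i: "i < n" for i
      using GQ[OF h i] GQ[OF q i] i G[of q] c(1) unfolding \<mu> by simp
    \<comment> \<open>The rows of the Gram matrices test \<open>v\<close> in the second argument;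
      moving it to the first conjugates the eigenvalue.\<close>
    then have e: "h v b - cnj \<mu> * q v b = 0" if "b \<in> B" for b
      using Bbs[OF that] hermitian_formD(2)[OF q, of v b] hermitian_formD(2)[OF h, of v b] by auto
    have "functional (\<lambda>w. h v w - cnj \<mu> * q v w)"
      using hermitian_formD(1)[OF q, of v] hermitian_formD(1)[OF h, of v]
      by (auto simp: functional_def algebra_simps)
    from functional_zero_on_span[OF this e]
    have "\<forall>w\<in>span B. h v w = cnj \<mu> * q v w" by simp
    then show ?thesis by blast
  qed
  ultimately show thesis using that v unfolding pencil_eigenvector_def by blast
qed

text \<open>Treats finite and infinite eigenvalues alike: \<open>h v\<close> and \<open>q v\<close>
  are multiples of a single functional, so the vectors orthogonal to \<open>v\<close> for both forms
  are its kernel. If it vanishes on \<open>V\<close>, then \<open>v\<close> lies in both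
  radicals.\<close>

lemma pencil_eigenvector_functional:
  assumes h: "hermitian_form h" and q: "hermitian_form q" and v: "pencil_eigenvector h q V v"
  obtains \<phi> \<alpha> \<beta> where "functional \<phi>" "\<And>w. w \<in> V \<Longrightarrow> h v w = \<alpha> * \<phi> w" "\<And>w. w \<in> V \<Longrightarrow> q v w = \<beta> * \<phi> w"
    "\<alpha> \<noteq> 0 \<or> \<beta> \<noteq> 0"
proof (cases "\<forall>w\<in>V. q v w = 0")
  case True
  then show thesis using that[of "h v" 1 0] hermitian_formD(1)[OF h] by simp
next
  case False
  then obtain \<mu> where "\<forall>w\<in>V. h v w = \<mu> * q v w" using v unfolding pencil_eigenvector_def by blast
  then show thesis using that[of "q v" \<mu> 1] hermitian_formD(1)[OF q] by simp
qed

text \<open>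
  An eigenvector of the pencil that is not isotropic for both forms splits off as an orthogonal
  summand, and an isotropic eigenvector of the complement is one of the whole space.
\<close>

lemma simultaneous_diagonalization:
  assumes h: "hermitian_form h" and q: "hermitian_form q" and B: "finite B" "independent B"
    and noniso: "\<And>v. pencil_eigenvector h q (span B) v \<Longrightarrow> h v v \<noteq> 0 \<or> q v v \<noteq> 0"
  obtains D where "orthogonal_basis h D" "orthogonal_basis q D" "span D = span B" "card D = card B"
proof -
  have "\<exists>D. orthogonal_basis h D \<and> orthogonal_basis q D \<and> span D = span B \<and> card D = card B"
    using B noniso
  proof (induct "card B" arbitrary: B)
    case 0
    then show ?case by (intro exI[of _ "{}"]) (auto simp: orthogonal_basis_def)
  next
    case (Suc n B)
    note B = Suc.prems(1,2)
    have "B \<noteq> {}" using Suc.hyps(2) by auto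
    then obtain v where v: "pencil_eigenvector h q (span B) v"
      using pencil_eigenvector_exists[OF h q B] by blast
    have vB: "v \<in> span B" and v0: "v \<noteq> 0" using v by (auto simp: pencil_eigenvector_def)
    obtain \<phi> \<alpha> \<beta> where \<phi>: "functional \<phi>" "\<And>w. w \<in> span B \<Longrightarrow> h v w = \<alpha> * \<phi> w"
      "\<And>w. w \<in> span B \<Longrightarrow> q v w = \<beta> * \<phi> w"
      using pencil_eigenvector_functional[OF h q v] by metis
    \<comment> \<open>The values \<open>h v v\<close> and \<open>q v v\<close> are multiples of
      \<open>\<phi> v\<close>, so non-isotropy puts \<open>v\<close> outside the kernel, and
      \<open>v\<close> complements it.\<close>
    have \<phi>v: "\<phi> v \<noteq> 0" using Suc.prems(3)[OF v] \<phi>(2,3)[OF vB] by auto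
    obtain B0 where B0: "finite B0" "independent B0" "card B = Suc (card B0)"
      "span B0 = {x \<in> span B. \<phi> x = 0}"
      using kernel_basis[OF \<phi>(1) B vB \<phi>v] .
    have orth: "h v w = 0" "q v w = 0" "h w v = 0" "q w v = 0" if "w \<in> span B0" for w
    proof -
      show hq: "h v w = 0" "q v w = 0" using that \<phi>(2,3)[of w] B0(4) by auto
      show "h w v = 0" "q w v = 0"
        using hq hermitian_formD(2)[OF h, of w v] hermitian_formD(2)[OF q, of w v] by simp_all
    qed
    have noniso0: "h x x \<noteq> 0 \<or> q x x \<noteq> 0" if x: "pencil_eigenvector h q (span B0) x" for x
    proof (rule Suc.prems(3))
      have x0: "x \<in> span B0" "x \<noteq> 0" using x by (auto simp: pencil_eigenvector_def)
      \<comment> \<open>A vector of \<open>span B\<close> differs from one of \<open>span B0\<close>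
        by a multiple of \<open>v\<close>, which is orthogonal to \<open>x\<close>. Hence
        eigenvector equations extend from \<open>span B0\<close> to \<open>span B\<close>.\<close>
      have red: "\<exists>w'\<in>span B0. h x w = h x w' \<and> q x w = q x w'" if w: "w \<in> span B" for w
      proof -
        let ?w = "w - (\<phi> w / \<phi> v) *s v"
        have "?w \<in> span B0" unfolding B0(4) using w vB \<phi>v
          by (auto simp: functional_simps[OF \<phi>(1)] intro: span_diff span_scale)
        moreover have "h x w = h x ?w" "q x w = q x ?w"
          using orth(3,4)[OF x0(1)] by (simp_all add: form_right[OF h] form_right[OF q])
        ultimately show ?thesis by blast
      qed
      have "x \<in> span B" using x0 B0(4) by blast
      moreover have "(\<exists>\<mu>. \<forall>w\<in>span B. h x w = \<mu> * q x w) \<or> (\<forall>w\<in>span B. q x w = 0)"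
      proof -
        consider \<mu> where "\<forall>w\<in>span B0. h x w = \<mu> * q x w" | "\<forall>w\<in>span B0. q x w = 0"
          using x by (auto simp: pencil_eigenvector_def)
        then show ?thesis
        proof cases
          case 1
          then have "\<forall>w\<in>span B. h x w = \<mu> * q x w" using red by metis
          then show ?thesis by blast
        next
          case 2
          then have "\<forall>w\<in>span B. q x w = 0" using red by metis
          then show ?thesis by blast
        qed
      qed
      ultimately show "pencil_eigenvector h q (span B) x" using x0 by (simp add: pencil_eigenvector_def)
    qed
    have "n = card B0" using Suc.hyps(2) B0(3) by simp
    from Suc.hyps(1)[OF this B0(1,2) noniso0]
    obtain D where D: "orthogonal_basis h D" "orthogonal_basis q D" "span D = span B0" "card D = card B0"
      by blast
    note D' = orthogonal_basisD[OF D(1)]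
    have vD: "v \<notin> span D" using \<phi>v by (simp add: D(3) B0(4))
    then have indep: "independent (insert v D)" using D'(2) by (rule independent_insertI)
    have "v \<notin> D" using vD span_base by blast
    then have card: "card (insert v D) = card B" using D'(1) D(4) B0(3) by simp
    have DB0: "D \<subseteq> span B0" using D(3) span_superset by blast
    then have "insert v D \<subseteq> span B" using vB B0(4) by blast
    then have "span (insert v D) = span B" using span_eq_of_card[OF B(1) indep] card by simp
    moreover have "orthogonal_basis h (insert v D)" "orthogonal_basis q (insert v D)"
      using D(1,2) indep orth DB0 unfolding orthogonal_basis_def by (auto 4 3)
    ultimately show ?case using card by blast
  qed
  then show thesis using that by blast
qed

text \<open>If the subspace is not already orthogonal to \<open>v\<close>, cutting it with the
  complement of \<open>v\<close> costs one dimension, and adjoining \<open>v\<close> wins it back,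
  because \<open>v\<close> is isotropic and orthogonal to what remains. For this \<open>v\<close>
  must lie outside the subspace: otherwise adding multiples of \<open>v\<close> to a vector
  \<open>p\<close> with \<open>Q v p \<noteq> 0\<close> would make the form negative.\<close>

lemma contains_dim_isotropic_orthogonal:
  assumes Q: "hermitian_form Q" and V: "subspace V" and v: "v \<in> V" "v \<noteq> 0" "Q v v = 0"
    and k: "contains_dim k {x \<in> V. 0 \<le> Re (Q x x)}"
  shows "contains_dim k {x \<in> V. Q v x = 0 \<and> 0 \<le> Re (Q x x)}"
proof -
  obtain B where B: "finite B" "independent B" "card B = k" "span B \<subseteq> {x \<in> V. 0 \<le> Re (Q x x)}"
    using k by (rule contains_dimE)
  show ?thesis
  proof (cases "\<forall>x\<in>span B. Q v x = 0")
    case True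
    then show ?thesis using B by (intro contains_dimI[of B]) auto
  next
    case False
    then obtain p where p: "p \<in> span B" "Q v p \<noteq> 0" by blast
    have vB: "v \<notin> span B"
    proof
      assume vB: "v \<in> span B"
      define m where "m = (cmod (Q v p))\<^sup>2"
      have m: "m > 0" using p by (simp add: m_def)
      \<comment> \<open>Chosen so that \<open>Re (Q p p) - 2 * (r * m)\<close>, the value at
        \<open>p + c *s v\<close>, becomes -1.\<close>
      define r where "r = (Re (Q p p) + 1) / (2 * m)"
      define c where "c = - (complex_of_real r * Q v p)"
      have pv: "Q p v = cnj (Q v p)" by (rule hermitian_formD(2)[OF Q])
      have "Q (p + c *s v) (p + c *s v) = Q p p + c * cnj (Q v p) + cnj c * Q v p"
        by (simp add: form_left[OF Q] form_right[OF Q] v(3) pv algebra_simps)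
      also have "\<dots> = Q p p - 2 * complex_of_real (r * m)"
        unfolding c_def m_def of_real_mult complex_norm_square by (simp add: algebra_simps)
      finally have "Re (Q (p + c *s v) (p + c *s v)) = Re (Q p p) - 2 * (r * m)" by simp
      also have "\<dots> = -1" using m by (simp add: r_def field_simps)
      finally have "Re (Q (p + c *s v) (p + c *s v)) = -1" .
      moreover have "p + c *s v \<in> span B" using p vB by (intro span_add span_scale)
      ultimately show False using B(4) by force
    qed
    obtain B0 where B0: "finite B0" "independent B0" "card B = Suc (card B0)"
      "span B0 = {x \<in> span B. Q v x = 0}"
      using kernel_basis[OF hermitian_formD(1)[OF Q] B(1,2) p] .
    have vB0: "v \<notin> span B0" using vB B0(4) by blast
    then have "v \<notin> B0" using span_base by blast
    then have card: "card (insert v B0) = k" using B0 B(3) by simp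
    have "x \<in> {x \<in> V. Q v x = 0 \<and> 0 \<le> Re (Q x x)}" if x': "x \<in> span (insert v B0)" for x
    proof -
      obtain c where c: "x - c *s v \<in> span B0" using x' span_breakdown_eq by blast
      define y where "y = x - c *s v"
      have x: "x = y + c *s v" by (simp add: y_def)
      have y: "y \<in> V" "Q v y = 0" "0 \<le> Re (Q y y)" using c B0(4) B(4) by (auto simp: y_def)
      have "Q y v = 0" using y(2) hermitian_formD(2)[OF Q, of y v] by simp
      then show ?thesis unfolding x using y v
        by (auto simp: form_left[OF Q] form_right[OF Q] intro!: subspace_add[OF V] subspace_scale[OF V])
    qed
    then show ?thesis using B0 card independent_insertI[OF vB0 B0(2)]
      by (intro contains_dimI[of "insert v B0"]) auto
  qed
qed

subsection \<open>Common isotropic subspaces of two forms\<close>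

text \<open>With the minus sign a diagonal entry \<open>u b - t * v b\<close> vanishes at
  \<open>u b / v b\<close>. The application to matrices compensates by negating the imaginary
  form.\<close>

abbreviation pencil_form :: "('a \<Rightarrow> 'a \<Rightarrow> complex) \<Rightarrow> ('a \<Rightarrow> 'a \<Rightarrow> complex) \<Rightarrow> real \<Rightarrow> 'a \<Rightarrow> 'a \<Rightarrow> complex" where
  "pencil_form h q t \<equiv> \<lambda>x y. h x y - complex_of_real t * q x y"

text \<open>The invariant of the induction. For the forms of a matrix it amounts to the two
  eigenvalue inequalities of the test, see \<open>eigval_bounds_iff_balanced\<close>.\<close>

definition balanced :: "nat \<Rightarrow> ('a \<Rightarrow> 'a \<Rightarrow> complex) \<Rightarrow> 'a set \<Rightarrow> bool" where
  "balanced k Q V \<longleftrightarrow> contains_dim k {x \<in> V. 0 \<le> Re (Q x x)} \<and> contains_dim k {x \<in> V. Re (Q x x) \<le> 0}"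

lemma contains_dim_minus:
  "contains_dim k {x \<in> V. 0 \<le> Re (- Q x x)} \<longleftrightarrow> contains_dim k {x \<in> V. Re (Q x x) \<le> 0}"
  "contains_dim k {x \<in> V. Re (- Q x x) \<le> 0} \<longleftrightarrow> contains_dim k {x \<in> V. 0 \<le> Re (Q x x)}"
  by simp_all

lemma balanced_minus: "balanced k (\<lambda>x y. - Q x y) V \<longleftrightarrow> balanced k Q V"
  unfolding balanced_def contains_dim_minus by blast

lemma balanced_isotropic_orthogonal:
  assumes Q: "hermitian_form Q" and V: "subspace V" and v: "v \<in> V" "v \<noteq> 0" "Q v v = 0"
    and k: "balanced k Q V"
  shows "balanced k Q {x \<in> V. Q v x = 0}"
proof -
  have "contains_dim k {x \<in> V. Q v x = 0 \<and> 0 \<le> Re (Q x x)}"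
    using contains_dim_isotropic_orthogonal[OF Q V v] k unfolding balanced_def by blast
  moreover have "contains_dim k {x \<in> V. - Q v x = 0 \<and> 0 \<le> Re (- Q x x)}"
    using contains_dim_isotropic_orthogonal[OF hermitian_form_minus[OF Q] V v(1,2)] v(3) k
    unfolding balanced_def contains_dim_minus by simp
  ultimately show ?thesis unfolding balanced_def by (simp add: conj_assoc)
qed

lemma balanced_kernel:
  assumes \<phi>: "functional \<phi>" and k: "balanced (Suc k) Q V"
  shows "balanced k Q {x \<in> V. \<phi> x = 0}"
proof -
  have e: "{x \<in> {x \<in> V. \<phi> x = 0}. P x} = {x \<in> {x \<in> V. P x}. \<phi> x = 0}" for P by auto
  show ?thesis using k unfolding balanced_def e by (intro conjI contains_dim_kernel[OF \<phi>]) blast+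
qed

text \<open>Both \<open>b\<close> and \<open>c\<close> lie in the radical of \<open>R\<close> on
  \<open>span D\<close>, and square roots as coefficients balance the opposite values of
  \<open>S\<close>. With \<open>R\<close> taken as a member of the pencil, or as \<open>q\<close>,
  the result is an isotropic pencil eigenvector, which yields the contradictions in
  \<open>balanced_hyperplane\<close>.\<close>

lemma isotropic_combination:
  assumes R: "hermitian_form R" and S: "hermitian_form S"
    and D: "orthogonal_basis R D" "orthogonal_basis S D"
    and bc: "b \<in> D" "c \<in> D" "Re (R b b) = 0" "Re (R c c) = 0" "Re (S b b) > 0" "Re (S c c) < 0"
  obtains x where "x \<in> span D" "x \<noteq> 0" "\<And>w. w \<in> span D \<Longrightarrow> R x w = 0" "S x x = 0"
proof -
  note D' = orthogonal_basisD[OF D(1)] orthogonal_basisD(3)[OF D(2)]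
  define \<beta> \<gamma> where "\<beta> = complex_of_real (sqrt (- Re (S c c)))" and "\<gamma> = complex_of_real (sqrt (Re (S b b)))"
  define x where "x = \<beta> *s b + \<gamma> *s c"
  have ne: "b \<noteq> c" using bc by auto
  have Rz: "R d w = 0" if "Re (R d d) = 0" "d \<in> D" "w \<in> span D" for d w
  proof -
    have "R d d = 0" using form_diag_real[OF R, of d] that(1) by simp
    then have "R d e = 0" if "e \<in> D" for e using D'(3)[OF \<open>d \<in> D\<close> that] by (cases "d = e") auto
    then show ?thesis using functional_zero_on_span[OF hermitian_formD(1)[OF R]] that(3) by blast
  qed
  have Sbc: "S b c = 0" "S c b = 0" using D'(4) bc ne by blast+
  have real: "S d d = complex_of_real (Re (S d d))" for d by (rule form_diag_real[OF S])
  have 1: "x \<in> span D" unfolding x_def using bc by (intro span_add span_scale span_base)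
  have "S b x = \<beta> * S b b" by (simp add: x_def form_right[OF S] Sbc)
  moreover have "\<beta> \<noteq> 0" "S b b \<noteq> 0" using bc by (auto simp: \<beta>_def)
  ultimately have 2: "x \<noteq> 0" using form_right(3)[OF S, of b] by auto
  have 3: "R x w = 0" if "w \<in> span D" for w
    using Rz[OF bc(3,1) that] Rz[OF bc(4,2) that] by (simp add: x_def form_left[OF R])
  have "S x x = cnj \<beta> * \<beta> * S b b + cnj \<gamma> * \<gamma> * S c c"
    by (simp add: x_def form_left[OF S] form_right[OF S] Sbc algebra_simps)
  also have "cnj \<beta> * \<beta> = complex_of_real (- Re (S c c))"
    using bc unfolding \<beta>_def complex_cnj_complex_of_real of_real_mult[symmetric] by simp
  also have "cnj \<gamma> * \<gamma> = complex_of_real (Re (S b b))"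
    using bc unfolding \<gamma>_def complex_cnj_complex_of_real of_real_mult[symmetric] by simp
  also have "complex_of_real (- Re (S c c)) * S b b + complex_of_real (Re (S b b)) * S c c = 0"
    by (subst (2) real, subst (3) real) simp
  finally have 4: "S x x = 0" .
  show thesis using that 1 2 3 4 by blast
qed

lemma orthogonal_basis_pencil: "orthogonal_basis h D \<Longrightarrow> orthogonal_basis q D \<Longrightarrow> orthogonal_basis (pencil_form h q t) D"
  unfolding orthogonal_basis_def by auto

text \<open>
  The hyperplane is the orthogonal complement of a vector \<open>z\<close> depending on \<open>t\<close> such that the
  value of the pencil at \<open>z\<close> is the weighted sum of \<open>sign_weights\<close>. Where that value is negative,
  compressing to the hyperplane does not diminish the positive part.
\<close>

lemma balanced_hyperplane_of_minimal:
  assumes h: "hermitian_form h" and q: "hermitian_form q"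
    and D: "orthogonal_basis h D" "orthogonal_basis q D"
    and uv: "\<And>b. u b = Re (h b b)" "\<And>b. v b = Re (q b b)" and signs: "affine_signs D u v"
    and pk: "\<And>t. t \<notin> affine_signs.zeros D u v \<Longrightarrow> k \<le> card (affine_signs.pos D u v t)"
    and nk: "\<And>t. t \<notin> affine_signs.zeros D u v \<Longrightarrow> k \<le> card (affine_signs.neg D u v t)"
    and t0: "t0 \<notin> affine_signs.zeros D u v" "card (affine_signs.pos D u v t0) = k"
    and ne: "affine_signs.zeros D u v \<noteq> {}"
  obtains \<phi> x where "functional \<phi>" "x \<in> span D" "\<phi> x \<noteq> 0"
    "\<And>t. t \<notin> affine_signs.zeros D u v \<Longrightarrow> balanced k (pencil_form h q t) {x \<in> span D. \<phi> x = 0}"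
proof -
  interpret affine_signs D u v by (rule signs)
  note D' = orthogonal_basisD[OF D(1)]
  obtain w where w: "\<And>b. b \<in> D \<Longrightarrow> 0 \<le> w b" "\<exists>b\<in>D. 0 < w b" "\<exists>t. t \<notin> zeros \<and> k < card (pos t)"
    "\<And>t. t \<notin> zeros \<Longrightarrow> card (pos t) = k \<Longrightarrow> (\<Sum>b\<in>D. w b / (u b - t * v b)) < 0"
    "\<And>t. t \<notin> zeros \<Longrightarrow> k < card (pos t) \<Longrightarrow> (\<Sum>b\<in>D. w b / (u b - t * v b)) > 0"
    by (rule sign_weights[OF pk t0 ne]) blast+
  obtain t1 where "t1 \<notin> zeros" "k < card (pos t1)" using w(3) by blast
  \<comment> \<open>At \<open>t1\<close> there are more than \<open>k\<close> positive and at least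
    \<open>k\<close> negative entries. Hence wherever exactly \<open>k\<close> entries are positive,
    at least \<open>k + 1\<close> are negative.\<close>
  then have big: "2 * k < card D" using nk[of t1] pos_neg_card[of t1] by simp
  \<comment> \<open>Square roots, so that the pencil at the vector \<open>z\<close> representing
    \<phi> takes a value linear in the weights. Only \<open>z\<close> depends on \<open>t\<close>;
    the hyperplane does not.\<close>
  define \<phi> where "\<phi> x = (\<Sum>b\<in>D. complex_of_real (sqrt (w b)) * coord D b x)" for x
  have \<phi>: "functional \<phi>" using functional_coord[OF D'(2)]
    by (simp add: functional_def \<phi>_def distrib_left sum.distrib sum_distrib_left mult.left_commute)
  obtain d where d: "d \<in> D" "0 < w d" using w(2) by blast
  have "\<phi> d = (\<Sum>b\<in>D. if b = d then complex_of_real (sqrt (w d)) else 0)"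
    unfolding \<phi>_def using d by (intro sum.cong refl) (auto simp: coord_basis[OF D'(2)])
  then have \<phi>d: "\<phi> d \<noteq> 0" using d D'(1) by simp
  have bal: "balanced k (pencil_form h q t) {x \<in> span D. \<phi> x = 0}" if t: "t \<notin> zeros" for t
  proof -
    let ?Q = "pencil_form h q t"
    have Q: "hermitian_form ?Q" by (rule hermitian_form_pencil[OF h q])
    have DQ: "orthogonal_basis ?Q D" by (rule orthogonal_basis_pencil[OF D])
    have e: "Re (?Q b b) = u b - t * v b" for b by (simp add: uv)
    have eQ: "?Q b b = complex_of_real (u b - t * v b)" for b
      using form_diag_real[OF Q, of b] unfolding e .
    define z where "z = (\<Sum>b\<in>D. complex_of_real (sqrt (w b) / (u b - t * v b)) *s b)"
    have zD: "z \<in> span D" unfolding z_def by (intro span_sum span_scale span_base)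
    have Qz: "?Q z x = \<phi> x" if x: "x \<in> span D" for x
    proof -
      have "?Q z x = (\<Sum>b\<in>D. complex_of_real (sqrt (w b) / (u b - t * v b)) * ?Q b x)"
        unfolding z_def by (simp add: form_sum(2)[OF Q] form_left(2)[OF Q] del: of_real_divide)
      also have "\<dots> = \<phi> x" unfolding \<phi>_def
      proof (rule sum.cong[OF refl])
        fix b assume b: "b \<in> D"
        have "u b - t * v b \<noteq> 0" using nonzero_off_zeros[OF t b] .
        then have "complex_of_real (u b - t * v b) \<noteq> 0" using of_real_eq_0_iff by blast
        then show "complex_of_real (sqrt (w b) / (u b - t * v b)) * ?Q b x = complex_of_real (sqrt (w b)) * coord D b x"
          unfolding orthogonal_basis_form(1)[OF Q DQ x b] eQ of_real_divide by simp
      qed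
      finally show ?thesis .
    qed
    have "\<phi> z = complex_of_real (\<Sum>b\<in>D. w b / (u b - t * v b))"
    proof -
      have "coord D b z = complex_of_real (sqrt (w b) / (u b - t * v b))" if b: "b \<in> D" for b
      proof -
        note \<psi> = functional_coord[OF D'(2), of b]
        have "coord D b z = (\<Sum>c\<in>D. if c = b then complex_of_real (sqrt (w b) / (u b - t * v b)) else 0)"
          unfolding z_def functional_sum[OF \<psi>] functional_simps(2)[OF \<psi>]
          using b by (intro sum.cong refl) (auto simp: coord_basis[OF D'(2)])
        then show ?thesis using b D'(1) by simp
      qed
      then have "\<phi> z = (\<Sum>b\<in>D. complex_of_real (sqrt (w b) * (sqrt (w b) / (u b - t * v b))))"
        unfolding \<phi>_def by (intro sum.cong refl) (simp only: of_real_mult)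
      also have "\<dots> = (\<Sum>b\<in>D. complex_of_real (w b / (u b - t * v b)))"
        using w(1) by (intro sum.cong refl arg_cong[of _ _ complex_of_real]) simp
      finally show ?thesis by simp
    qed
    then have Qzz: "Re (?Q z z) = (\<Sum>b\<in>D. w b / (u b - t * v b))" using Qz[OF zD] by simp
    have DP: "orthogonal_basis ?Q (pos t)" by (rule orthogonal_basis_mono[OF DQ]) (auto simp: pos_def)
    have DN: "orthogonal_basis (\<lambda>x y. - ?Q x y) (neg t)"
      by (rule orthogonal_basis_mono[OF orthogonal_basis_minus[OF DQ]]) (auto simp: neg_def)
    have "0 < Re (?Q b b)" if "b \<in> pos t" for b using that unfolding e pos_def by simp
    note posdef = positive_definite_span[OF Q DP this]
    have "0 < Re (- ?Q b b)" if "b \<in> neg t" for b using that unfolding uminus_complex.sel e neg_def by simp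
    note negdef = positive_definite_span[OF hermitian_form_minus[OF Q] DN this]
    have indep: "independent (pos t)" "independent (neg t)"
      by (rule independent_mono[OF D'(2)]; auto simp: pos_def neg_def)+
    have sub: "span (pos t) \<subseteq> span D" "span (neg t) \<subseteq> span D"
      by (rule span_mono; auto simp: pos_def neg_def)+
    have P: "contains_dim (card (pos t)) {x \<in> span D. 0 \<le> Re (?Q x x)}"
    proof (rule contains_dimI[OF finite_pos indep(1) order_refl])
      show "span (pos t) \<subseteq> {x \<in> span D. 0 \<le> Re (?Q x x)}"
        using posdef sub(1) form_right(3)[OF Q] by (force simp: less_imp_le)
    qed
    have N: "contains_dim (card (neg t)) {x \<in> span D. Re (?Q x x) \<le> 0}"
    proof (rule contains_dimI[OF finite_neg indep(2) order_refl])
      show "span (neg t) \<subseteq> {x \<in> span D. Re (?Q x x) \<le> 0}"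
        using negdef sub(2) form_right(3)[OF Q] by (force simp: less_imp_le)
    qed
    have zk: "?Q z x = 0 \<longleftrightarrow> \<phi> x = 0" if "x \<in> span D" for x by (simp only: Qz[OF that])
    have zk': "- ?Q z x = 0 \<and> 0 \<le> Re (- ?Q x x) \<longleftrightarrow> \<phi> x = 0 \<and> Re (?Q x x) \<le> 0" if "x \<in> span D" for x
      by (simp only: Qz[OF that] uminus_complex.sel neg_0_le_iff_le neg_equal_0_iff_equal)
    have sw: "{x \<in> {x \<in> span D. \<phi> x = 0}. R x} = {x \<in> {x \<in> span D. R x}. \<phi> x = 0}" for R by auto
    \<comment> \<open>With exactly \<open>k\<close> positive entries, the positive part is kept by
      projecting along the negative vector \<open>z\<close>, while the negative part can afford the
      loss of a dimension by \<open>big\<close>. Otherwise the roles of the two parts are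
      exchanged.\<close>
    show ?thesis
    proof (cases "card (pos t) = k")
      case True
      then have "Re (?Q z z) < 0" using w(4)[OF t] Qzz by simp
      from contains_dim_orthogonal_complement[OF Q subspace_span zD this finite_pos indep(1) sub(1) posdef]
      have "contains_dim k {x \<in> span D. ?Q z x = 0 \<and> 0 \<le> Re (?Q x x)}" unfolding True .
      then have 1: "contains_dim k {x \<in> {x \<in> span D. \<phi> x = 0}. 0 \<le> Re (?Q x x)}"
        by (rule contains_dim_mono[OF _ order_refl]) (use zk in blast)
      have "Suc k \<le> card (neg t)" using pos_neg_card[OF t] big True by simp
      then have "contains_dim (Suc k) {x \<in> span D. Re (?Q x x) \<le> 0}" by (rule contains_dim_mono[OF N _ order_refl])
      from contains_dim_kernel[OF \<phi> this] 1 show ?thesis unfolding balanced_def sw by blast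
    next
      case False
      then have kp: "k < card (pos t)" using pk[OF t] by simp
      then have z': "Re (- ?Q z z) < 0" using w(5)[OF t] Qzz by simp
      have "contains_dim (card (neg t)) {x \<in> span D. - ?Q z x = 0 \<and> 0 \<le> Re (- ?Q x x)}"
        using contains_dim_orthogonal_complement[OF hermitian_form_minus[OF Q] subspace_span zD z' finite_neg indep(2) sub(2) negdef] .
      then have 1: "contains_dim k {x \<in> {x \<in> span D. \<phi> x = 0}. Re (?Q x x) \<le> 0}"
        by (rule contains_dim_mono[OF _ nk[OF t]]) (use zk' in blast)
      have "contains_dim (Suc k) {x \<in> span D. 0 \<le> Re (?Q x x)}"
        by (rule contains_dim_mono[OF P _ order_refl]) (use kp in simp)
      from contains_dim_kernel[OF \<phi> this] 1 show ?thesis unfolding balanced_def sw by blast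
    qed
  qed
  show thesis using that[OF \<phi> _ \<phi>d bal] span_base[OF d(1)] by blast
qed

text \<open>If the positive count attains \<open>k\<close> somewhere, the weighted hyperplane works;
  if the negative count does, so does the one for the negated forms. If neither is ever minimal, any
  hyperplane will do, because both parts have a dimension to spare.\<close>

lemma balanced_hyperplane:
  assumes h: "hermitian_form h" and q: "hermitian_form q"
    and D: "orthogonal_basis h D" "orthogonal_basis q D"
    and noniso: "\<And>x. pencil_eigenvector h q (span D) x \<Longrightarrow> h x x \<noteq> 0 \<or> q x x \<noteq> 0"
    and F: "finite F" and k: "0 < k" and bal: "\<And>t. t \<notin> F \<Longrightarrow> balanced k (pencil_form h q t) (span D)"
  obtains \<phi> x F' where "functional \<phi>" "x \<in> span D" "\<phi> x \<noteq> 0" "finite F'"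
    "\<And>t. t \<notin> F' \<Longrightarrow> balanced k (pencil_form h q t) {x \<in> span D. \<phi> x = 0}"
proof -
  note D' = orthogonal_basisD[OF D(1)]
  define u v where "u b = Re (h b b)" and "v b = Re (q b b)" for b
  note hp = hermitian_form_pencil[OF h q] and Dp = orthogonal_basis_pencil[OF D]
  have noiso: False if "x \<in> span D" "x \<noteq> 0" "\<And>w. w \<in> span D \<Longrightarrow> pencil_form h q t x w = 0" "q x x = 0" for x t
  proof -
    have "\<forall>w\<in>span D. h x w = complex_of_real t * q x w" using that(3) by simp
    then show False using noniso[of x] that unfolding pencil_eigenvector_def by auto
  qed
  have noiso': False if "x \<in> span D" "x \<noteq> 0" "\<And>w. w \<in> span D \<Longrightarrow> q x w = 0" "h x x = 0" for x
    using noniso[of x] that unfolding pencil_eigenvector_def by auto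
  have signs: "affine_signs D u v"
  proof
    show "finite D" by (rule D'(1))
  next
    fix b assume b: "b \<in> D"
    show "u b \<noteq> 0 \<or> v b \<noteq> 0"
    proof (rule ccontr)
      assume "\<not> (u b \<noteq> 0 \<or> v b \<noteq> 0)"
      then have 0: "h b b = 0" "q b b = 0"
        using form_diag_real[OF h, of b] form_diag_real[OF q, of b] by (simp_all add: u_def v_def)
      have "b \<noteq> 0" using b D'(2) dependent_zero by blast
      moreover have "q b c = 0" if "c \<in> D" for c
        using orthogonal_basisD(3)[OF D(2) b that] 0 by (cases "b = c") auto
      then have "q b w = 0" if "w \<in> span D" for w
        using functional_zero_on_span[OF hermitian_formD(1)[OF q] _ that] by blast
      ultimately show False using noiso'[OF span_base[OF b]] 0 by blast
    qed
  next
    fix b c t assume bc: "b \<in> D" "c \<in> D" "u b = t * v b" "u c = t * v c" "0 < v b"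
    show "\<not> v c < 0"
    proof
      assume "v c < 0"
      then obtain x where "x \<in> span D" "x \<noteq> 0" "\<And>w. w \<in> span D \<Longrightarrow> pencil_form h q t x w = 0" "q x x = 0"
        using isotropic_combination[OF hp q Dp D(2) bc(1,2), of t] bc unfolding u_def v_def by auto
      then show False using noiso by blast
    qed
  qed
  interpret affine_signs D u v by (rule signs)
  \<comment> \<open>Here the old exceptional set is traded for \<open>zeros\<close>: just to the
    right of \<open>t\<close> there is a parameter outside \<open>F\<close> with no zero in between,
    so the counts agree.\<close>
  have pk: "k \<le> card (pos t)" and nk: "k \<le> card (neg t)" if t: "t \<notin> zeros" for t
  proof -
    obtain d where d: "d > 0" "\<And>z. z \<in> zeros \<Longrightarrow> \<bar>z - t\<bar> \<le> d \<Longrightarrow> z = t"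
      by (rule gap_around[OF finite_zeros, of 1 t]) auto
    have "infinite ({t..t + d} - F)" using F d(1) by (simp add: infinite_Icc)
    then obtain t' where t': "t' \<in> {t..t + d}" "t' \<notin> F" by (metis Diff_iff finite.emptyI ex_in_conv)
    have gap: "{t..t'} \<inter> zeros = {}"
    proof (rule ccontr)
      assume "{t..t'} \<inter> zeros \<noteq> {}"
      then obtain z where z: "z \<in> zeros" "t \<le> z" "z \<le> t'" by auto
      then have "z = t" using d(2)[OF z(1)] t'(1) by simp
      then show False using z t by simp
    qed
    have t't: "t \<le> t'" using t' by simp
    have t'z: "t' \<notin> zeros" using gap t't by auto
    have e: "Re (pencil_form h q t' b b) = u b - t' * v b" for b by (simp add: u_def v_def)
    have "k \<le> card {b \<in> D. 0 \<le> Re (pencil_form h q t' b b)}"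
      using bal[OF t'(2)] unfolding balanced_def by (intro nonneg_dim_le_card[OF hp Dp]) simp
    also have "{b \<in> D. 0 \<le> Re (pencil_form h q t' b b)} = pos t'"
      unfolding e by (rule nonneg_iff_off_zeros(1)[OF t'z])
    finally have 1: "k \<le> card (pos t')" .
    have "k \<le> card {b \<in> D. 0 \<le> Re (- pencil_form h q t' b b)}"
      using bal[OF t'(2)] unfolding balanced_def
      by (intro nonneg_dim_le_card[OF hermitian_form_minus[OF hp] orthogonal_basis_minus[OF Dp]]) (simp add: contains_dim_minus)
    also have "{b \<in> D. 0 \<le> Re (- pencil_form h q t' b b)} = neg t'"
      unfolding uminus_complex.sel e by (rule nonneg_iff_off_zeros(2)[OF t'z])
    finally have 2: "k \<le> card (neg t')" .
    have 3: "pos t = pos t'" by (rule pos_constant[OF t't gap])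
    show "k \<le> card (pos t)" using 1 3 by simp
    show "k \<le> card (neg t)" using 2 3 pos_neg_card[OF t] pos_neg_card[OF t'z] by simp
  qed
  have posD: "pos t \<noteq> {}" "neg t \<noteq> {}" if "t \<notin> zeros" for t using pk[OF that] nk[OF that] k by auto
  \<comment> \<open>Without zeros \<open>q\<close> vanishes on the basis, while \<open>h\<close>
    takes both signs on it because \<open>k\<close> is positive. The combination of two such basis
    vectors would be an isotropic eigenvector at infinity.\<close>
  have zne: "zeros \<noteq> {}"
  proof
    assume z: "zeros = {}"
    then have v0: "v b = 0" if "b \<in> D" for b using that unfolding zeros_def by auto
    obtain b c where "b \<in> pos 0" "c \<in> neg 0" using posD[of 0] z by auto
    then have bc: "b \<in> D" "c \<in> D" "u b > 0" "u c < 0" by (auto simp: pos_def neg_def)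
    obtain x where "x \<in> span D" "x \<noteq> 0" "\<And>w. w \<in> span D \<Longrightarrow> q x w = 0" "h x x = 0"
      using isotropic_combination[OF q h D(2,1) bc(1,2)] bc v0[OF bc(1)] v0[OF bc(2)] unfolding u_def v_def by auto
    then show False using noiso' by blast
  qed
  consider t0 where "t0 \<notin> zeros" "card (pos t0) = k" | t0 where "t0 \<notin> zeros" "card (neg t0) = k"
    | "\<And>t. t \<notin> zeros \<Longrightarrow> k < card (pos t) \<and> k < card (neg t)"
    using pk nk by (metis nat_less_le)
  then show thesis
  proof cases
    case 1
    obtain \<phi> x where \<phi>: "functional \<phi>" "x \<in> span D" "\<phi> x \<noteq> 0"
      "\<And>t. t \<notin> zeros \<Longrightarrow> balanced k (pencil_form h q t) {x \<in> span D. \<phi> x = 0}"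
      by (rule balanced_hyperplane_of_minimal[OF h q D u_def v_def signs pk nk 1 zne]) blast+
    show thesis by (rule that[OF \<phi>(1-3) finite_zeros \<phi>(4)])
  next
    case 2
    \<comment> \<open>Negating both forms exchanges positive and negative entries and keeps the
      zeros.\<close>
    define u' v' where "u' b = - u b" and "v' b = - v b" for b
    interpret m: affine_signs D u' v'
    proof
      show "finite D" by (rule D'(1))
      show "u' b \<noteq> 0 \<or> v' b \<noteq> 0" if "b \<in> D" for b using nondegenerate[OF that] by (simp add: u'_def v'_def)
      show "\<not> v' c < 0" if "b \<in> D" "c \<in> D" "u' b = t * v' b" "u' c = t * v' c" "0 < v' b" for b c t
        using no_opposite[of c b t] that by (auto simp: u'_def v'_def)
    qed
    have z: "m.zeros = zeros" unfolding m.zeros_def zeros_def by (simp add: u'_def v'_def)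
    have pn: "m.pos t = neg t" "m.neg t = pos t" for t
      unfolding m.pos_def m.neg_def pos_def neg_def by (auto simp: u'_def v'_def)
    have uv: "\<And>b. u' b = Re (- h b b)" "\<And>b. v' b = Re (- q b b)" by (simp_all add: u'_def v'_def u_def v_def)
    have neg: "pencil_form (\<lambda>x y. - h x y) (\<lambda>x y. - q x y) t = (\<lambda>x y. - pencil_form h q t x y)" for t by (simp add: fun_eq_iff)
    obtain \<phi> x where \<phi>: "functional \<phi>" "x \<in> span D" "\<phi> x \<noteq> 0"
      "\<And>t. t \<notin> zeros \<Longrightarrow> balanced k (\<lambda>x y. - pencil_form h q t x y) {x \<in> span D. \<phi> x = 0}"
      by (rule balanced_hyperplane_of_minimal[OF hermitian_form_minus[OF h] hermitian_form_minus[OF q]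
          orthogonal_basis_minus[OF D(1)] orthogonal_basis_minus[OF D(2)] uv m.affine_signs_axioms,
          unfolded z pn neg, OF nk pk 2 zne]) blast+
    show thesis by (rule that[OF \<phi>(1-3) finite_zeros \<phi>(4)[unfolded balanced_minus]])
  next
    case 3
    obtain b where b: "b \<in> D" using zne by (auto simp: zeros_def)
    note \<phi> = functional_coord[OF D'(2), of b]
    have "balanced k (pencil_form h q t) {x \<in> span D. coord D b x = 0}" if t: "t \<notin> zeros" for t
    proof (rule balanced_kernel[OF \<phi>])
      have e: "Re (pencil_form h q t b b) = u b - t * v b" for b by (simp add: u_def v_def)
      have "{b \<in> D. 0 \<le> Re (pencil_form h q t b b)} = pos t"
        unfolding e by (rule nonneg_iff_off_zeros(1)[OF t])
      then have "contains_dim (Suc k) {x \<in> span D. 0 \<le> Re (pencil_form h q t x x)}"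
        using contains_dim_mono[OF contains_dim_nonneg[OF hp Dp, of t], of "Suc k"] 3[OF t] by auto
      moreover have "{b \<in> D. 0 \<le> Re (- pencil_form h q t b b)} = neg t"
        unfolding uminus_complex.sel e by (rule nonneg_iff_off_zeros(2)[OF t])
      then have "contains_dim (Suc k) {x \<in> span D. 0 \<le> Re (- pencil_form h q t x x)}"
        using contains_dim_mono[OF contains_dim_nonneg[OF hermitian_form_minus[OF hp] orthogonal_basis_minus[OF Dp], of t], of "Suc k"] 3[OF t] by auto
      ultimately show "balanced (Suc k) (pencil_form h q t) (span D)"
        unfolding balanced_def contains_dim_minus(1)[of _ _ "pencil_form h q t"] by blast
    qed
    then show thesis using that[OF \<phi> span_base[OF b]] coord_basis[OF D'(2) b] finite_zeros by simp
  qed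
qed

text \<open>The exceptional set and \<open>k\<close> vary in the induction. The number
  \<open>k\<close> drops only when an isotropic eigenvector in both radicals is split off, to be put
  back at the end.\<close>

theorem contains_dim_isotropic:
  assumes h: "hermitian_form h" and q: "hermitian_form q" and B: "finite B" "independent B"
    and F: "finite F" and bal: "\<And>t. t \<notin> F \<Longrightarrow> balanced k (pencil_form h q t) (span B)"
  shows "contains_dim k {x \<in> span B. h x x = 0 \<and> q x x = 0}"
  using B F bal
proof (induct "card B" arbitrary: B F k rule: less_induct)
  case (less B F k)
  note B = less.prems(1,2) and F = less.prems(3) and bal = less.prems(4)
  have step: "contains_dim l {x \<in> span B. \<phi> x = 0 \<and> h x x = 0 \<and> q x x = 0}"
    if \<phi>: "functional \<phi>" "x \<in> span B" "\<phi> x \<noteq> 0" and F': "finite F'"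
      and b: "\<And>t. t \<notin> F' \<Longrightarrow> balanced l (pencil_form h q t) {x \<in> span B. \<phi> x = 0}" for \<phi> x F' l
  proof -
    obtain B0 where B0: "finite B0" "independent B0" "card B = Suc (card B0)" "span B0 = {x \<in> span B. \<phi> x = 0}"
      using kernel_basis[OF \<phi>(1) B \<phi>(2,3)] .
    have "contains_dim l {x \<in> span B0. h x x = 0 \<and> q x x = 0}"
      using less.hyps[OF _ B0(1,2) F'] b B0(3,4) by simp
    then show ?thesis by (rule contains_dim_mono) (auto simp: B0(4))
  qed
  show ?case
  proof (cases "k = 0")
    case True
    then show ?thesis using form_right(3)[OF h] form_right(3)[OF q] span_zero
      by (intro contains_dimI[of "{}"] independent_empty) auto
  next
    case k: False
    show ?thesis
    proof (cases "\<exists>v. pencil_eigenvector h q (span B) v \<and> h v v = 0 \<and> q v v = 0")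
      case True
      then obtain v where v: "pencil_eigenvector h q (span B) v" "h v v = 0" "q v v = 0" by blast
      have vB: "v \<in> span B" "v \<noteq> 0" using v(1) by (auto simp: pencil_eigenvector_def)
      obtain \<phi> \<alpha> \<beta> where \<phi>: "functional \<phi>" "\<And>w. w \<in> span B \<Longrightarrow> h v w = \<alpha> * \<phi> w"
        "\<And>w. w \<in> span B \<Longrightarrow> q v w = \<beta> * \<phi> w" "\<alpha> \<noteq> 0 \<or> \<beta> \<noteq> 0"
        using pencil_eigenvector_functional[OF h q v(1)] by metis
      show ?thesis
      proof (cases "\<exists>x\<in>span B. \<phi> x \<noteq> 0")
        case True
        then obtain x where x: "x \<in> span B" "\<phi> x \<noteq> 0" by blast
        \<comment> \<open>Where \<open>\<alpha> = t * \<beta>\<close>, the pencil at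
          \<open>v\<close> is the zero functional and its kernel is all of \<open>span B\<close>.
          This happens for at most one \<open>t\<close>; elsewhere the complement of
          \<open>v\<close> is the kernel of \<phi>.\<close>
        define F' where "F' = F \<union> {t. \<alpha> = complex_of_real t * \<beta>}"
        have "finite {t. \<alpha> = complex_of_real t * \<beta>}"
        proof (rule finite_subset)
          show "{t. \<alpha> = complex_of_real t * \<beta>} \<subseteq> {Re (\<alpha> / \<beta>)}" using \<phi>(4) by auto
        qed simp
        then have F': "finite F'" using F by (simp add: F'_def)
        have "balanced k (pencil_form h q t) {x \<in> span B. \<phi> x = 0}" if t: "t \<notin> F'" for t
        proof -
          have Qv: "pencil_form h q t v w = (\<alpha> - complex_of_real t * \<beta>) * \<phi> w" if "w \<in> span B" for w
            using \<phi>(2,3)[OF that] by (simp add: algebra_simps)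
          have ne: "\<alpha> - complex_of_real t * \<beta> \<noteq> 0" using t by (simp add: F'_def)
          have "balanced k (pencil_form h q t) {x \<in> span B. pencil_form h q t v x = 0}"
            using t v(2,3) by (intro balanced_isotropic_orthogonal[OF hermitian_form_pencil[OF h q] subspace_span vB] bal)
              (auto simp: F'_def)
          moreover have "{x \<in> span B. pencil_form h q t v x = 0} = {x \<in> span B. \<phi> x = 0}"
          proof -
            have "pencil_form h q t v w = 0 \<longleftrightarrow> \<phi> w = 0" if "w \<in> span B" for w
              unfolding Qv[OF that] using ne by simp
            then show ?thesis by blast
          qed
          ultimately show ?thesis by simp
        qed
        from step[OF \<phi>(1) x F' this] show ?thesis by (rule contains_dim_mono) auto
      next
        case False
        \<comment> \<open>Here \<open>v\<close> is orthogonal to everything. A hyperplane missing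
          \<open>v\<close> contains an isotropic subspace of dimension \<open>k - 1\<close>, and
          adjoining \<open>v\<close> keeps it isotropic.\<close>
        then have z: "h v w = 0" "q v w = 0" if "w \<in> span B" for w using \<phi>(2,3)[OF that] that by auto
        have iv: "independent {v}" using vB by simp
        define \<psi> where "\<psi> = coord {v} v"
        have \<psi>: "functional \<psi>" "\<psi> v = 1" using functional_coord[OF iv] coord_basis[OF iv] by (simp_all add: \<psi>_def)
        obtain l where l: "k = Suc l" using k by (cases k) auto
        have "contains_dim l {x \<in> span B. \<psi> x = 0 \<and> h x x = 0 \<and> q x x = 0}"
          using balanced_kernel[OF \<psi>(1)] bal \<psi>(2) l by (intro step[OF \<psi>(1) vB(1) _ F]) auto
        then obtain C where C: "finite C" "independent C" "card C = l"
          "span C \<subseteq> {x \<in> span B. \<psi> x = 0 \<and> h x x = 0 \<and> q x x = 0}" by (rule contains_dimE)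
        have vC: "v \<notin> span C" using C(4) \<psi>(2) by auto
        then have "v \<notin> C" using span_base by blast
        then have card: "k \<le> card (insert v C)" using C l by simp
        have "x \<in> {x \<in> span B. h x x = 0 \<and> q x x = 0}" if x': "x \<in> span (insert v C)" for x
        proof -
          obtain c where c: "x - c *s v \<in> span C" using x' span_breakdown_eq by blast
          define y where "y = x - c *s v"
          have x: "x = y + c *s v" by (simp add: y_def)
          have y: "y \<in> span B" "h y y = 0" "q y y = 0" using c C(4) by (auto simp: y_def)
          have "h v y = 0" "q v y = 0" using z y by blast+
          moreover have "h y v = cnj (h v y)" "q y v = cnj (q v y)"
            using hermitian_formD(2)[OF h] hermitian_formD(2)[OF q] by blast+
          ultimately show ?thesis unfolding x using y vB v(2,3)
            by (auto simp: form_left[OF h] form_right[OF h] form_left[OF q] form_right[OF q]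
                intro!: span_add span_scale)
        qed
        then show ?thesis using C(1) independent_insertI[OF vC C(2)] card
          by (intro contains_dimI[of "insert v C"]) auto
      qed
    next
      case False
      then have noniso: "\<And>v. pencil_eigenvector h q (span B) v \<Longrightarrow> h v v \<noteq> 0 \<or> q v v \<noteq> 0" by blast
      obtain D where D: "orthogonal_basis h D" "orthogonal_basis q D" "span D = span B" "card D = card B"
        using simultaneous_diagonalization[OF h q B noniso] .
      obtain \<phi> x F' where "functional \<phi>" "x \<in> span B" "\<phi> x \<noteq> 0" "finite F'"
        "\<And>t. t \<notin> F' \<Longrightarrow> balanced k (pencil_form h q t) {x \<in> span B. \<phi> x = 0}"
        using balanced_hyperplane[OF h q D(1,2) _ F _ , unfolded D(3), OF noniso _ bal] k by auto
      from step[OF this] show ?thesis by (rule contains_dim_mono) auto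
    qed
  qed
qed

section \<open>Orthonormal families\<close>

text \<open>Diagonalizing \<open>q\<close> simultaneously with itself replaces Gram-Schmidt;
  definiteness rules out isotropic eigenvectors, and only normalisation remains.\<close>

lemma orthonormal_family:
  assumes q: "hermitian_form q" and B: "finite B" "independent B" "card B = k"
    and pos: "\<And>x. x \<in> span B \<Longrightarrow> x \<noteq> 0 \<Longrightarrow> 0 < Re (q x x)"
  obtains u where "\<And>j. j < k \<Longrightarrow> u j \<in> span B" "\<And>i j. i < k \<Longrightarrow> j < k \<Longrightarrow> q (u i) (u j) = (if i = j then 1 else 0)"
proof -
  have "q v v \<noteq> 0 \<or> q v v \<noteq> 0" if "pencil_eigenvector q q (span B) v" for v
    using that pos[of v] unfolding pencil_eigenvector_def by auto
  then obtain D where D: "orthogonal_basis q D" "span D = span B" "card D = card B"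
    using simultaneous_diagonalization[OF q q B(1,2)] by blast
  note D' = orthogonal_basisD[OF D(1)]
  obtain f where f: "bij_betw f {..<k} D"
    using ex_bij_betw_nat_finite[OF D'(1)] D(3) B(3) by (auto simp: atLeast0LessThan)
  have fD: "f i \<in> D" if "i < k" for i using f that by (auto simp: bij_betw_def)
  have finj: "f i = f j \<longleftrightarrow> i = j" if "i < k" "j < k" for i j using f that by (auto simp: bij_betw_def inj_on_def)
  define u where "u j = complex_of_real (1 / sqrt (Re (q (f j) (f j)))) *s f j" for j
  show thesis
  proof
    fix j assume j: "j < k"
    have "f j \<in> span B" using span_base[OF fD[OF j]] D(2) by simp
    then show "u j \<in> span B" unfolding u_def by (rule span_scale)
  next
    fix i j assume ij: "i < k" "j < k"
    show "q (u i) (u j) = (if i = j then 1 else 0)"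
    proof (cases "i = j")
      case False
      then have "f i \<noteq> f j" using finj[OF ij] by blast
      then have "q (f i) (f j) = 0" by (rule D'(3)[OF fD[OF ij(1)] fD[OF ij(2)]])
      then show ?thesis using False by (simp add: u_def form_left(2)[OF q] form_right(2)[OF q])
    next
      case True
      define r where "r = Re (q (f i) (f i))"
      have qr: "q (f i) (f i) = complex_of_real r" unfolding r_def by (rule form_diag_real[OF q])
      have "f i \<noteq> 0" using fD[OF ij(1)] D'(2) dependent_zero[of D] by metis
      moreover have "f i \<in> span B" using span_base[OF fD[OF ij(1)]] unfolding D(2) .
      ultimately have r: "r > 0" using pos[of "f i"] unfolding r_def by blast
      have "q (u i) (u i) = complex_of_real (1 / sqrt r) * (complex_of_real (1 / sqrt r) * complex_of_real r)"
        unfolding u_def form_left(2)[OF q] form_right(2)[OF q] complex_cnj_complex_of_real r_def[symmetric] qr Re_complex_of_real ..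
      also have "\<dots> = 1" unfolding of_real_mult[symmetric] using r by simp
      finally show ?thesis using True by simp
    qed
  qed
qed

lemma independent_orthonormal:
  assumes q: "hermitian_form q" and u: "\<And>i j. i < k \<Longrightarrow> j < k \<Longrightarrow> q (u i) (u j) = (if i = j then 1 else 0)"
  shows "independent (u ` {..<k})" "card (u ` {..<k}) = k"
proof -
  have inj: "inj_on u {..<k}"
  proof (rule inj_onI)
    fix i j assume ij: "i \<in> {..<k}" "j \<in> {..<k}" "u i = u j"
    then have "q (u i) (u j) = 1" using u[of i i] by simp
    then show "i = j" using u[of i j] ij by (simp split: if_splits)
  qed
  then show "card (u ` {..<k}) = k" by (simp add: card_image)
  show "independent (u ` {..<k})"
  proof (rule independent_if_scalars_zero)
    fix c b assume 0: "(\<Sum>x\<in>u ` {..<k}. c x *s x) = 0" and b: "b \<in> u ` {..<k}"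
    obtain i where i: "i < k" "b = u i" using b by auto
    have "0 = q (u i) (\<Sum>j<k. c (u j) *s u j)"
      using 0 by (simp add: sum.reindex[OF inj] form_right[OF q])
    also have "\<dots> = (\<Sum>j<k. c (u j) * q (u i) (u j))" by (simp add: form_sum[OF q] form_right[OF q])
    also have "\<dots> = (\<Sum>j<k. if j = i then c (u i) else 0)"
      using i by (intro sum.cong refl) (auto simp: u)
    finally show "c b = 0" using i by simp
  qed simp
qed

lemma form_zero_on_span:
  assumes Q: "hermitian_form Q" and 0: "\<And>b c. b \<in> B \<Longrightarrow> c \<in> B \<Longrightarrow> Q b c = 0" and x: "x \<in> span B"
  shows "Q x x = 0"
proof -
  have "Q b x = 0" if "b \<in> B" for b
    using functional_zero_on_span[OF hermitian_formD(1)[OF Q] 0[OF that] x] .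
  then have "Q x b = 0" if "b \<in> B" for b using that hermitian_formD(2)[OF Q, of x b] by simp
  then show ?thesis using functional_zero_on_span[OF hermitian_formD(1)[OF Q] _ x] by blast
qed

end

section \<open>Eigenvalues of Hermitian matrices\<close>

lemma sum_fun_apply: "(\<Sum>a\<in>A. f a) i = (\<Sum>a\<in>A. f a i)"
  for f :: "'a \<Rightarrow> 'b \<Rightarrow> 'c::comm_monoid_add"
  by (induct A rule: infinite_finite_induct) auto

text \<open>\<open>P\<close> passes from an entry to all earlier ones, so the entries satisfying it
  form a prefix. This turns a bound on the eigenvalue with a given index into a count.\<close>

lemma sorted_filter_nth:
  assumes "sorted_wrt R L" "\<And>x y. P y \<Longrightarrow> R x y \<Longrightarrow> P x" "i < length L"
  shows "P (L ! i) \<longleftrightarrow> i < length (filter P L)"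
  using assms(1,3)
proof (induct L arbitrary: i)
  case (Cons x L)
  show ?case
  proof (cases "P x")
    case True
    then show ?thesis using Cons by (cases i) auto
  next
    case False
    then have "\<not> P y" if "y \<in> set L" for y using Cons.prems(1) assms(2) that by auto
    then have "filter P (x # L) = []" using False by (simp add: filter_empty_conv)
    moreover have "\<not> P ((x # L) ! i)" using False \<open>\<And>y. y \<in> set L \<Longrightarrow> \<not> P y\<close> Cons.prems(2) by (cases i) auto
    ultimately show ?thesis by simp
  qed
qed simp

lemma proots_linear_factors: "proots (\<Prod>x\<leftarrow>L. [:- x, 1:]) = mset (L :: 'a::idom list)"
proof (induct L)
  case (Cons a L)
  have "(\<Prod>x\<leftarrow>L. [:- x, 1:]) \<noteq> 0" by (auto simp: prod_list_zero_iff)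
  then have "proots ([:- a, 1:] * (\<Prod>x\<leftarrow>L. [:- x, 1:])) = {#a#} + mset L"
    using Cons by (subst proots_mult) (simp_all only: proots_linear_factor, auto)
  then show ?case by simp
qed simp

lemma poly_char_poly_det:
  fixes M :: "'a::comm_ring_1 mat"
  assumes M: "M \<in> carrier_mat n n"
  shows "poly (char_poly M) z = det (z \<cdot>\<^sub>m 1\<^sub>m n - M)"
proof -
  have ev: "comm_ring_hom (\<lambda>p :: 'a poly. poly p z)" by unfold_locales auto
  have "poly (char_poly M) z = det (map_mat (\<lambda>p. poly p z) (char_poly_matrix M))"
    unfolding char_poly_def comm_ring_hom.hom_det[OF ev] ..
  also have "map_mat (\<lambda>p. poly p z) (char_poly_matrix M) = z \<cdot>\<^sub>m 1\<^sub>m n - M"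
    using M by (intro eq_matI) (auto simp: char_poly_matrix_def)
  finally show ?thesis .
qed

section \<open>Complex n-space and the forms of matrices\<close>

text \<open>The locale works on a whole type; complex n-space becomes the subspace
  \<open>fn.span (units n)\<close> of functions vanishing from index \<open>n\<close> on.\<close>

definition scale_fun :: "complex \<Rightarrow> (nat \<Rightarrow> complex) \<Rightarrow> nat \<Rightarrow> complex" where
  "scale_fun c f = (\<lambda>i. c * f i)"

lemma scale_fun_apply [simp]: "scale_fun c f i = c * f i"
  by (simp add: scale_fun_def)

interpretation fn: complex_vector_space scale_fun
  by unfold_locales (auto simp: fun_eq_iff algebra_simps)

definition units :: "nat \<Rightarrow> (nat \<Rightarrow> complex) set" where
  "units n = (\<lambda>i j. if j = i then 1 else 0) ` {..<n}"

lemma inj_units: "inj_on (\<lambda>i j. if j = i then 1 else 0 :: complex) A"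
  by (rule inj_onI) (metis zero_neq_one)

lemma finite_units: "finite (units n)" and card_units: "card (units n) = n"
  unfolding units_def by (simp_all add: card_image inj_units)

lemma sum_units: "(\<Sum>b\<in>units n. scale_fun (u b) b) i = (if i < n then u (\<lambda>j. if j = i then 1 else 0) else 0)"
  unfolding units_def sum_fun_apply sum.reindex[OF inj_units] o_def scale_fun_apply
  by (auto simp: if_distrib[of "\<lambda>x. _ * x"] cong: if_cong)

lemma independent_units: "fn.independent (units n)"
proof (rule fn.independent_if_scalars_zero[OF finite_units])
  fix u b assume 0: "(\<Sum>x\<in>units n. scale_fun (u x) x) = 0" and b: "b \<in> units n"
  obtain i where i: "i < n" "b = (\<lambda>j. if j = i then 1 else 0)" using b by (auto simp: units_def)
  have "u b = (\<Sum>x\<in>units n. scale_fun (u x) x) i" unfolding sum_units i(2) using i(1) by simp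
  then show "u b = 0" unfolding 0 by simp
qed

lemma span_units: "fn.span (units n) = {f. \<forall>i\<ge>n. f i = 0}"
proof (intro Set.set_eqI iffI)
  fix f assume "f \<in> fn.span (units n)"
  then obtain u where "f = (\<Sum>b\<in>units n. scale_fun (u b) b)" using fn.span_finite[OF finite_units] by auto
  then show "f \<in> {f. \<forall>i\<ge>n. f i = 0}" by (simp add: sum_units)
next
  fix f :: "nat \<Rightarrow> complex" assume f: "f \<in> {f. \<forall>i\<ge>n. f i = 0}"
  define u :: "(nat \<Rightarrow> complex) \<Rightarrow> complex" where "u b = (\<Sum>i<n. f i * b i)" for b
  have "u (\<lambda>j. if j = i then 1 else 0) = f i" if "i < n" for i
    using that by (simp add: u_def if_distrib[of "\<lambda>x. _ * x"] cong: if_cong)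
  then have "f = (\<Sum>b\<in>units n. scale_fun (u b) b)"
    using f by (intro ext) (auto simp: sum_units)
  then show "f \<in> fn.span (units n)"
    by (metis (no_types, lifting) fn.span_sum fn.span_scale fn.span_base)
qed

definition mat_form :: "nat \<Rightarrow> complex mat \<Rightarrow> (nat \<Rightarrow> complex) \<Rightarrow> (nat \<Rightarrow> complex) \<Rightarrow> complex" where
  "mat_form n M x y = (\<Sum>i<n. \<Sum>j<n. cnj (x i) * M $$ (i, j) * y j)"

lemma hermitian_mat_form:
  assumes "M \<in> carrier_mat n n" "mat_adjoint M = M"
  shows "fn.hermitian_form (mat_form n M)"
  unfolding fn.hermitian_form_def fn.functional_def
proof (intro conjI allI)
  fix x y z c
  show "mat_form n M x (y + z) = mat_form n M x y + mat_form n M x z"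
    by (simp add: mat_form_def distrib_left sum.distrib)
  show "mat_form n M x (scale_fun c y) = c * mat_form n M x y"
    by (simp add: mat_form_def sum_distrib_left mult_ac)
  have M: "cnj (M $$ (j, i)) = M $$ (i, j)" if "i < n" "j < n" for i j
    using mat_adjoint_index[OF assms(1) that] assms(2) by simp
  have "cnj (mat_form n M x y) = (\<Sum>i<n. \<Sum>j<n. x i * (cnj (M $$ (i, j)) * cnj (y j)))"
    by (simp add: mat_form_def mult_ac)
  also have "\<dots> = (\<Sum>j<n. \<Sum>i<n. x i * (cnj (M $$ (i, j)) * cnj (y j)))" by (rule sum.swap)
  also have "\<dots> = mat_form n M y x"
    unfolding mat_form_def by (intro sum.cong refl) (simp add: M mult_ac)
  finally show "mat_form n M y x = cnj (mat_form n M x y)" ..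
qed

lemma mat_form_add:
  "M \<in> carrier_mat n n \<Longrightarrow> N \<in> carrier_mat n n \<Longrightarrow> mat_form n (M + N) x y = mat_form n M x y + mat_form n N x y"
  by (simp add: mat_form_def distrib_left distrib_right sum.distrib)

lemma mat_form_minus:
  "M \<in> carrier_mat n n \<Longrightarrow> N \<in> carrier_mat n n \<Longrightarrow> mat_form n (M - N) x y = mat_form n M x y - mat_form n N x y"
  by (simp add: mat_form_def right_diff_distrib left_diff_distrib sum_subtractf)

lemma mat_form_smult:
  "M \<in> carrier_mat n n \<Longrightarrow> mat_form n (c \<cdot>\<^sub>m M) x y = c * mat_form n M x y"
  by (simp add: mat_form_def sum_distrib_left mult_ac)

lemma mat_form_one: "mat_form n (1\<^sub>m n) x y = (\<Sum>i<n. cnj (x i) * y i)"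
proof -
  have "(\<Sum>j<n. cnj (x i) * 1\<^sub>m n $$ (i, j) * y j) = cnj (x i) * y i" if "i < n" for i
  proof -
    have "(\<Sum>j<n. cnj (x i) * 1\<^sub>m n $$ (i, j) * y j) = (\<Sum>j<n. if j = i then cnj (x i) * y i else 0)"
      using that by (intro sum.cong refl) auto
    then show ?thesis using that by simp
  qed
  then show ?thesis by (simp add: mat_form_def)
qed

lemma mat_form_one_diag: "mat_form n (1\<^sub>m n) x x = complex_of_real (\<Sum>i<n. (cmod (x i))\<^sup>2)"
  unfolding mat_form_one of_real_sum complex_norm_square by (simp add: mult.commute)

lemma hermitian_mat_form_one: "fn.hermitian_form (mat_form n (1\<^sub>m n))"
proof (rule hermitian_mat_form)
  show one: "1\<^sub>m n \<in> carrier_mat n n" by simp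
  note c = mat_adjoint_carrier[OF one]
  show "mat_adjoint (1\<^sub>m n) = (1\<^sub>m n :: complex mat)"
  proof (rule eq_matI)
    fix i j assume "i < dim_row (1\<^sub>m n :: complex mat)" "j < dim_col (1\<^sub>m n :: complex mat)"
    then have "i < n" "j < n" by simp_all
    then show "mat_adjoint (1\<^sub>m n) $$ (i, j) = (1\<^sub>m n :: complex mat) $$ (i, j)"
      unfolding mat_adjoint_index[OF one \<open>i < n\<close> \<open>j < n\<close>] by auto
  qed (use c in auto)
qed

lemma mat_form_one_pos:
  assumes "x \<in> fn.span (units n)" "x \<noteq> 0"
  shows "0 < Re (mat_form n (1\<^sub>m n) x x)"
proof -
  have "\<exists>i. x i \<noteq> 0"
  proof (rule ccontr)
    assume "\<not> (\<exists>i. x i \<noteq> 0)"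
    then have "x = (\<lambda>i. 0)" by blast
    then show False using assms(2) unfolding zero_fun_def by blast
  qed
  then obtain i where i: "x i \<noteq> 0" by blast
  moreover have "i < n"
  proof (rule ccontr)
    assume "\<not> i < n"
    then show False using assms(1) i unfolding span_units by simp
  qed
  ultimately have "0 < (\<Sum>i<n. (cmod (x i))\<^sup>2)"
    using sum_pos2[of "{..<n}" i "\<lambda>i. (cmod (x i))\<^sup>2"] by simp
  then show ?thesis unfolding mat_form_one_diag by simp
qed

lemma adjoint_mult_index:
  assumes X: "X \<in> carrier_mat n k" and N: "N \<in> carrier_mat n n" and ij: "i < k" "j < k"
    and u: "\<And>l. l < n \<Longrightarrow> u l = X $$ (l, i)" "\<And>l. l < n \<Longrightarrow> v l = X $$ (l, j)"
  shows "(mat_adjoint X * N * X) $$ (i, j) = mat_form n N u v"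
proof -
  note X' = mat_adjoint_carrier[OF X]
  have 1: "(mat_adjoint X * N) $$ (i, l) = (\<Sum>m<n. cnj (u m) * N $$ (m, l))" if "l < n" for l
    using that X' N ij u by (simp add: scalar_prod_def atLeast0LessThan mat_adjoint_index[OF X])
  have "(mat_adjoint X * N * X) $$ (i, j) = row (mat_adjoint X * N) i \<bullet> col X j"
    by (rule index_mult_mat) (use X X' ij in auto)
  also have "\<dots> = (\<Sum>l<n. (mat_adjoint X * N) $$ (i, l) * X $$ (l, j))"
    using X X' N ij by (simp add: scalar_prod_def atLeast0LessThan)
  also have "\<dots> = (\<Sum>l<n. \<Sum>m<n. cnj (u m) * N $$ (m, l) * v l)"
    using 1 u by (simp add: sum_distrib_right)
  also have "\<dots> = mat_form n N u v" unfolding mat_form_def by (rule sum.swap)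
  finally show ?thesis .
qed

lemma adjoint_mult_self_index:
  assumes X: "X \<in> carrier_mat n k" and ij: "i < k" "j < k"
    and u: "\<And>l. l < n \<Longrightarrow> u l = X $$ (l, i)" "\<And>l. l < n \<Longrightarrow> v l = X $$ (l, j)"
  shows "(mat_adjoint X * X) $$ (i, j) = mat_form n (1\<^sub>m n) u v"
  using adjoint_mult_index[OF X one_carrier_mat ij u] mat_adjoint_carrier[OF X] by simp

text \<open>
  Congruence by a simultaneously orthogonal basis turns \<open>z I - M\<close> into a diagonal matrix, so the
  eigenvalues of \<open>M\<close> are the Rayleigh quotients of the basis vectors.
\<close>

lemma eigvals_rayleigh:
  assumes M: "M \<in> carrier_mat n n" "mat_adjoint M = M"
  obtains D where "fn.orthogonal_basis (mat_form n M) D" "fn.orthogonal_basis (mat_form n (1\<^sub>m n)) D"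
    "fn.span D = fn.span (units n)"
    "mset (herm_eigvals M) = image_mset (\<lambda>b. Re (mat_form n M b b) / Re (mat_form n (1\<^sub>m n) b b)) (mset_set D)"
proof -
  let ?h = "mat_form n M" and ?q = "mat_form n (1\<^sub>m n)"
  note h = hermitian_mat_form[OF M] and q = hermitian_mat_form_one[of n]
  have "?h v v \<noteq> 0 \<or> ?q v v \<noteq> 0" if "fn.pencil_eigenvector ?h ?q (fn.span (units n)) v" for v
    using that mat_form_one_pos[of v n] unfolding fn.pencil_eigenvector_def by auto
  then obtain D where D: "fn.orthogonal_basis ?h D" "fn.orthogonal_basis ?q D"
    "fn.span D = fn.span (units n)" "card D = card (units n)"
    using fn.simultaneous_diagonalization[OF h q finite_units independent_units] by blast
  note D' = fn.orthogonal_basisD[OF D(1)] fn.orthogonal_basisD(3)[OF D(2)]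
  have "card D = n" using D(4) card_units by simp
  then obtain f where f: "bij_betw f {..<n} D" using ex_bij_betw_nat_finite[OF D'(1)] by (auto simp: atLeast0LessThan)
  have fD: "f i \<in> D" if "i < n" for i using f that by (auto simp: bij_betw_def)
  have finj: "f i = f j \<longleftrightarrow> i = j" if "i < n" "j < n" for i j using f that by (auto simp: bij_betw_def inj_on_def)
  have qpos: "0 < Re (?q b b)" if "b \<in> D" for b
  proof (rule mat_form_one_pos)
    show "b \<in> fn.span (units n)" using fn.span_base[OF that] D(3) by simp
    show "b \<noteq> 0" using that D'(2) fn.dependent_zero by blast
  qed
  define r where "r b = Re (?h b b) / Re (?q b b)" for b
  define P where "P = mat n n (\<lambda>(i, j). f j i)"
  have P: "P \<in> carrier_mat n n" "mat_adjoint P \<in> carrier_mat n n"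
    using mat_adjoint_carrier[of P n n] by (auto simp: P_def)
  have Pu: "f j l = P $$ (l, j)" if "j < n" "l < n" for j l using that by (simp add: P_def)
  have dt: "det (mat_adjoint P) * det N * det P = (\<Prod>i<n. mat_form n N (f i) (f i))"
    if N: "N \<in> carrier_mat n n" and off: "\<And>i j. i < n \<Longrightarrow> j < n \<Longrightarrow> i \<noteq> j \<Longrightarrow> mat_form n N (f i) (f j) = 0" for N
  proof -
    let ?T = "mat_adjoint P * N * P"
    have T: "?T \<in> carrier_mat n n" using P N by simp
    have Tij: "?T $$ (i, j) = mat_form n N (f i) (f j)" if "i < n" "j < n" for i j
      by (rule adjoint_mult_index[OF P(1) N that]) (use Pu that in auto)
    have "upper_triangular ?T" using T Tij off by (intro upper_triangularI) auto
    then have "det ?T = prod_list (diag_mat ?T)" using T by (rule det_upper_triangular)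
    also have "\<dots> = (\<Prod>i<n. mat_form n N (f i) (f i))"
      using T Tij by (simp add: diag_mat_def prod.list_conv_set_nth atLeast0LessThan del: index_mult_mat)
    finally show ?thesis using P N by (simp add: det_mult[of _ n] mult.assoc)
  qed
  \<comment> \<open>This is \<open>det (mat_adjoint P) * det P\<close>, obtained from
    \<open>dt\<close> with the identity matrix. Being nonzero, it can be cancelled from the
    congruence.\<close>
  define \<delta> where "\<delta> = (\<Prod>i<n. ?q (f i) (f i))"
  have q_real: "?q b b = complex_of_real (Re (?q b b))" and h_real: "?h b b = complex_of_real (Re (?h b b))" for b
    using fn.form_diag_real[OF q] fn.form_diag_real[OF h] by blast+
  have "?q b b \<noteq> 0" if "b \<in> D" for b using qpos[OF that] by auto
  then have \<delta>0: "\<delta> \<noteq> 0" using fD by (simp add: \<delta>_def)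
  have one: "det (mat_adjoint P) * det P = \<delta>"
    using dt[of "1\<^sub>m n"] D'(4) fD finj by (simp add: \<delta>_def)
  have "poly (char_poly M) z = poly (\<Prod>i<n. [:- complex_of_real (r (f i)), 1:]) z" for z
  proof -
    let ?N = "z \<cdot>\<^sub>m 1\<^sub>m n - M"
    have N: "?N \<in> carrier_mat n n" by (rule minus_carrier_mat[OF M(1)])
    have form: "mat_form n ?N x y = z * ?q x y - ?h x y" for x y
      using M(1) by (simp add: mat_form_minus mat_form_smult)
    have "\<delta> * det ?N = det (mat_adjoint P) * det ?N * det P" unfolding one[symmetric] by (simp add: mult_ac)
    also have "\<dots> = (\<Prod>i<n. mat_form n ?N (f i) (f i))"
      by (rule dt[OF N]) (use D'(3,4) fD finj in \<open>simp add: form\<close>)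
    also have "\<dots> = (\<Prod>i<n. ?q (f i) (f i) * (z - complex_of_real (r (f i))))"
    proof (rule prod.cong[OF refl])
      fix i assume "i \<in> {..<n}"
      then have "Re (?q (f i) (f i)) \<noteq> 0" using qpos[OF fD, of i] by simp
      then have "Re (?q (f i) (f i)) * r (f i) = Re (?h (f i) (f i))" by (simp add: r_def)
      then have "complex_of_real (Re (?q (f i) (f i))) * complex_of_real (r (f i)) = complex_of_real (Re (?h (f i) (f i)))"
        unfolding of_real_mult[symmetric] by (rule arg_cong)
      then have "?q (f i) (f i) * complex_of_real (r (f i)) = ?h (f i) (f i)"
        unfolding q_real[symmetric] h_real[symmetric] .
      then show "mat_form n ?N (f i) (f i) = ?q (f i) (f i) * (z - complex_of_real (r (f i)))"
        unfolding form by (simp add: algebra_simps)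
    qed
    also have "\<dots> = \<delta> * (\<Prod>i<n. z - complex_of_real (r (f i)))" by (simp add: \<delta>_def prod.distrib)
    finally show ?thesis using \<delta>0 by (simp add: poly_char_poly_det[OF M(1)] poly_prod)
  qed
  then have "char_poly M = (\<Prod>i<n. [:- complex_of_real (r (f i)), 1:])" using poly_eq_poly_eq_iff by blast
  also have "\<dots> = (\<Prod>x\<leftarrow>map (\<lambda>i. complex_of_real (r (f i))) [0..<n]. [:- x, 1:])"
    by (simp add: o_def prod.distinct_set_conv_list[symmetric] atLeast0LessThan)
  finally have "proots (char_poly M) = mset (map (\<lambda>i. complex_of_real (r (f i))) [0..<n])"
    by (simp only: proots_linear_factors)
  then have "mset (herm_eigvals M) = image_mset (\<lambda>i. r (f i)) (mset_set {..<n})"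
    by (simp add: herm_eigvals_def image_mset.compositionality o_def atLeast0LessThan)
  also have "\<dots> = image_mset r (image_mset f (mset_set {..<n}))" by (simp add: image_mset.compositionality o_def)
  also have "image_mset f (mset_set {..<n}) = mset_set D"
    using image_mset_mset_set[of f "{..<n}"] f by (simp add: bij_betw_def)
  finally show thesis using that D by (simp add: r_def)
qed

text \<open>The Courant-Fischer principle by counting: the bound holds iff at least \<open>k\<close>
  Rayleigh quotients lie on the right side of \<open>c\<close>, that is, iff at least
  \<open>k\<close> diagonal entries of the shifted form have the right sign. The law of inertia
  turns this into a subspace of dimension \<open>k\<close>.\<close>

lemma herm_eigval_iff_contains_dim:
  assumes M: "M \<in> carrier_mat n n" "mat_adjoint M = M" and k: "1 \<le> k" "k \<le> n"
  shows "c \<le> herm_eigval M k \<longleftrightarrow>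
      fn.contains_dim k {x \<in> fn.span (units n). 0 \<le> Re (mat_form n M x x - complex_of_real c * mat_form n (1\<^sub>m n) x x)}"
    and "herm_eigval M (n - k + 1) \<le> c \<longleftrightarrow>
      fn.contains_dim k {x \<in> fn.span (units n). Re (mat_form n M x x - complex_of_real c * mat_form n (1\<^sub>m n) x x) \<le> 0}"
proof -
  let ?h = "mat_form n M" and ?q = "mat_form n (1\<^sub>m n)"
  let ?Q = "\<lambda>x y. ?h x y - complex_of_real c * ?q x y"
  let ?L = "herm_eigvals M"
  note L = herm_eigvals_char_poly(2,3)[OF M]
  obtain D where D: "fn.orthogonal_basis ?h D" "fn.orthogonal_basis ?q D"
    "fn.span D = fn.span (units n)" and ms: "mset ?L = image_mset (\<lambda>b. Re (?h b b) / Re (?q b b)) (mset_set D)"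
    using eigvals_rayleigh[OF M] .
  have Q: "fn.hermitian_form ?Q" by (rule fn.hermitian_form_pencil[OF hermitian_mat_form[OF M] hermitian_mat_form_one])
  have DQ: "fn.orthogonal_basis ?Q D" using D(1,2) by (rule fn.orthogonal_basis_pencil)
  note D' = fn.orthogonal_basisD[OF D(1)]
  have qpos: "0 < Re (?q b b)" if "b \<in> D" for b
  proof (rule mat_form_one_pos)
    show "b \<in> fn.span (units n)" using fn.span_base[OF that] D(3) by simp
    show "b \<noteq> 0" using that D'(2) fn.dependent_zero by blast
  qed
  have count: "length (filter P ?L) = card {b \<in> D. P (Re (?h b b) / Re (?q b b))}" for P
  proof -
    have "length (filter P ?L) = size (filter_mset P (mset ?L))" by (simp flip: mset_filter)
    also have "\<dots> = card {b \<in> D. P (Re (?h b b) / Re (?q b b))}"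
      unfolding ms using D'(1) by (simp add: filter_mset_image_mset)
    finally show ?thesis .
  qed
  have ge: "{b \<in> D. c \<le> Re (?h b b) / Re (?q b b)} = {b \<in> D. 0 \<le> Re (?Q b b)}"
    and le: "{b \<in> D. Re (?h b b) / Re (?q b b) \<le> c} = {b \<in> D. 0 \<le> Re (- ?Q b b)}"
    using qpos by (auto simp: field_simps)
  have "c \<le> herm_eigval M k \<longleftrightarrow> k - 1 < length (filter ((\<le>) c) ?L)"
    unfolding herm_eigval_def using L k by (intro sorted_filter_nth[where R = "(\<ge>)"]) auto
  also have "\<dots> \<longleftrightarrow> k \<le> card {b \<in> D. 0 \<le> Re (?Q b b)}" unfolding count ge using k by auto
  also have "\<dots> \<longleftrightarrow> fn.contains_dim k {x \<in> fn.span (units n). 0 \<le> Re (?Q x x)}"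
    using fn.nonneg_dim_le_card[OF Q DQ] fn.contains_dim_mono[OF fn.contains_dim_nonneg[OF Q DQ] _ order_refl]
    unfolding D(3) by blast
  finally show "c \<le> herm_eigval M k \<longleftrightarrow> fn.contains_dim k {x \<in> fn.span (units n). 0 \<le> Re (?Q x x)}" .
  \<comment> \<open>The 0-based index is \<open>n - k\<close>, so the bound fails iff more than
    \<open>n - k\<close> eigenvalues exceed \<open>c\<close>, that is, iff fewer than
    \<open>k\<close> are at most \<open>c\<close>.\<close>
  have "\<not> herm_eigval M (n - k + 1) \<le> c \<longleftrightarrow> n - k < length (filter ((<) c) ?L)"
    unfolding herm_eigval_def not_le using L k by (subst sorted_filter_nth[of "(\<ge>)" ?L "(<) c"]) auto
  moreover have "length (filter ((<) c) ?L) + length (filter (\<lambda>x. x \<le> c) ?L) = n"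
    using sum_length_filter_compl[of "(<) c" ?L] L by (simp add: not_less)
  ultimately have "herm_eigval M (n - k + 1) \<le> c \<longleftrightarrow> k \<le> length (filter (\<lambda>x. x \<le> c) ?L)"
    using k by linarith
  also have "\<dots> \<longleftrightarrow> k \<le> card {b \<in> D. 0 \<le> Re (- ?Q b b)}" unfolding count le ..
  also have "\<dots> \<longleftrightarrow> fn.contains_dim k {x \<in> fn.span (units n). 0 \<le> Re (- ?Q x x)}"
    using fn.nonneg_dim_le_card[OF fn.hermitian_form_minus[OF Q] fn.orthogonal_basis_minus[OF DQ]]
      fn.contains_dim_mono[OF fn.contains_dim_nonneg[OF fn.hermitian_form_minus[OF Q] fn.orthogonal_basis_minus[OF DQ]] _ order_refl]
    unfolding D(3) by blast
  also have "\<dots> \<longleftrightarrow> fn.contains_dim k {x \<in> fn.span (units n). Re (?Q x x) \<le> 0}"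
    by (rule fn.contains_dim_minus(1)[of _ _ ?Q])
  finally show "herm_eigval M (n - k + 1) \<le> c \<longleftrightarrow> fn.contains_dim k {x \<in> fn.span (units n). Re (?Q x x) \<le> 0}" .
qed

lemma real_pencil_at_carrier: "A \<in> carrier_mat n n \<Longrightarrow> real_pencil_at A s \<in> carrier_mat n n"
  by (simp add: real_pencil_at_def herm_re_carrier herm_im_carrier)

lemma real_pencil_at_adjoint:
  assumes A: "A \<in> carrier_mat n n" shows "mat_adjoint (real_pencil_at A s) = real_pencil_at A s"
proof (rule eq_matI)
  note M = real_pencil_at_carrier[OF A, of s]
  note M' = mat_adjoint_carrier[OF M]
  fix i j assume "i < dim_row (real_pencil_at A s)" "j < dim_col (real_pencil_at A s)"
  then have ij: "i < n" "j < n" using M by auto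
  show "mat_adjoint (real_pencil_at A s) $$ (i, j) = real_pencil_at A s $$ (i, j)"
    unfolding mat_adjoint_index[OF M ij] using ij herm_re_carrier[OF A] herm_im_carrier[OF A]
    by (simp add: real_pencil_at_def herm_re_cnj[OF A] herm_im_cnj[OF A])
qed (use mat_adjoint_carrier[OF real_pencil_at_carrier[OF A, of s]] real_pencil_at_carrier[OF A, of s] in auto)

lemma mat_form_real_pencil_at:
  assumes A: "A \<in> carrier_mat n n"
  shows "mat_form n (real_pencil_at A s) x y = mat_form n (herm_re A) x y + complex_of_real s * mat_form n (herm_im A) x y"
  unfolding real_pencil_at_def using herm_re_carrier[OF A] herm_im_carrier[OF A]
  by (simp add: mat_form_add mat_form_smult)

lemma mat_form_herm_parts:
  assumes A: "A \<in> carrier_mat n n"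
  shows "mat_form n A x y = mat_form n (herm_re A) x y + \<i> * mat_form n (herm_im A) x y"
proof -
  have "A $$ (i, j) = herm_re A $$ (i, j) + \<i> * herm_im A $$ (i, j)" if "i < n" "j < n" for i j
    using that A mat_adjoint_carrier[OF A] by (simp add: herm_re_def herm_im_def field_simps)
  then have "A = herm_re A + \<i> \<cdot>\<^sub>m herm_im A"
    using A herm_re_carrier[OF A] herm_im_carrier[OF A] by (intro eq_matI) auto
  then have "mat_form n A x y = mat_form n (herm_re A + \<i> \<cdot>\<^sub>m herm_im A) x y" by simp
  then show ?thesis using herm_re_carrier[OF A] herm_im_carrier[OF A] by (simp add: mat_form_add mat_form_smult)
qed

section \<open>Continuity and signs of the eigenvalues along the pencil\<close>

text \<open>A crude norm bound: the product of two coordinate moduli is at most the squared norm, so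
  the sum of the moduli of the matrix entries serves as \<open>C\<close>.\<close>

lemma mat_form_bound:
  obtains C where "C \<ge> 0" "\<And>x. \<bar>Re (mat_form n K x x)\<bar> \<le> C * Re (mat_form n (1\<^sub>m n) x x)"
proof
  let ?C = "\<Sum>i<n. \<Sum>j<n. cmod (K $$ (i, j))"
  show "?C \<ge> 0" by (intro sum_nonneg) simp
  fix x :: "nat \<Rightarrow> complex"
  let ?S = "\<Sum>i<n. (cmod (x i))\<^sup>2"
  have le: "(cmod (x i))\<^sup>2 \<le> ?S" if "i < n" for i using that by (intro member_le_sum) auto
  have "\<bar>Re (mat_form n K x x)\<bar> \<le> cmod (mat_form n K x x)" by (rule abs_Re_le_cmod)
  also have "\<dots> \<le> (\<Sum>i<n. \<Sum>j<n. cmod (cnj (x i) * K $$ (i, j) * x j))"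
    unfolding mat_form_def by (intro sum_norm_le order_refl)
  also have "\<dots> \<le> (\<Sum>i<n. \<Sum>j<n. cmod (K $$ (i, j)) * ?S)"
  proof (intro sum_mono)
    fix i j assume ij: "i \<in> {..<n}" "j \<in> {..<n}"
    have "2 * (cmod (x i) * cmod (x j)) \<le> (cmod (x i))\<^sup>2 + (cmod (x j))\<^sup>2"
      using sum_squares_bound[of "cmod (x i)" "cmod (x j)"] by simp
    then have "cmod (x i) * cmod (x j) \<le> ?S" using le[of i] le[of j] ij by simp
    then have "cmod (K $$ (i, j)) * (cmod (x i) * cmod (x j)) \<le> cmod (K $$ (i, j)) * ?S"
      by (rule mult_left_mono) simp
    then show "cmod (cnj (x i) * K $$ (i, j) * x j) \<le> cmod (K $$ (i, j)) * ?S"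
      by (simp add: norm_mult mult_ac)
  qed
  also have "\<dots> = ?C * ?S" by (simp add: sum_distrib_right)
  finally show "\<bar>Re (mat_form n K x x)\<bar> \<le> ?C * Re (mat_form n (1\<^sub>m n) x x)"
    unfolding mat_form_one_diag by simp
qed

text \<open>A form of Weyl's inequality: a subspace witnessing the eigenvalue at \<open>s\<close>
  also serves at \<open>s'\<close> once the bound is lowered by
  \<open>C * \<bar>s' - s\<bar>\<close>. The eigenvalue is therefore Lipschitz in
  \<open>s\<close>.\<close>

lemma continuous_on_herm_eigval:
  assumes A: "A \<in> carrier_mat n n" and k: "1 \<le> k" "k \<le> n"
  shows "continuous_on S (\<lambda>s. herm_eigval (real_pencil_at A s) k)"
proof -
  let ?M = "real_pencil_at A" and ?q = "mat_form n (1\<^sub>m n)"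
  note M = real_pencil_at_carrier[OF A] real_pencil_at_adjoint[OF A]
  obtain C where C: "C \<ge> 0" "\<And>x. \<bar>Re (mat_form n (herm_im A) x x)\<bar> \<le> C * Re (?q x x)"
    using mat_form_bound[of n "herm_im A"] by blast
  have lower: "herm_eigval (?M s) k - C * \<bar>s' - s\<bar> \<le> herm_eigval (?M s') k" for s s'
  proof -
    let ?c = "herm_eigval (?M s) k" and ?c' = "herm_eigval (?M s) k - C * \<bar>s' - s\<bar>"
    have "fn.contains_dim k {x \<in> fn.span (units n). 0 \<le> Re (mat_form n (?M s) x x - complex_of_real ?c * ?q x x)}"
      using herm_eigval_iff_contains_dim(1)[OF M k, where c = ?c and s1 = s] by simp
    then have "fn.contains_dim k {x \<in> fn.span (units n). 0 \<le> Re (mat_form n (?M s') x x - complex_of_real ?c' * ?q x x)}"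
    proof (rule fn.contains_dim_mono[OF _ order_refl], safe)
      fix x assume x: "0 \<le> Re (mat_form n (?M s) x x - complex_of_real ?c * ?q x x)"
      have "\<bar>(s' - s) * Re (mat_form n (herm_im A) x x)\<bar> \<le> \<bar>s' - s\<bar> * (C * Re (?q x x))"
        unfolding abs_mult by (intro mult_left_mono C(2)) simp
      then have "- (C * \<bar>s' - s\<bar> * Re (?q x x)) \<le> (s' - s) * Re (mat_form n (herm_im A) x x)"
        by (simp add: mult_ac abs_le_iff)
      then show "0 \<le> Re (mat_form n (?M s') x x - complex_of_real ?c' * ?q x x)"
        using x by (simp add: mat_form_real_pencil_at[OF A] algebra_simps)
    qed
    then show ?thesis using herm_eigval_iff_contains_dim(1)[OF M k, where c = ?c' and s1 = s'] by simp
  qed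
  have lip: "\<bar>herm_eigval (?M s') k - herm_eigval (?M s) k\<bar> \<le> C * \<bar>s' - s\<bar>" for s s'
    using lower[of s s'] lower[of s' s] by (simp add: abs_if split: if_splits)
  show ?thesis
  proof (rule continuous_at_imp_continuous_on, rule ballI)
    fix s :: real
    have "((\<lambda>s'. s' - s) \<longlongrightarrow> 0) (at s)" by (rule LIM_zero) (rule tendsto_ident_at)
    then have "((\<lambda>s'. herm_eigval (?M s') k - herm_eigval (?M s) k) \<longlongrightarrow> 0) (at s)"
      by (rule tendsto_0_le[where K = C]) (use lip in \<open>simp add: mult.commute\<close>)
    then show "isCont (\<lambda>s. herm_eigval (?M s) k) s" unfolding isCont_def using LIM_zero_iff by blast
  qed
qed

text \<open>Near a point of \<open>S\<close>, nonzero values keep their sign, so the set of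
  vanishing indices can only shrink. As its size is constant it stays the same, every sign is
  locally constant, and connectedness concludes.\<close>

lemma sgn_constant_of_card_zeros:
  fixes \<mu> :: "nat \<Rightarrow> real \<Rightarrow> real"
  assumes S: "connected S" "s \<in> S" "s' \<in> S" and cont: "\<And>j. j < n \<Longrightarrow> continuous_on S (\<mu> j)"
    and card: "\<And>s. s \<in> S \<Longrightarrow> card {j. j < n \<and> \<mu> j s = 0} = d" and j: "j < n"
  shows "sgn (\<mu> j s) = sgn (\<mu> j s')"
proof (rule connected_local_const[OF S], rule ballI)
  fix s assume s: "s \<in> S"
  have "eventually (\<lambda>s'. \<mu> i s \<noteq> 0 \<longrightarrow> sgn (\<mu> i s') = sgn (\<mu> i s)) (at s within S)" if i: "i < n" for i
  proof (cases "\<mu> i s" "0 :: real" rule: linorder_cases)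
    case less
    have "(\<mu> i \<longlongrightarrow> \<mu> i s) (at s within S)" using cont[OF i] s by (simp add: continuous_on_def)
    then have "eventually (\<lambda>s'. \<mu> i s' < 0) (at s within S)" using less by (rule order_tendstoD)
    then show ?thesis using less by (auto elim: eventually_mono)
  next
    case greater
    have "(\<mu> i \<longlongrightarrow> \<mu> i s) (at s within S)" using cont[OF i] s by (simp add: continuous_on_def)
    then have "eventually (\<lambda>s'. 0 < \<mu> i s') (at s within S)" using greater by (rule order_tendstoD)
    then show ?thesis using greater by (auto elim: eventually_mono)
  qed simp
  then have "eventually (\<lambda>s'. \<forall>i\<in>{..<n}. \<mu> i s \<noteq> 0 \<longrightarrow> sgn (\<mu> i s') = sgn (\<mu> i s)) (at s within S)"
    by (intro eventually_ball_finite) auto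
  moreover have "eventually (\<lambda>s'. s' \<in> S) (at s within S)" by (simp add: eventually_at_filter)
  ultimately show "eventually (\<lambda>s'. sgn (\<mu> j s) = sgn (\<mu> j s')) (at s within S)"
  proof eventually_elim
    case (elim s')
    have "{i. i < n \<and> \<mu> i s' = 0} \<subseteq> {i. i < n \<and> \<mu> i s = 0}" using elim(1) by (force simp: sgn_if split: if_splits)
    then have "{i. i < n \<and> \<mu> i s' = 0} = {i. i < n \<and> \<mu> i s = 0}"
      using card[OF s] card[OF elim(2)] by (intro card_subset_eq) auto
    then have "\<mu> j s' = 0 \<longleftrightarrow> \<mu> j s = 0" using j by blast
    then show ?case using elim(1) j by (cases "\<mu> j s = 0") auto
  qed
qed

section \<open>The determinant polynomial\<close>

text \<open>Acts on the coefficients with respect to \<open>t\<close>, so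
  \<open>map_poly (eval2 x y)\<close> leaves a univariate polynomial in \<open>t\<close>.\<close>

definition eval2 :: "'a::comm_ring_1 \<Rightarrow> 'a \<Rightarrow> 'a poly poly \<Rightarrow> 'a" where
  "eval2 x y c = poly (poly c [:x:]) y"

lemma eval2_hom: "comm_ring_hom (eval2 x y)"
  by unfold_locales (auto simp: eval2_def)

lemma eval2_semiring_hom: "comm_semiring_hom (eval2 x y)"
  by unfold_locales (auto simp: eval2_def)

lemma map_eval2_hom: "comm_ring_hom (map_poly (eval2 x y))"
proof -
  interpret map_poly_comm_ring_hom "eval2 x y"
    using eval2_hom by (simp add: map_poly_comm_ring_hom_def)
  show ?thesis by (rule comm_ring_hom_axioms)
qed

lemma poly_map_eval2: "poly (map_poly (eval2 x y) p) t = eval2 x y (poly p [:[:t:]:])"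
proof -
  interpret comm_ring_hom "eval2 x y" by (rule eval2_hom)
  have "eval2 x y [:[:t:]:] = t" by (simp add: eval2_def)
  then show ?thesis using poly_map_poly[of p "[:[:t:]:]"] by simp
qed

lemma eval2_of_real:
  "eval2 (complex_of_real x) (complex_of_real y) (poly (map_poly3 complex_of_real p) [:[:complex_of_real t:]:])
    = complex_of_real (eval2 x y (poly p [:[:t:]:]))"
proof -
  interpret h1: map_poly_comm_ring_hom complex_of_real by unfold_locales auto
  interpret h2: map_poly_comm_ring_hom "map_poly complex_of_real" ..
  have h: "comm_semiring_hom complex_of_real" by unfold_locales auto
  note pm0 = comm_semiring_hom.poly_map_poly[OF h]
    and pm1 = comm_semiring_hom.poly_map_poly[OF h1.comm_semiring_hom_axioms]
    and pm2 = comm_semiring_hom.poly_map_poly[OF h2.comm_semiring_hom_axioms]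
  have c: "map_poly (map_poly complex_of_real) [:[:t:]:] = [:[:complex_of_real t:]:]"
    "map_poly complex_of_real [:x:] = [:complex_of_real x:]"
    by (auto intro!: poly_eqI simp: coeff_map_poly coeff_pCons split: nat.splits)
  show ?thesis unfolding eval2_def c[symmetric] pm2 pm1 pm0 ..
qed

lemma pencil_poly_eval:
  assumes A: "A \<in> carrier_mat n n"
  shows "complex_of_real (poly (map_poly (eval2 x y) (pencil_poly A)) t)
    = det (complex_of_real t \<cdot>\<^sub>m 1\<^sub>m n + complex_of_real x \<cdot>\<^sub>m herm_re A + complex_of_real y \<cdot>\<^sub>m herm_im A)"
proof -
  define E where "E p = eval2 (complex_of_real x) (complex_of_real y) (poly p [:[:complex_of_real t:]:])" for p
  have E: "comm_ring_hom E" by unfold_locales (auto simp: E_def eval2_def)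
  have "complex_of_real (poly (map_poly (eval2 x y) (pencil_poly A)) t) = E (det (pencil A))"
    unfolding poly_map_eval2 E_def eval2_of_real[symmetric] of_real_pencil_poly[OF A] ..
  also have "\<dots> = det (map_mat E (pencil A))" by (rule comm_ring_hom.hom_det[OF E, symmetric])
  also have "map_mat E (pencil A) = complex_of_real t \<cdot>\<^sub>m 1\<^sub>m n + complex_of_real x \<cdot>\<^sub>m herm_re A + complex_of_real y \<cdot>\<^sub>m herm_im A"
    using A herm_re_carrier[OF A] herm_im_carrier[OF A]
    by (intro eq_matI) (auto simp: pencil_def E_def eval2_def var_t_def var_x_def var_y_def const3_def)
  finally show ?thesis .
qed

text \<open>Up to the factor \<open>(-1) ^ n\<close>, the determinant is the characteristic
  polynomial at \<open>- t\<close>, so its roots are the negated eigenvalues.\<close>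

lemma pencil_poly_eval_pencil_at:
  assumes A: "A \<in> carrier_mat n n"
  shows "map_poly (eval2 1 s) (pencil_poly A) = (\<Prod>x\<leftarrow>herm_eigvals (real_pencil_at A s). [:x, 1:])"
proof -
  let ?M = "real_pencil_at A s"
  let ?L = "herm_eigvals ?M"
  note M = real_pencil_at_carrier[OF A, of s] real_pencil_at_adjoint[OF A, of s]
  note eig = herm_eigvals_char_poly[OF M]
  have "poly (map_poly (eval2 1 s) (pencil_poly A)) t = poly (\<Prod>x\<leftarrow>?L. [:x, 1:]) t" for t
  proof -
    let ?t = "complex_of_real t"
    have "complex_of_real (poly (map_poly (eval2 1 s) (pencil_poly A)) t) = det (?t \<cdot>\<^sub>m 1\<^sub>m n + ?M)"
      unfolding pencil_poly_eval[OF A] real_pencil_at_def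
      using herm_re_carrier[OF A] herm_im_carrier[OF A] by (intro arg_cong[of _ _ det] eq_matI) auto
    also have "?t \<cdot>\<^sub>m 1\<^sub>m n + ?M = (-1) \<cdot>\<^sub>m ((- ?t) \<cdot>\<^sub>m 1\<^sub>m n - ?M)"
      using M(1) by (intro eq_matI) auto
    also have "det \<dots> = (-1) ^ n * det ((- ?t) \<cdot>\<^sub>m 1\<^sub>m n - ?M)" using M(1) by (simp add: det_smult)
    also have "det ((- ?t) \<cdot>\<^sub>m 1\<^sub>m n - ?M) = poly (\<Prod>x\<leftarrow>?L. [:- complex_of_real x, 1:]) (- ?t)"
      unfolding poly_char_poly_det[OF M(1), symmetric] eig(1) ..
    also have "\<dots> = (\<Prod>x\<leftarrow>?L. - ?t - complex_of_real x)"
    proof -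
      have "poly (\<Prod>x\<leftarrow>L. [:- complex_of_real x, 1:]) z = (\<Prod>x\<leftarrow>L. z - complex_of_real x)" for L z
        by (induct L) (simp_all add: algebra_simps)
      then show ?thesis .
    qed
    also have "(-1) ^ n * \<dots> = complex_of_real (\<Prod>x\<leftarrow>?L. t + x)"
    proof -
      have "(-1) ^ length L * (\<Prod>x\<leftarrow>L. - ?t - complex_of_real x) = complex_of_real (\<Prod>x\<leftarrow>L. t + x)" for L
        by (induct L) (simp_all add: algebra_simps)
      from this[of ?L] show ?thesis unfolding eig(2) .
    qed
    also have "(\<Prod>x\<leftarrow>?L. t + x) = poly (\<Prod>x\<leftarrow>?L. [:x, 1:]) t"
      by (simp add: poly_prod_list o_def add.commute)
    finally show ?thesis by (simp only: of_real_eq_iff)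
  qed
  then show ?thesis using poly_eq_poly_eq_iff by blast
qed

text \<open>The scalar \<open>x\<close> is pulled out of the matrix. Thus the slice
  \<open>x = 1\<close> controls the polynomial wherever \<open>x\<close> is nonzero.\<close>

lemma pencil_poly_homogeneous:
  assumes A: "A \<in> carrier_mat n n" and x: "x \<noteq> 0"
  shows "poly (map_poly (eval2 x y) (pencil_poly A)) (x * t) = x ^ n * poly (map_poly (eval2 1 (y / x)) (pencil_poly A)) t"
proof -
  let ?N = "complex_of_real t \<cdot>\<^sub>m 1\<^sub>m n + complex_of_real 1 \<cdot>\<^sub>m herm_re A + complex_of_real (y / x) \<cdot>\<^sub>m herm_im A"
  have c: "herm_re A \<in> carrier_mat n n" "herm_im A \<in> carrier_mat n n"
    using herm_re_carrier[OF A] herm_im_carrier[OF A] by auto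
  have "complex_of_real (x * t) \<cdot>\<^sub>m 1\<^sub>m n + complex_of_real x \<cdot>\<^sub>m herm_re A + complex_of_real y \<cdot>\<^sub>m herm_im A = complex_of_real x \<cdot>\<^sub>m ?N"
    using c x by (intro eq_matI) (auto simp: algebra_simps)
  then have "complex_of_real (poly (map_poly (eval2 x y) (pencil_poly A)) (x * t)) = det (complex_of_real x \<cdot>\<^sub>m ?N)"
    unfolding pencil_poly_eval[OF A] by simp
  also have "\<dots> = complex_of_real x ^ n * det ?N" using c by (simp add: det_smult)
  also have "\<dots> = complex_of_real (x ^ n * poly (map_poly (eval2 1 (y / x)) (pencil_poly A)) t)"
    unfolding pencil_poly_eval[OF A, symmetric] by simp
  finally show ?thesis by (simp only: of_real_eq_iff)
qed

lemma test_line_linear: "test_line a b = [:[:[:0, b:], [:a:]:], 1:]"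
  by (simp add: test_line_def var_t_def var_x_def var_y_def const3_def)

lemma map_eval2_test_line: "map_poly (eval2 x y) (test_line a b) = [:a * x + b * y, 1:]"
  by (simp add: test_line_linear map_poly_pCons eval2_def mult.commute add.commute)

lemma pencil_poly_factor:
  assumes A: "A \<in> carrier_mat n n"
  shows "pencil_poly A = test_line a b ^ line_mult A a b * reduced_poly A a b"
  unfolding reduced_poly_def using line_mult(1)[OF A] by (simp add: dvd_mult_div_cancel)

lemma map_eval2_factor:
  assumes A: "A \<in> carrier_mat n n"
  shows "map_poly (eval2 x y) (pencil_poly A)
    = [:a * x + b * y, 1:] ^ line_mult A a b * map_poly (eval2 x y) (reduced_poly A a b)"
proof -
  interpret comm_ring_hom "map_poly (eval2 x y)" by (rule map_eval2_hom)
  show ?thesis using arg_cong[OF pencil_poly_factor[OF A, of a b], of "map_poly (eval2 x y)"]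
    by (simp add: hom_mult hom_power map_eval2_test_line)
qed

lemma poly_restricted:
  "poly (restricted_poly A a b) s = poly (map_poly (eval2 1 s) (reduced_poly A a b)) (- a - b * s)"
proof -
  interpret comm_ring_hom "eval2 1 s" by (rule eval2_hom)
  have "eval2 1 s [:[:- a, - b:]:] = - a - b * s" by (simp add: eval2_def)
  then show ?thesis using poly_map_poly[of "reduced_poly A a b" "[:[:- a, - b:]:]"]
    by (simp add: restricted_poly_def eval2_def one_pCons mult.commute)
qed

text \<open>
  If the restricted polynomial were zero, then by homogeneity the reduced polynomial would vanish
  on the whole plane \<open>t = - a x - b y\<close>, so the line could be split off once more.
\<close>

lemma restricted_poly_nonzero:
  assumes A: "A \<in> carrier_mat n n"
  shows "restricted_poly A a b \<noteq> 0"
proof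
  assume zero: "restricted_poly A a b = 0"
  let ?F = "reduced_poly A a b" and ?d = "line_mult A a b"
  \<comment> \<open>The substitution \<open>t = - a * x - b * y\<close>, written as a polynomial in
    \<open>x\<close> with coefficients in \<open>y\<close>.\<close>
  define r where "r = poly ?F [:[:0, - b:], [:- a:]:]"
  have vanish: "eval2 x y r = 0" if x: "x \<noteq> 0" for x y
  proof -
    let ?s = "y / x"
    let ?p = "smult (x ^ ?d) (map_poly (eval2 x y) ?F \<circ>\<^sub>p [:0, x:])"
    let ?p' = "smult (x ^ n) (map_poly (eval2 1 ?s) ?F)"
    \<comment> \<open>The reduced polynomial inherits homogeneity by cancelling the power of the
      line. This has to happen between polynomials in \<open>t\<close>, as the line vanishes at the
      very value of \<open>t\<close> that is substituted afterwards.\<close>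
    have "poly ([:a + b * ?s, 1:] ^ ?d * ?p) t = poly ([:a + b * ?s, 1:] ^ ?d * ?p') t" for t
    proof -
      have e: "a * x + b * y + x * t = x * (a + b * ?s + t)" using x by (simp add: field_simps)
      have "poly ([:a + b * ?s, 1:] ^ ?d * ?p) t = (x * (a + b * ?s + t)) ^ ?d * poly (map_poly (eval2 x y) ?F) (x * t)"
        by (simp add: poly_pcompose power_mult_distrib mult_ac)
      also have "\<dots> = poly (map_poly (eval2 x y) (pencil_poly A)) (x * t)"
        unfolding map_eval2_factor[OF A, of x y a b] using e by simp
      also have "\<dots> = x ^ n * poly (map_poly (eval2 1 ?s) (pencil_poly A)) t" by (rule pencil_poly_homogeneous[OF A x])
      also have "\<dots> = poly ([:a + b * ?s, 1:] ^ ?d * ?p') t"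
        unfolding map_eval2_factor[OF A, of 1 ?s a b] by simp
      finally show ?thesis .
    qed
    then have "[:a + b * ?s, 1:] ^ ?d * ?p = [:a + b * ?s, 1:] ^ ?d * ?p'" using poly_eq_poly_eq_iff by blast
    then have "?p = ?p'" by (simp only: mult_cancel_left) simp
    then have "poly ?p (- a - b * ?s) = poly ?p' (- a - b * ?s)" by simp
    also have "\<dots> = 0" using poly_restricted[of A a b ?s] zero by simp
    finally have "poly (map_poly (eval2 x y) ?F) (x * (- a - b * ?s)) = 0" using x by (simp add: poly_pcompose mult.commute)
    moreover have "x * (- a - b * ?s) = eval2 x y [:[:0, - b:], [:- a:]:]" using x by (simp add: eval2_def field_simps)
    ultimately show ?thesis
      using comm_semiring_hom.poly_map_poly[OF eval2_semiring_hom[of x y], of ?F "[:[:0, - b:], [:- a:]:]"]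
      by (simp add: r_def)
  qed
  have "poly r [:x:] = 0" if "x \<noteq> 0" for x
  proof -
    have "poly (poly r [:x:]) y = poly 0 y" for y using vanish[OF that, of y] by (simp add: eval2_def)
    then show ?thesis using poly_eq_poly_eq_iff by blast
  qed
  \<comment> \<open>Homogeneity says nothing at \<open>x = 0\<close>, but the nonzero constants are
    already infinitely many roots of \<open>r\<close> over the polynomials in
    \<open>y\<close>.\<close>
  then have "(\<lambda>x :: real. [:x:]) ` (- {0}) \<subseteq> {z. poly r z = 0}" by auto
  moreover have "infinite ((\<lambda>x :: real. [:x:]) ` (- {0}))"
    using infinite_UNIV_char_0[where 'a = real] by (subst finite_image_iff) (auto simp: inj_on_def Compl_eq_Diff_UNIV)
  ultimately have "r = 0" using poly_roots_finite[of r] finite_subset by blast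
  then have "test_line a b dvd ?F" unfolding r_def poly_eq_0_iff_dvd test_line_linear by simp
  then have "test_line a b ^ Suc ?d dvd pencil_poly A"
    by (subst pencil_poly_factor[OF A, of a b]) (simp add: mult.commute mult_dvd_mono)
  then show False using line_mult(2)[OF A] by fastforce
qed

section \<open>Eigenvalues on the line and the gaps between the roots\<close>

text \<open>The count is the order of the root \<open>- (a + b * s)\<close> of the determinant at
  \<open>x = 1\<close>, \<open>y = s\<close>. The power of the line contributes
  \<open>line_mult A a b\<close>, and the reduced factor nothing, since its value there is the
  restricted polynomial at \<open>s\<close>.\<close>

lemma card_eigvals_on_line:
  assumes A: "A \<in> carrier_mat n n" and s: "poly (restricted_poly A a b) s \<noteq> 0"
  shows "card {j. j < n \<and> herm_eigvals (real_pencil_at A s) ! j - (a + b * s) = 0} = line_mult A a b"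
proof -
  let ?L = "herm_eigvals (real_pencil_at A s)" and ?F = "map_poly (eval2 1 s) (reduced_poly A a b)"
  let ?c = "a + b * s"
  have L: "length ?L = n" using herm_eigvals_char_poly(2)[OF real_pencil_at_carrier[OF A] real_pencil_at_adjoint[OF A]] .
  have p: "(\<Prod>x\<leftarrow>?L. [:x, 1:]) = [:?c, 1:] ^ line_mult A a b * ?F"
    using map_eval2_factor[OF A, of 1 s a b] pencil_poly_eval_pencil_at[OF A, of s] by simp
  have F: "poly ?F (- ?c) \<noteq> 0" using s by (simp add: poly_restricted)
  have p0: "(\<Prod>x\<leftarrow>?L. [:x, 1:]) \<noteq> 0" by (auto simp: prod_list_zero_iff)
  have "order (- ?c) (\<Prod>x\<leftarrow>?L. [:x, 1:]) = order (- ?c) ([:- (- ?c), 1:] ^ line_mult A a b) + order (- ?c) ?F"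
    using p0 unfolding p minus_minus by (rule order_mult)
  also have "\<dots> = line_mult A a b" using order_0I[OF F] by (simp only: order_power_n_n)
  finally have 1: "count (proots (\<Prod>x\<leftarrow>?L. [:x, 1:])) (- ?c) = line_mult A a b" using p0 by simp
  have 2: "proots (\<Prod>x\<leftarrow>?L. [:x, 1:]) = mset (map uminus ?L)"
    using proots_linear_factors[of "map uminus ?L"] by (simp add: o_def)
  have 3: "count (mset (map uminus L)) (- c) = length (filter (\<lambda>x. x - c = 0) L)" for L and c :: real
    by (induct L) auto
  have "length (filter (\<lambda>x. x - ?c = 0) ?L) = line_mult A a b" using 1 unfolding 2 3 .
  then show ?thesis unfolding length_filter_conv_card L .
qed

text \<open>The index \<open>i\<close> counts the roots below \<open>s\<close>. In the 0-based list
  the gap containing \<open>s\<close> is bounded by \<open>L ! (i - 1)\<close> and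
  \<open>L ! i\<close>, as far as these exist, and the test point with index \<open>i\<close> lies
  in the same gap.\<close>

lemma test_point_in_gap:
  assumes A: "A \<in> carrier_mat n n" and s: "poly (restricted_poly A a b) s \<noteq> 0"
  obtains i where "i \<in> {0..num_roots A a b}"
    "\<And>r. poly (restricted_poly A a b) r = 0 \<Longrightarrow> (r < s \<and> r < test_point A a b i) \<or> (s < r \<and> test_point A a b i < r)"
proof -
  let ?R = "{y. poly (restricted_poly A a b) y = 0}"
  define L where "L = root_list A a b"
  have fin: "finite ?R" by (rule poly_roots_finite[OF restricted_poly_nonzero[OF A]])
  have L: "sorted L" "set L = ?R" using fin by (simp_all add: L_def root_list_def)
  have m: "num_roots A a b = length L" by (simp add: num_roots_def L_def)
  define i where "i = length (filter (\<lambda>r. r < s) L)"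
  have lt: "L ! j < s \<longleftrightarrow> j < i" if "j < length L" for j
    unfolding i_def using sorted_filter_nth[of "(\<le>)" L "\<lambda>r. r < s" j] L(1) that by auto
  have gt: "s < L ! j" if "i \<le> j" "j < length L" for j
  proof -
    have "L ! j \<noteq> s" using s L(2) nth_mem[OF that(2)] by auto
    then show ?thesis using lt[OF that(2)] that(1) by auto
  qed
  have mono: "L ! j \<le> L ! l" if "j \<le> l" "l < length L" for j l using sorted_nth_mono[OF L(1)] that by blast
  have i: "i \<le> length L" by (simp add: i_def)
  have tp: "test_point A a b i = (if length L = 0 then 0 else if i = 0 then L ! 0 - 1
      else if i = length L then L ! (length L - 1) + 1 else (L ! (i - 1) + L ! i) / 2)"
    by (simp add: test_point_def num_roots_def L_def[symmetric] Let_def)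
  have left: "L ! j < test_point A a b i" if "j < i" for j
  proof (cases "i = length L")
    case True
    then have "L ! j \<le> L ! (length L - 1)" using that by (intro mono) auto
    then show ?thesis using that True unfolding tp by auto
  next
    case False
    then have "L ! j \<le> L ! (i - 1)" "L ! (i - 1) < s" "s < L ! i"
      using that i mono[of j "i - 1"] lt[of "i - 1"] gt[of i] by auto
    then show ?thesis using that False i unfolding tp by auto
  qed
  have right: "test_point A a b i < L ! j" if "i \<le> j" "j < length L" for j
  proof (cases "i = 0")
    case True
    then show ?thesis using that mono[of 0 j] unfolding tp by auto
  next
    case False
    then have "L ! i \<le> L ! j" "L ! (i - 1) < s" "s < L ! i"
      using that i mono[of i j] lt[of "i - 1"] gt[of i] by auto
    then show ?thesis using that False i unfolding tp by auto
  qed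
  show thesis
  proof (rule that[of i])
    show "i \<in> {0..num_roots A a b}" using i m by simp
    fix r assume "poly (restricted_poly A a b) r = 0"
    then have "r \<in> set L" using L(2) by simp
    then obtain j where j: "j < length L" "r = L ! j" by (auto simp: in_set_conv_nth)
    show "(r < s \<and> r < test_point A a b i) \<or> (s < r \<and> test_point A a b i < r)"
      using j lt[OF j(1)] gt[of j] left[of j] right[of j] by (cases "j < i") auto
  qed
qed

text \<open>The interval between \<open>s\<close> and its test point is free of roots, so the number
  of eigenvalues on the line is constant along it. One test point has to serve the indices
  \<open>k\<close> and \<open>n - k + 1\<close> together, hence the quantifier inside.\<close>

lemma sgn_eigvals_test_point:
  assumes A: "A \<in> carrier_mat n n" and s: "poly (restricted_poly A a b) s \<noteq> 0"
  obtains i where "i \<in> {0..num_roots A a b}"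
    "\<And>k. 1 \<le> k \<Longrightarrow> k \<le> n \<Longrightarrow> sgn (herm_eigval (real_pencil_at A s) k - (a + b * s))
      = sgn (herm_eigval (real_pencil_at A (test_point A a b i)) k - (a + b * test_point A a b i))"
proof -
  obtain i where i: "i \<in> {0..num_roots A a b}"
    "\<And>r. poly (restricted_poly A a b) r = 0 \<Longrightarrow> (r < s \<and> r < test_point A a b i) \<or> (s < r \<and> test_point A a b i < r)"
    using test_point_in_gap[OF A s] by blast
  define p where "p = test_point A a b i"
  define S where "S = {min s p..max s p}"
  have S: "connected S" "s \<in> S" "p \<in> S" by (auto simp: S_def)
  have noroot: "poly (restricted_poly A a b) r \<noteq> 0" if "r \<in> S" for r
  proof
    assume "poly (restricted_poly A a b) r = 0"
    from i(2)[OF this] that show False by (auto simp: S_def p_def)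
  qed
  have "sgn (herm_eigval (real_pencil_at A s) k - (a + b * s)) = sgn (herm_eigval (real_pencil_at A p) k - (a + b * p))"
    if k: "1 \<le> k" "k \<le> n" for k
  proof -
    let ?\<mu> = "\<lambda>j s. herm_eigvals (real_pencil_at A s) ! j - (a + b * s)"
    have cont: "continuous_on S (?\<mu> j)" if "j < n" for j
      using continuous_on_herm_eigval[OF A, of "Suc j" S] that
      by (intro continuous_intros) (simp add: herm_eigval_def)
    have "sgn (?\<mu> (k - 1) s) = sgn (?\<mu> (k - 1) p)"
      by (rule sgn_constant_of_card_zeros[OF S cont]) (use card_eigvals_on_line[OF A noroot] k in auto)
    then show ?thesis by (simp add: herm_eigval_def)
  qed
  then show thesis using that i(1) by (simp add: p_def)
qed

section \<open>Correctness of the test\<close>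

context
  fixes A :: "complex mat" and n k :: nat and a b :: real
  assumes A: "A \<in> carrier_mat n n" and k: "1 \<le> k" "k \<le> n"
begin

abbreviation (input) "inner \<equiv> mat_form n (1\<^sub>m n)"
abbreviation (input) "re_form \<equiv> (\<lambda>x y. mat_form n (herm_re A) x y - complex_of_real a * inner x y)"
abbreviation (input) "im_form \<equiv> (\<lambda>x y. mat_form n (herm_im A) x y - complex_of_real b * inner x y)"

lemma hermitian_parts:
  "fn.hermitian_form (mat_form n (herm_re A))" "fn.hermitian_form (mat_form n (herm_im A))"
  "fn.hermitian_form re_form" "fn.hermitian_form im_form"
proof -
  show "fn.hermitian_form (mat_form n (herm_re A))" "fn.hermitian_form (mat_form n (herm_im A))"
    using hermitian_mat_form herm_re_carrier[OF A] herm_re_adjoint[OF A] herm_im_carrier[OF A] herm_im_adjoint[OF A]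
    by blast+
  then show "fn.hermitian_form re_form" "fn.hermitian_form im_form"
    using fn.hermitian_form_pencil[OF _ hermitian_mat_form_one] by blast+
qed

text \<open>The columns of \<open>X\<close> form an orthonormal basis of the isotropic subspace.
  Conversely, an orthonormal basis of the subspace provides the columns, and polarization makes the
  off-diagonal entries vanish.\<close>

lemma rank_num_range_iff_isotropic:
  "Complex a b \<in> rank_num_range k A \<longleftrightarrow>
    fn.contains_dim k {x \<in> fn.span (units n). re_form x x = 0 \<and> im_form x x = 0}"
proof
  assume "Complex a b \<in> rank_num_range k A"
  then obtain X where X: "X \<in> carrier_mat n k" "mat_adjoint X * X = 1\<^sub>m k"
    "mat_adjoint X * A * X = Complex a b \<cdot>\<^sub>m 1\<^sub>m k" using A by (auto simp: rank_num_range_def)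
  define u where "u j = (\<lambda>i. if i < n then X $$ (i, j) else 0)" for j
  have uX: "u j l = X $$ (l, j)" if "l < n" for j l using that by (simp add: u_def)
  have orth: "inner (u i) (u j) = (if i = j then 1 else 0)" if "i < k" "j < k" for i j
    using adjoint_mult_self_index[OF X(1) that, of "u i" "u j"] uX X(2) that by simp
  have Auu: "mat_form n A (u i) (u j) = (if i = j then Complex a b else 0)" if "i < k" "j < k" for i j
    using adjoint_mult_index[OF X(1) A that, of "u i" "u j"] uX X(3) that
    by (cases "i = j") simp_all
  have zero: "re_form (u i) (u j) = 0" "im_form (u i) (u j) = 0" if ij: "i < k" "j < k" for i j
  proof -
    let ?h = "mat_form n (herm_re A) (u i) (u j)" and ?g = "mat_form n (herm_im A) (u i) (u j)"
    have "mat_form n (herm_re A) (u j) (u i) = cnj ?h" "mat_form n (herm_im A) (u j) (u i) = cnj ?g"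
      using fn.hermitian_formD(2) hermitian_parts(1,2) by blast+
    \<comment> \<open>The entries at \<open>(i, j)\<close> and \<open>(j, i)\<close> together
      separate the two Hermitian parts, whose values at \<open>(j, i)\<close> are the conjugates of
      those at \<open>(i, j)\<close>.\<close>
    then have "?h + \<i> * ?g = (if i = j then Complex a b else 0)"
      "cnj ?h + \<i> * cnj ?g = (if i = j then Complex a b else 0)"
      using Auu[OF ij] Auu[OF ij(2,1)] by (simp_all add: mat_form_herm_parts[OF A] split: if_splits)
    then have "?h = (if i = j then complex_of_real a else 0)" "?g = (if i = j then complex_of_real b else 0)"
      by (auto simp: complex_eq_iff split: if_splits)
    then show "re_form (u i) (u j) = 0" "im_form (u i) (u j) = 0" using orth[OF ij] by simp_all
  qed
  note indep = fn.independent_orthonormal[OF hermitian_mat_form_one orth]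
  have "u ` {..<k} \<subseteq> fn.span (units n)" unfolding span_units by (auto simp: u_def)
  then have "fn.span (u ` {..<k}) \<subseteq> fn.span (units n)" by (simp add: fn.span_minimal)
  moreover have "re_form x x = 0 \<and> im_form x x = 0" if "x \<in> fn.span (u ` {..<k})" for x
    using fn.form_zero_on_span[OF hermitian_parts(3) _ that] fn.form_zero_on_span[OF hermitian_parts(4) _ that] zero
    by auto
  ultimately show "fn.contains_dim k {x \<in> fn.span (units n). re_form x x = 0 \<and> im_form x x = 0}"
    using indep by (intro fn.contains_dimI[of "u ` {..<k}"]) auto
next
  assume "fn.contains_dim k {x \<in> fn.span (units n). re_form x x = 0 \<and> im_form x x = 0}"
  then obtain B where B: "finite B" "fn.independent B" "card B = k"
    and iso: "fn.span B \<subseteq> {x \<in> fn.span (units n). re_form x x = 0 \<and> im_form x x = 0}"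
    by (rule fn.contains_dimE)
  have "0 < Re (inner x x)" if "x \<in> fn.span B" "x \<noteq> 0" for x
    using mat_form_one_pos that iso by blast
  then obtain u where u: "\<And>j. j < k \<Longrightarrow> u j \<in> fn.span B"
    "\<And>i j. i < k \<Longrightarrow> j < k \<Longrightarrow> inner (u i) (u j) = (if i = j then 1 else 0)"
    using fn.orthonormal_family[OF hermitian_mat_form_one B] by blast
  have zero: "re_form x y = 0" "im_form x y = 0" if "x \<in> fn.span B" "y \<in> fn.span B" for x y
    using fn.form_polarization[OF hermitian_parts(3) fn.subspace_span _ that]
      fn.form_polarization[OF hermitian_parts(4) fn.subspace_span _ that] iso by blast+
  define X where "X = mat n k (\<lambda>(i, j). u j i)"
  have X: "X \<in> carrier_mat n k" by (simp add: X_def)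
  note X' = mat_adjoint_carrier[OF X]
  have uX: "u j l = X $$ (l, j)" if "j < k" "l < n" for j l using that by (simp add: X_def)
  have "mat_adjoint X * X = 1\<^sub>m k"
  proof (rule eq_matI)
    fix i j assume "i < dim_row (1\<^sub>m k :: complex mat)" "j < dim_col (1\<^sub>m k :: complex mat)"
    then have ij: "i < k" "j < k" by simp_all
    show "(mat_adjoint X * X) $$ (i, j) = 1\<^sub>m k $$ (i, j)"
      using adjoint_mult_self_index[OF X ij, of "u i" "u j"] uX ij u(2) by simp
  qed (use X X' in auto)
  moreover have "mat_adjoint X * A * X = Complex a b \<cdot>\<^sub>m 1\<^sub>m k"
  proof (rule eq_matI)
    fix i j assume "i < dim_row (Complex a b \<cdot>\<^sub>m 1\<^sub>m k :: complex mat)" "j < dim_col (Complex a b \<cdot>\<^sub>m 1\<^sub>m k :: complex mat)"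
    then have ij: "i < k" "j < k" by simp_all
    have "(mat_adjoint X * A * X) $$ (i, j) = mat_form n A (u i) (u j)"
      by (rule adjoint_mult_index[OF X A ij]) (use uX ij in auto)
    also have "\<dots> = (complex_of_real a + \<i> * complex_of_real b) * inner (u i) (u j)"
      unfolding mat_form_herm_parts[OF A] using zero[OF u(1) u(1), OF ij] by (simp add: algebra_simps)
    finally show "(mat_adjoint X * A * X) $$ (i, j) = (Complex a b \<cdot>\<^sub>m 1\<^sub>m k) $$ (i, j)"
      using u(2) ij by (simp add: Complex_eq)
  qed (use X X' A in auto)
  ultimately show "Complex a b \<in> rank_num_range k A" using X A by (auto simp: rank_num_range_def)
qed

lemma eigval_bounds_iff_balanced:
  "a + b * s \<le> herm_eigval (real_pencil_at A s) k \<and> herm_eigval (real_pencil_at A s) (n - k + 1) \<le> a + b * s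
    \<longleftrightarrow> fn.balanced k (fn.pencil_form re_form (\<lambda>x y. - im_form x y) s) (fn.span (units n))"
proof -
  have e: "mat_form n (real_pencil_at A s) x x - complex_of_real (a + b * s) * inner x x
      = fn.pencil_form re_form (\<lambda>x y. - im_form x y) s x x" for x
    by (simp add: mat_form_real_pencil_at[OF A] algebra_simps)
  show ?thesis
    unfolding herm_eigval_iff_contains_dim[OF real_pencil_at_carrier[OF A] real_pencil_at_adjoint[OF A] k]
      fn.balanced_def e ..
qed

text \<open>Necessity holds at every \<open>s\<close>, because an isotropic subspace serves for both
  halves of \<open>balanced\<close>; in particular it covers all test points. Sufficiency is
  \<open>contains_dim_isotropic\<close>.\<close>

lemma rank_num_range_iff_off_finite:
  assumes "finite F"
  shows "Complex a b \<in> rank_num_range k A \<longleftrightarrow>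
    (\<forall>s. s \<notin> F \<longrightarrow> a + b * s \<le> herm_eigval (real_pencil_at A s) k \<and> herm_eigval (real_pencil_at A s) (n - k + 1) \<le> a + b * s)"
    (is "?L \<longleftrightarrow> ?R")
    and "Complex a b \<in> rank_num_range k A \<Longrightarrow>
      a + b * s \<le> herm_eigval (real_pencil_at A s) k \<and> herm_eigval (real_pencil_at A s) (n - k + 1) \<le> a + b * s"
proof -
  have all: "a + b * s \<le> herm_eigval (real_pencil_at A s) k \<and> herm_eigval (real_pencil_at A s) (n - k + 1) \<le> a + b * s"
    if ?L for s
  proof -
    have "fn.contains_dim k {x \<in> fn.span (units n). re_form x x = 0 \<and> im_form x x = 0}"
      using that rank_num_range_iff_isotropic by blast
    then show ?thesis unfolding eigval_bounds_iff_balanced fn.balanced_def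
      by (intro conjI) (erule fn.contains_dim_mono[OF _ order_refl], auto)+
  qed
  then show "a + b * s \<le> herm_eigval (real_pencil_at A s) k \<and> herm_eigval (real_pencil_at A s) (n - k + 1) \<le> a + b * s"
    if ?L using that .
  have ?L if ?R
  proof -
    have "fn.contains_dim k {x \<in> fn.span (units n). re_form x x = 0 \<and> - im_form x x = 0}"
      by (rule fn.contains_dim_isotropic[OF hermitian_parts(3) fn.hermitian_form_minus[OF hermitian_parts(4)]
            finite_units independent_units assms]) (use that eigval_bounds_iff_balanced in blast)
    then show ?thesis by (simp only: rank_num_range_iff_isotropic neg_equal_0_iff_equal)
  qed
  then show "?L \<longleftrightarrow> ?R" using all by blast
qed

end

theorem proposition4p2:
  fixes A :: "complex mat" and n k :: nat and a b :: real
  assumes "A \<in> carrier_mat n n" and "1 \<le> k" and "k \<le> n"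
  shows "(membership_test A k a b \<longleftrightarrow> Complex a b \<in> rank_num_range k A) \<and>
    (Complex a b \<in> rank_num_range k A \<longleftrightarrow>
      (\<forall>i \<in> {0..num_roots A a b}.
         herm_eigval (herm_re A + complex_of_real (test_point A a b i) \<cdot>\<^sub>m herm_im A) k
           \<ge> a + b * test_point A a b i \<and>
         herm_eigval (herm_re A + complex_of_real (test_point A a b i) \<cdot>\<^sub>m herm_im A) (n - k + 1)
           \<le> a + b * test_point A a b i))"
proof -
  let ?C = "\<lambda>s. a + b * s \<le> herm_eigval (real_pencil_at A s) k \<and>
    herm_eigval (real_pencil_at A s) (n - k + 1) \<le> a + b * s"
  define F where "F = {s. poly (restricted_poly A a b) s = 0}"
  have F: "finite F" unfolding F_def by (rule poly_roots_finite[OF restricted_poly_nonzero[OF assms(1)]])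
  have iff: "Complex a b \<in> rank_num_range k A \<longleftrightarrow> (\<forall>i\<in>{0..num_roots A a b}. ?C (test_point A a b i))"
  proof
    assume "Complex a b \<in> rank_num_range k A"
    then show "\<forall>i\<in>{0..num_roots A a b}. ?C (test_point A a b i)"
      using rank_num_range_iff_off_finite(2)[OF assms F] by blast
  next
    assume test: "\<forall>i\<in>{0..num_roots A a b}. ?C (test_point A a b i)"
    \<comment> \<open>Equal signs of the shifted eigenvalues carry both weak inequalities from the
      test point over to \<open>s\<close>.\<close>
    have "?C s" if "s \<notin> F" for s
    proof -
      have "poly (restricted_poly A a b) s \<noteq> 0" using that by (simp add: F_def)
      from sgn_eigvals_test_point[OF assms(1) this] obtain i where i: "i \<in> {0..num_roots A a b}"
        and sg: "\<And>k. 1 \<le> k \<Longrightarrow> k \<le> n \<Longrightarrow> sgn (herm_eigval (real_pencil_at A s) k - (a + b * s))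
          = sgn (herm_eigval (real_pencil_at A (test_point A a b i)) k - (a + b * test_point A a b i))"
        by blast
      have "?C (test_point A a b i)" using test i by blast
      moreover have "0 \<le> x \<longleftrightarrow> 0 \<le> y" "x \<le> 0 \<longleftrightarrow> y \<le> 0" if "sgn x = sgn y" for x y :: real
        using that by (auto simp: sgn_if split: if_splits)
      note this(1)[OF sg[OF assms(2,3)]] this(2)[OF sg[of "n - k + 1"]]
      moreover have "1 \<le> n - k + 1" "n - k + 1 \<le> n" using assms(2,3) by auto
      ultimately show ?thesis by simp
    qed
    then show "Complex a b \<in> rank_num_range k A" using rank_num_range_iff_off_finite(1)[OF assms F] by blast
  qed
  moreover have "membership_test A k a b \<longleftrightarrow> (\<forall>i\<in>{0..num_roots A a b}. ?C (test_point A a b i))"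
    using assms(1) by (auto simp: membership_test_def not_less not_le)
  ultimately show ?thesis unfolding real_pencil_at_def by blast
qed

end
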